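(* Let $G_1$ and $G_2$ be countable groups and $\Gamma=G_1\times G_2$. The following are equivalent: (1) there is a non-degenerate probability measure $\nu$ on $\Gamma$ such that the Poisson–Furstenberg boundary $\partial(\Gamma,\nu)$ is non-trivial while the boundaries $\partial(G_1,\mathrm{pr}_1(\nu))$ and $\partial(G_2,\mathrm{pr}_2(\nu))$ are both trivial; (2) $G_1$ and $G_2$ are both amenable and each of them has a non-trivial ICC factor group.
   Context: A probability measure $\nu$ on a countable group $G$ is non-degenerate if its support generates $G$ as a semigroup. A group is ICC if every non-identity element has an infinite conjugacy class; an ICC factor group of $G$ is a quotient $G/N$ which is ICC. The Poisson–Furstenberg boundary $\partial(G,\nu)$ is the space of ergodic components of the time shift on the trajectory space of the $\nu$-random walk $Z_n=X_1\cdots X_n$ ($X_i$ i.i.d. with law $\nu$); it is trivial if the corresponding $\sigma$-algebra is trivial mod 0. $\mathrm{pr}_j$ is the coordinate projection $G_1\times G_2\to G_j$. *)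

theory Defs
  imports "HOL-Probability.Probability" "HOL-Algebra.Coset"
begin

definition prob_on :: "('a, 'c) monoid_scheme \<Rightarrow> 'a pmf \<Rightarrow> bool" where
  "prob_on G \<nu> \<longleftrightarrow> set_pmf \<nu> \<subseteq> carrier G"

inductive_set sgp_gen :: "('a, 'c) monoid_scheme \<Rightarrow> 'a set \<Rightarrow> 'a set"
  for G :: "('a, 'c) monoid_scheme" and S :: "'a set" where
  base: "x \<in> S \<Longrightarrow> x \<in> sgp_gen G S"
| mult: "x \<in> sgp_gen G S \<Longrightarrow> y \<in> sgp_gen G S \<Longrightarrow> x \<otimes>\<^bsub>G\<^esub> y \<in> sgp_gen G S"

definition nondegenerate :: "('a, 'c) monoid_scheme \<Rightarrow> 'a pmf \<Rightarrow> bool" where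
  "nondegenerate G \<nu> \<longleftrightarrow> sgp_gen G (set_pmf \<nu>) = carrier G"

primrec rw :: "('a, 'c) monoid_scheme \<Rightarrow> (nat \<Rightarrow> 'a) \<Rightarrow> nat \<Rightarrow> 'a" where
  "rw G X 0 = \<one>\<^bsub>G\<^esub>"
| "rw G X (Suc n) = rw G X n \<otimes>\<^bsub>G\<^esub> X n"

definition traj_space :: "(nat \<Rightarrow> 'a) measure" where
  "traj_space = PiM UNIV (\<lambda>_. count_space UNIV)"

definition path_measure :: "('a, 'c) monoid_scheme \<Rightarrow> 'a pmf \<Rightarrow> (nat \<Rightarrow> 'a) measure" where
  "path_measure G \<nu> = distr (PiM UNIV (\<lambda>_. measure_pmf \<nu>)) traj_space (\<lambda>X n. rw G X n)"

definition poisson_trivial :: "('a, 'c) monoid_scheme \<Rightarrow> 'a pmf \<Rightarrow> bool" where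
  "poisson_trivial G \<nu> \<longleftrightarrow>
     (\<forall>A \<in> sets traj_space. (\<lambda>z. z \<circ> Suc) -` A = A \<longrightarrow>
        emeasure (path_measure G \<nu>) A = 0 \<or> emeasure (path_measure G \<nu>) A = 1)"

definition amenable :: "('a, 'c) monoid_scheme \<Rightarrow> bool" where
  "amenable G \<longleftrightarrow> (\<exists>m :: 'a set \<Rightarrow> real.
     m (carrier G) = 1 \<and>
     (\<forall>A. A \<subseteq> carrier G \<longrightarrow> 0 \<le> m A) \<and>
     (\<forall>A B. A \<subseteq> carrier G \<longrightarrow> B \<subseteq> carrier G \<longrightarrow> A \<inter> B = {} \<longrightarrow> m (A \<union> B) = m A + m B) \<and>
     (\<forall>g \<in> carrier G. \<forall>A. A \<subseteq> carrier G \<longrightarrow> m (g <#\<^bsub>G\<^esub> A) = m A))"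

definition icc :: "('a, 'c) monoid_scheme \<Rightarrow> bool" where
  "icc G \<longleftrightarrow> (\<forall>x \<in> carrier G. x \<noteq> \<one>\<^bsub>G\<^esub> \<longrightarrow>
     infinite {g \<otimes>\<^bsub>G\<^esub> x \<otimes>\<^bsub>G\<^esub> inv\<^bsub>G\<^esub> g | g. g \<in> carrier G})"

definition has_nontrivial_icc_factor :: "('a, 'c) monoid_scheme \<Rightarrow> bool" where
  "has_nontrivial_icc_factor G \<longleftrightarrow>
     (\<exists>N. N \<lhd> G \<and> N \<noteq> carrier G \<and> icc (G Mod N))"

end

theory Submission
  imports Defs
begin

text \<open>A shift-invariant event \<open>A\<close> gives the bounded harmonic function \<open>x \<mapsto> P\<^sub>x(A)\<close>, so a trivial boundary means
  that bounded harmonic functions are constant.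

  If the marginals have trivial boundary, Cesaro averages of the walk started at \<open>x\<close> define a harmonic
  function of \<open>x\<close> for each set; being constant, it is an invariant mean. An element with finitely many
  conjugates acts trivially on bounded harmonic functions, because right increments of such a function
  tend to \<open>0\<close> along the walk. Hence, if \<open>G\<^sub>1\<close> has no ICC factor, it acts trivially, bounded harmonic
  functions on the product come from \<open>G\<^sub>2\<close>, and they are constant.

  Conversely, the increments are drawn at random scales. At scale \<open>k\<close> the increment is \<open>(i h\<^sub>j, j g\<^sub>i)\<close>,
  where \<open>i\<close> and \<open>j\<close> are independent with almost invariant laws and \<open>h\<close>, \<open>g\<close> are generic: each
  coordinate alone is almost invariant under everything that happened at smaller scales, which makes the
  marginals trivial, while the pair determines the position just before the increment, because a
  generic conjugation in an ICC group moves finite sets off each other. So the walk on the product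
  remembers its starting point.\<close>

section \<open>Bounded harmonic functions and the triviality of the boundary\<close>

text \<open>Two demands on an increment pull in opposite directions: trivial marginal boundaries
  need almost invariant laws, and memory needs decodable ones. They are compatible because almost
  invariance is only asked of functions of a single coordinate. A second circularity is removed by
  the order of choices: the law of the scales comes first, it fixes the time by which scale
  \<open>k\<close> has normally been exceeded, and only then are finite sets chosen that contain all
  words formed from smaller scales within that time. A heavy tail makes the largest scale so far
  usually occur only once; the position then reads before-record-after, and extracting the word
  before the record, again and again, leads back to the start. For non-degeneracy each scale also
  gives a small weight to one element of an enumeration of the group. The invariant mean serves
  twice: by separation and compactness it yields finitely supported almost invariant measures, and
  as a notion of null set it yields generic elements, since a fibre with infinitely many disjoint
  translates is null.\<close>

abbreviation expect :: "'a pmf \<Rightarrow> ('a \<Rightarrow> real) \<Rightarrow> real" where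
  "expect \<equiv> measure_pmf.expectation"

definition harmonic :: "('a, 'c) monoid_scheme \<Rightarrow> 'a pmf \<Rightarrow> ('a \<Rightarrow> real) \<Rightarrow> bool" where
  "harmonic G \<nu> h \<longleftrightarrow> (\<forall>x \<in> carrier G. h x = expect \<nu> (\<lambda>s. h (x \<otimes>\<^bsub>G\<^esub> s)))"

text \<open>Harmonicity lives on the carrier, the bound on the whole type: under
  \<open>prob_on\<close> the values off the carrier are never seen, and a global bound makes every
  expectation integrable at once.\<close>

definition liouville :: "('a, 'c) monoid_scheme \<Rightarrow> 'a pmf \<Rightarrow> bool" where
  "liouville G \<nu> \<longleftrightarrow> (\<forall>h C. harmonic G \<nu> h \<longrightarrow> (\<forall>x. \<bar>h x\<bar> \<le> C) \<longrightarrow>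
     (\<forall>x \<in> carrier G. h x = h \<one>\<^bsub>G\<^esub>))"

section \<open>Expectations of bounded functions under a pmf\<close>

lemma integrable_pmf_bounded:
  fixes f :: "'a \<Rightarrow> real"
  assumes "\<And>x. x \<in> set_pmf p \<Longrightarrow> \<bar>f x\<bar> \<le> C"
  shows "integrable (measure_pmf p) f"
  using assms by (intro measure_pmf.integrable_const_bound[where B = C]) (auto simp: AE_measure_pmf_iff)

lemma expect_le:
  assumes "\<And>x. x \<in> set_pmf p \<Longrightarrow> \<bar>f x\<bar> \<le> C" "\<And>x. x \<in> set_pmf p \<Longrightarrow> f x \<le> B"
  shows "expect p f \<le> B"
proof -
  have "expect p f \<le> expect p (\<lambda>_. B)"
    using assms by (intro integral_mono_AE integrable_pmf_bounded) (auto simp: AE_measure_pmf_iff)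
  then show ?thesis by simp
qed

lemma expect_abs_le:
  assumes "\<And>x. x \<in> set_pmf p \<Longrightarrow> \<bar>f x\<bar> \<le> C"
  shows "\<bar>expect p f\<bar> \<le> C"
proof -
  have "expect p f \<le> C" by (rule expect_le[where C = C]) (use assms in force)+
  moreover have "expect p (\<lambda>x. - f x) \<le> C" by (rule expect_le[where C = C]) (use assms in force)+
  ultimately show ?thesis by simp
qed

lemma expect_mono:
  assumes "\<And>x. x \<in> set_pmf p \<Longrightarrow> \<bar>f x\<bar> \<le> C" "\<And>x. x \<in> set_pmf p \<Longrightarrow> \<bar>g x\<bar> \<le> D"
    and "\<And>x. x \<in> set_pmf p \<Longrightarrow> f x \<le> g x"
  shows "expect p f \<le> expect p g"
  using assms by (intro integral_mono_AE integrable_pmf_bounded) (auto simp: AE_measure_pmf_iff)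

lemma expect_cong:
  assumes "\<And>x. x \<in> set_pmf p \<Longrightarrow> f x = g x"
  shows "expect p f = expect p g"
  using assms by (intro integral_cong_AE) (auto simp: AE_measure_pmf_iff)

lemma pmf_times_le_expect:
  assumes "\<And>x. x \<in> set_pmf p \<Longrightarrow> \<bar>f x\<bar> \<le> C" "\<And>x. x \<in> set_pmf p \<Longrightarrow> 0 \<le> f x" "s \<in> set_pmf p"
  shows "pmf p s * f s \<le> expect p f"
proof -
  have "expect p (\<lambda>x. indicator {s} x * f s) \<le> expect p f"
    by (rule expect_mono[where C = "\<bar>f s\<bar>" and D = C])
      (use assms in \<open>auto simp: indicator_def\<close>)
  then show ?thesis by (simp add: pmf.rep_eq)
qed

text \<open>Nonnegative integrals of composed laws iterate; a function bounded by \<open>C\<close>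
  becomes nonnegative after adding \<open>C\<close>, and linearity returns the signed case.\<close>

lemma expect_bind:
  fixes N :: "'x \<Rightarrow> 'y pmf"
  assumes C: "\<And>x. \<bar>f x\<bar> \<le> C"
  shows "expect (bind_pmf M N) f = expect M (\<lambda>x. expect (N x) f)"
proof -
  have nonneg: "expect (bind_pmf M N) g = expect M (\<lambda>x. expect (N x) g)"
    if g: "\<And>x. 0 \<le> g x" "\<And>x. \<bar>g x\<bar> \<le> D" for g :: "'y \<Rightarrow> real" and D
  proof -
    have e0: "0 \<le> expect p g" for p using g(1) by (intro integral_nonneg_AE) simp
    have "ennreal (expect (bind_pmf M N) g) = (\<integral>\<^sup>+x. ennreal (g x) \<partial>bind_pmf M N)"
      using g by (intro nn_integral_eq_integral[symmetric] integrable_pmf_bounded[where C = D]) auto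
    also have "\<dots> = (\<integral>\<^sup>+x. \<integral>\<^sup>+y. ennreal (g y) \<partial>N x \<partial>M)" by simp
    also have "\<dots> = (\<integral>\<^sup>+x. ennreal (expect (N x) g) \<partial>M)"
      using g by (intro nn_integral_cong nn_integral_eq_integral integrable_pmf_bounded[where C = D]) auto
    also have "\<dots> = ennreal (expect M (\<lambda>x. expect (N x) g))"
      using g by (intro nn_integral_eq_integral integrable_pmf_bounded[where C = D] expect_abs_le) (auto simp: e0)
    finally show ?thesis
      using e0 by (subst (asm) ennreal_inj) (auto intro!: integral_nonneg_AE)
  qed
  have i: "integrable (measure_pmf p) f" for p by (rule integrable_pmf_bounded[OF C])
  have "expect (bind_pmf M N) (\<lambda>x. f x + C) = expect M (\<lambda>x. expect (N x) (\<lambda>x. f x + C))"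
  proof (rule nonneg)
    fix x show "0 \<le> f x + C" "\<bar>f x + C\<bar> \<le> 2 * C" using C[of x] by linarith+
  qed
  moreover have "integrable (measure_pmf M) (\<lambda>x. expect (N x) f)"
    by (rule integrable_pmf_bounded) (rule expect_abs_le[OF C])
  ultimately show ?thesis using i by simp
qed

lemma expect_pair:
  fixes A :: "'x pmf" and B :: "'y pmf"
  assumes C: "\<And>x. \<bar>f x\<bar> \<le> C"
  shows "expect (pair_pmf A B) f = expect A (\<lambda>a. expect B (\<lambda>b. f (a, b)))"
    and "expect (pair_pmf A B) f = expect B (\<lambda>b. expect A (\<lambda>a. f (a, b)))"
proof -
  \<comment> \<open>Fresh type variables let the same fact be used again with the two factors
    exchanged.\<close>
  have eq: "expect (pair_pmf A B) f = expect A (\<lambda>a. expect B (\<lambda>b. f (a, b)))"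
    if "\<And>x. \<bar>f x\<bar> \<le> C" for f :: "'v \<times> 'w \<Rightarrow> real" and A B
    unfolding pair_pmf_def using that by (simp add: expect_bind[where C = C])
  show "expect (pair_pmf A B) f = expect A (\<lambda>a. expect B (\<lambda>b. f (a, b)))" by (rule eq[OF C])
  have "expect (pair_pmf A B) f = expect (pair_pmf B A) (\<lambda>(b, a). f (a, b))"
    by (subst pair_commute_pmf) (simp add: case_prod_beta)
  also have "\<dots> = expect B (\<lambda>b. expect A (\<lambda>a. f (a, b)))"
    by (subst eq) (use C in auto)
  finally show "expect (pair_pmf A B) f = expect B (\<lambda>b. expect A (\<lambda>a. f (a, b)))" .
qed

lemma sgp_gen_subset:
  assumes "group G" "S \<subseteq> carrier G" "x \<in> sgp_gen G S"
  shows "x \<in> carrier G"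
  using assms(3)
proof induction
  case (mult x y)
  then show ?case using assms(1) by (simp add: group.is_monoid monoid.m_closed)
qed (use assms in auto)

section \<open>Walks from an arbitrary starting point and their hitting probabilities\<close>

primrec chain :: "('a, 'c) monoid_scheme \<Rightarrow> 'a \<Rightarrow> (nat \<Rightarrow> 'a) \<Rightarrow> nat \<Rightarrow> 'a" where
  "chain G x X 0 = x"
| "chain G x X (Suc n) = chain G x X n \<otimes>\<^bsub>G\<^esub> X n"

lemma rw_eq_chain: "rw G X n = chain G \<one>\<^bsub>G\<^esub> X n"
  by (induction n) auto

text \<open>The Markov property at time one: the first increment is absorbed into the starting
  point.\<close>

lemma chain_case_nat: "chain G x (case_nat s X) (Suc n) = chain G (x \<otimes>\<^bsub>G\<^esub> s) X n"
  by (induction n) auto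

abbreviation incr :: "'a pmf \<Rightarrow> (nat \<Rightarrow> 'a) measure" where
  "incr \<nu> \<equiv> PiM UNIV (\<lambda>_. measure_pmf \<nu>)"

lemma sequence_space_pmf: "sequence_space (measure_pmf \<nu>)"
  by (intro sequence_space.intro product_prob_spaceI) (simp add: measure_pmf.prob_space_axioms)

lemma space_incr: "space (incr \<nu>) = UNIV"
  by (simp add: space_PiM PiE_def)

lemma space_traj: "space traj_space = UNIV"
  by (simp add: space_PiM PiE_def traj_space_def)

lemma prob_space_incr: "prob_space (incr \<nu>)"
  by (intro prob_space_PiM measure_pmf.prob_space_axioms)

lemma measurable_chain_coord:
  fixes G :: "('a::countable, 'c) monoid_scheme" (structure)
  shows "(\<lambda>X. chain G x X n) \<in> measurable (incr \<nu>) (count_space UNIV)"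
proof (induction n)
  case (Suc n)
  have "(\<lambda>X. (\<lambda>y X. y \<otimes> X n) (chain G x X n) X) \<in> measurable (incr \<nu>) (count_space UNIV)"
  proof (rule measurable_compose_countable[OF _ Suc])
    fix y :: 'a
    have "(\<lambda>X. X n) \<in> measurable (incr \<nu>) (measure_pmf \<nu>)" by simp
    then show "(\<lambda>X. y \<otimes> X n) \<in> measurable (incr \<nu>) (count_space UNIV)"
      by (rule measurable_compose) simp
  qed
  then show ?case by simp
qed simp

lemma measurable_chain:
  fixes G :: "('a::countable, 'c) monoid_scheme"
  shows "chain G x \<in> measurable (incr \<nu>) traj_space"
  unfolding traj_space_def
  by (rule measurable_PiM_single') (auto simp: measurable_chain_coord)

definition hit :: "('a, 'c) monoid_scheme \<Rightarrow> 'a pmf \<Rightarrow> (nat \<Rightarrow> 'a) set \<Rightarrow> 'a \<Rightarrow> real" where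
  "hit G \<nu> A x = measure (incr \<nu>) {X. chain G x X \<in> A}"

lemma sets_chain_vimage:
  fixes G :: "('a::countable, 'c) monoid_scheme"
  assumes "A \<in> sets traj_space"
  shows "{X. chain G x X \<in> A} \<in> sets (incr \<nu>)"
  using measurable_sets[OF measurable_chain assms, of G x \<nu>] by (simp add: space_incr vimage_def)

lemma path_measure_hit:
  fixes G :: "('a::countable, 'c) monoid_scheme" (structure)
  assumes "A \<in> sets traj_space"
  shows "emeasure (path_measure G \<nu>) A = ennreal (hit G \<nu> A \<one>)"
proof -
  have [simp]: "(\<lambda>X n. rw G X n) = chain G \<one>" by (auto simp: rw_eq_chain fun_eq_iff)
  interpret prob_space "incr \<nu>" by (rule prob_space_incr)
  show ?thesis
    using assms unfolding path_measure_def hit_def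
    by (simp add: emeasure_distr measurable_chain space_incr vimage_def emeasure_eq_measure)
qed

lemma poisson_trivial_iff_hit:
  fixes G :: "('a::countable, 'c) monoid_scheme" (structure)
  shows "poisson_trivial G \<nu> \<longleftrightarrow> (\<forall>A\<in>sets traj_space. (\<lambda>z. z \<circ> Suc) -` A = A \<longrightarrow>
     hit G \<nu> A \<one> = 0 \<or> hit G \<nu> A \<one> = 1)"
  unfolding poisson_trivial_def
  by (intro ball_cong refl) (simp add: path_measure_hit hit_def)

text \<open>An i.i.d. sequence has the law of a first increment put in front of an independent copy
  of the sequence (\<open>PiM_iter\<close>); taking sections conditions on that increment.\<close>

lemma measure_first_step:
  fixes \<nu> :: "'a::countable pmf"
  assumes B: "B \<in> sets (incr \<nu>)"
  shows "measure (incr \<nu>) B = expect \<nu> (\<lambda>s. measure (incr \<nu>) {\<omega>. case_nat s \<omega> \<in> B})"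
proof -
  interpret S: prob_space "incr \<nu>" by (rule prob_space_incr)
  interpret sequence_space "measure_pmf \<nu>" by (rule sequence_space_pmf)
  let ?f = "\<lambda>(s, \<omega>). case_nat s \<omega> :: nat \<Rightarrow> 'a"
  have m: "?f \<in> measurable (measure_pmf \<nu> \<Otimes>\<^sub>M incr \<nu>) (incr \<nu>)" by measurable
  have "emeasure (incr \<nu>) B = emeasure (distr (measure_pmf \<nu> \<Otimes>\<^sub>M incr \<nu>) (incr \<nu>) ?f) B"
    by (simp add: PiM_iter)
  also have "\<dots> = emeasure (measure_pmf \<nu> \<Otimes>\<^sub>M incr \<nu>) (?f -` B \<inter> space (measure_pmf \<nu> \<Otimes>\<^sub>M incr \<nu>))"
    by (rule emeasure_distr[OF m B])
  also have "\<dots> = (\<integral>\<^sup>+s. emeasure (incr \<nu>) (Pair s -` (?f -` B \<inter> space (measure_pmf \<nu> \<Otimes>\<^sub>M incr \<nu>))) \<partial>\<nu>)"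
    by (rule S.emeasure_pair_measure_alt) (rule measurable_sets[OF m B])
  also have "\<dots> = (\<integral>\<^sup>+s. ennreal (measure (incr \<nu>) {\<omega>. case_nat s \<omega> \<in> B}) \<partial>\<nu>)"
    by (intro nn_integral_cong)
      (simp add: S.emeasure_eq_measure space_pair_measure space_incr vimage_def)
  also have "\<dots> = ennreal (expect \<nu> (\<lambda>s. measure (incr \<nu>) {\<omega>. case_nat s \<omega> \<in> B}))"
    by (intro nn_integral_eq_integral integrable_pmf_bounded[where C = 1]) auto
  finally show ?thesis
    by (simp add: S.emeasure_eq_measure)
qed

lemma shift_invariant_iff:
  assumes "(\<lambda>z. z \<circ> Suc) -` A = A"
  shows "z \<in> A \<longleftrightarrow> (\<lambda>n. z (Suc n)) \<in> A"
  using assms by (auto simp: vimage_def comp_def set_eq_iff)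

lemma hit_first_step:
  fixes G :: "('a::countable, 'c) monoid_scheme" (structure)
  assumes "A \<in> sets traj_space" and inv: "(\<lambda>z. z \<circ> Suc) -` A = A"
  shows "hit G \<nu> A x = expect \<nu> (\<lambda>s. hit G \<nu> A (x \<otimes> s))"
proof -
  have "chain G x (case_nat s \<omega>) \<in> A \<longleftrightarrow> chain G (x \<otimes> s) \<omega> \<in> A" for s \<omega>
    by (subst shift_invariant_iff[OF inv]) (simp only: chain_case_nat)
  then show ?thesis
    unfolding hit_def by (subst measure_first_step[OF sets_chain_vimage[OF assms(1)]]) simp
qed

lemma hit_nonneg: "0 \<le> hit G \<nu> A x" by (simp add: hit_def)

lemma hit_le_1: "hit G \<nu> A x \<le> 1"
  unfolding hit_def by (simp add: prob_space.prob_le_1 prob_space_incr)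

lemma abs_hit_le: "\<bar>hit G \<nu> A x\<bar> \<le> 1" using hit_nonneg[of G \<nu> A x] hit_le_1[of G \<nu> A x] by simp

text \<open>One term of the first-step equation at \<open>y\<close> is
  \<open>pmf \<nu> s * hit G \<nu> A (y \<otimes> s)\<close>, so positivity passes to predecessors;
  the free left factor \<open>y\<close> lets the induction handle products. This carries positivity
  back to the identity, the only start that \<open>poisson_trivial\<close> speaks of.\<close>

lemma hit_pos_reachable:
  fixes G :: "('a::countable, 'c) monoid_scheme" (structure)
  assumes G: "group G" "prob_on G \<nu>"
    and A: "A \<in> sets traj_space" "(\<lambda>z. z \<circ> Suc) -` A = A"
    and "x \<in> sgp_gen G (set_pmf \<nu>)" "y \<in> carrier G" "0 < hit G \<nu> A (y \<otimes> x)"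
  shows "0 < hit G \<nu> A y"
  using assms(5-)
proof (induction arbitrary: y)
  case (base s)
  have "0 < pmf \<nu> s * hit G \<nu> A (y \<otimes> s)"
    using base by (simp add: pmf_positive)
  also have "\<dots> \<le> hit G \<nu> A y"
    unfolding hit_first_step[OF A, of G \<nu> y]
    by (rule pmf_times_le_expect[where C = 1]) (use base in \<open>auto simp: abs_hit_le hit_nonneg hit_le_1\<close>)
  finally show ?case .
next
  case (mult a b)
  interpret group G by fact
  have ab: "a \<in> carrier G" "b \<in> carrier G"
    using mult.hyps sgp_gen_subset[OF G(1) G(2)[unfolded prob_on_def]] by blast+
  then have "y \<otimes> (a \<otimes> b) = (y \<otimes> a) \<otimes> b"
    using mult.prems by (simp add: m_assoc)
  with mult.prems have "0 < hit G \<nu> A ((y \<otimes> a) \<otimes> b)" by simp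
  then have "0 < hit G \<nu> A (y \<otimes> a)"
    using mult.prems(1) ab by (metis mult.IH(2) m_closed)
  with mult.prems(1) show ?case by (rule mult.IH(1))
qed

text \<open>Ville's maximal inequality for the nonnegative martingale formed by \<open>V\<close>
  along the walk. Induction on the time horizon with a first-step decomposition replaces stopping
  times.\<close>

lemma ville_finite:
  fixes G :: "('a::countable, 'c) monoid_scheme" (structure)
  assumes G: "group G" "prob_on G \<nu>"
    and V: "harmonic G \<nu> V" "\<And>x. x \<in> carrier G \<Longrightarrow> 0 \<le> V x" "\<And>x. \<bar>V x\<bar> \<le> C" and c: "0 < c"
    and x: "x \<in> carrier G"
  shows "measure (incr \<nu>) {X. \<exists>n\<le>N. c \<le> V (chain G x X n)} \<le> V x / c"
proof -
  interpret group G by fact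
  interpret S: prob_space "incr \<nu>" by (rule prob_space_incr)
  have triv: "measure (incr \<nu>) {X. \<exists>n\<le>N. c \<le> V (chain G x X n)} \<le> V x / c"
    if "x \<in> carrier G" "c \<le> V x" for x N
  proof -
    have "1 \<le> V x / c" using c that by simp
    then show ?thesis
      using S.prob_le_1[of "{X. \<exists>n\<le>N. c \<le> V (chain G x X n)}"] by linarith
  qed
  show ?thesis using x
  proof (induction N arbitrary: x)
    case 0
    show ?case
    proof (cases "c \<le> V x")
      case True
      then show ?thesis using triv[of x 0] 0 by simp
    next
      case False
      then show ?thesis using V(2) c 0 by simp
    qed
    next
    case (Suc N)
    show ?case
    proof (cases "c \<le> V x")
      case True
      then show ?thesis using triv[of x "Suc N"] Suc by simp
    next
      case False
      let ?B = "{X. \<exists>n\<le>Suc N. c \<le> V (chain G x X n)}"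
      have "{X. \<exists>n\<le>Suc N. c \<le> V (chain G x X n)} =
          (\<Union>n\<in>{..Suc N}. (\<lambda>X. chain G x X n) -` {y. c \<le> V y} \<inter> space (incr \<nu>))"
        by (auto simp: space_incr)
      also have "\<dots> \<in> sets (incr \<nu>)"
        by (intro sets.finite_UN measurable_sets[OF measurable_chain_coord]) auto
      finally have B: "?B \<in> sets (incr \<nu>)" .
      have eq: "{\<omega>. case_nat s \<omega> \<in> ?B} = {X. \<exists>n\<le>N. c \<le> V (chain G (x \<otimes> s) X n)}" for s
      proof -
        \<comment> \<open>Time 0 is excluded because \<open>V x\<close> is below \<open>c\<close>,
          so every hitting time moves down by one and the walk restarts at
          \<open>x \<otimes> s\<close>.\<close>
        have "(\<exists>n\<le>Suc N. c \<le> V (chain G x (case_nat s \<omega>) n)) \<longleftrightarrow>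
            (\<exists>n\<le>N. c \<le> V (chain G x (case_nat s \<omega>) (Suc n)))" for \<omega>
          using False by (metis Suc_le_mono chain.simps(1) not0_implies_Suc)
        then show ?thesis by (simp only: chain_case_nat mem_Collect_eq)
      qed
      have "measure (incr \<nu>) ?B
          = expect \<nu> (\<lambda>s. measure (incr \<nu>) {X. \<exists>n\<le>N. c \<le> V (chain G (x \<otimes> s) X n)})"
        by (subst measure_first_step[OF B]) (simp only: eq)
      also have "\<dots> \<le> expect \<nu> (\<lambda>s. V (x \<otimes> s) / c)"
      proof (rule expect_mono[where C = 1 and D = "C / c"])
        fix s assume "s \<in> set_pmf \<nu>"
        then have "x \<otimes> s \<in> carrier G" using G(2) Suc(2) by (auto simp: prob_on_def)
        then show "measure (incr \<nu>) {X. \<exists>n\<le>N. c \<le> V (chain G (x \<otimes> s) X n)} \<le> V (x \<otimes> s) / c"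
          by (rule Suc(1))
      qed (use V c in \<open>auto simp: divide_simps\<close>)
      also have "\<dots> = V x / c"
        using V(1) Suc(2) by (simp add: harmonic_def)
      finally show ?thesis .
    qed
  qed
qed

lemma sets_eventually_traj:
  "{z. \<forall>\<^sub>F n in sequentially. P (z n)} \<in> sets (traj_space :: (nat \<Rightarrow> 'a) measure)"
proof -
  have "{z :: nat \<Rightarrow> 'a. \<forall>\<^sub>F n in sequentially. P (z n)} = (\<Union>N. \<Inter>n\<in>{N..}. (\<lambda>z. z n) -` {y. P y} \<inter> space traj_space)"
    by (auto simp: eventually_sequentially space_traj)
  also have "\<dots> \<in> sets traj_space"
  proof (intro sets.countable_UN'' sets.countable_INT' image_subsetI)
    fix n :: nat
    have "(\<lambda>z. z n) \<in> measurable (traj_space :: (nat \<Rightarrow> 'a) measure) (count_space UNIV)"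
      unfolding traj_space_def by simp
    then show "(\<lambda>z. z n) -` {y. P y} \<inter> space traj_space \<in> sets traj_space"
      by (rule measurable_sets) simp
  qed auto
  finally show ?thesis .
qed

lemma eventually_traj_invariant:
  "(\<lambda>z. z \<circ> Suc) -` {z. \<forall>\<^sub>F n in sequentially. P (z n)} = {z. \<forall>\<^sub>F n in sequentially. P (z n)}"
proof -
  have "(\<forall>\<^sub>F n in sequentially. P ((z \<circ> Suc) n)) \<longleftrightarrow> (\<forall>\<^sub>F n in sequentially. P (z n))" for z
    using eventually_sequentially_Suc[of "\<lambda>n. P (z n)"] by (simp add: comp_def)
  then show ?thesis by (simp add: vimage_def)
qed

text \<open>By the maximal inequality the walk from \<open>x\<close> stays below \<open>c\<close>
  forever with probability at least \<open>1 - V x / c\<close>, which is positive. Being eventually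
  below \<open>c\<close> is shift-invariant, so positivity passes to the identity and triviality
  raises it to 1.\<close>

lemma harmonic_small_pos:
  fixes G :: "('a::countable, 'c) monoid_scheme" (structure)
  assumes G: "group G" "prob_on G \<nu>" "nondegenerate G \<nu>" "poisson_trivial G \<nu>"
    and V: "harmonic G \<nu> V" "\<And>x. x \<in> carrier G \<Longrightarrow> 0 \<le> V x" "\<And>x. \<bar>V x\<bar> \<le> C" and c: "0 < c"
    and x: "x \<in> carrier G" "V x < c"
  shows "hit G \<nu> {z. \<forall>\<^sub>F n in sequentially. V (z n) < c} \<one> = 1"
proof -
  interpret group G by fact
  interpret S: prob_space "incr \<nu>" by (rule prob_space_incr)
  let ?A = "{z. \<forall>\<^sub>F n in sequentially. V (z n) < c}"
  let ?B = "\<lambda>N. {X. \<exists>n\<le>N. c \<le> V (chain G x X n)}"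
  have Bm: "?B N \<in> sets (incr \<nu>)" for N
  proof -
    have "?B N = (\<Union>n\<in>{..N}. (\<lambda>X. chain G x X n) -` {y. c \<le> V y} \<inter> space (incr \<nu>))"
      by (auto simp: space_incr)
    also have "\<dots> \<in> sets (incr \<nu>)"
      by (intro sets.finite_UN measurable_sets[OF measurable_chain_coord]) auto
    finally show ?thesis .
  qed
  have "(\<lambda>N. measure (incr \<nu>) (?B N)) \<longlonglongrightarrow> measure (incr \<nu>) (\<Union>N. ?B N)"
    by (rule S.finite_Lim_measure_incseq) (use Bm in \<open>auto simp: incseq_def intro: order_trans\<close>)
  then have "measure (incr \<nu>) (\<Union>N. ?B N) \<le> V x / c"
    using ville_finite[OF G(1,2) V c x(1)] by (intro LIMSEQ_le_const2) auto
  then have "measure (incr \<nu>) (\<Union>N. ?B N) < 1"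
    using x c by (meson divide_less_eq_1_pos order.strict_trans1)
  then have "0 < measure (incr \<nu>) (space (incr \<nu>) - (\<Union>N. ?B N))"
    using Bm by (subst S.prob_compl) auto
  also have "\<dots> \<le> hit G \<nu> ?A x"
    unfolding hit_def
  proof (intro S.finite_measure_mono sets_chain_vimage sets_eventually_traj subsetI CollectI always_eventually allI)
    fix X n assume "X \<in> space (incr \<nu>) - (\<Union>N. ?B N)"
    then have "X \<notin> ?B n" by blast
    then show "V (chain G x X n) < c" by (auto simp: not_le)
  qed
  finally have pos: "0 < hit G \<nu> ?A (\<one> \<otimes> x)" using x by simp
  have "x \<in> sgp_gen G (set_pmf \<nu>)" using G(3) x by (simp add: nondegenerate_def)
  from hit_pos_reachable[OF G(1,2) sets_eventually_traj eventually_traj_invariant this one_closed pos]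
  have "0 < hit G \<nu> ?A \<one>" .
  then show ?thesis
    using G(4)[unfolded poisson_trivial_iff_hit, THEN bspec, THEN mp,
        OF sets_eventually_traj[of "\<lambda>x. V x < c"] eventually_traj_invariant]
    by auto
qed

lemma harmonic_affine:
  assumes "harmonic G \<nu> h" "\<And>x. \<bar>h x\<bar> \<le> C"
  shows "harmonic G \<nu> (\<lambda>x. a * h x + b)"
  using assms unfolding harmonic_def
  by (auto simp: integrable_pmf_bounded[where C = C])

text \<open>If the oscillation \<open>b - a\<close> were positive, the nonnegative harmonic
  functions \<open>b - h\<close> and \<open>h - a\<close> would each drop below half of it
  somewhere, hence eventually along almost every path. Their sum is \<open>b - a\<close>, a
  contradiction; no martingale limit is taken.\<close>

lemma poisson_trivial_imp_liouville:
  fixes G :: "('a::countable, 'c) monoid_scheme" (structure)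
  assumes G: "group G" "prob_on G \<nu>" "nondegenerate G \<nu>" "poisson_trivial G \<nu>"
  shows "liouville G \<nu>"
  unfolding liouville_def
proof (intro allI impI)
  fix h :: "'a \<Rightarrow> real" and C
  assume h: "harmonic G \<nu> h" and C: "\<forall>x. \<bar>h x\<bar> \<le> C"
  interpret group G by fact
  interpret S: prob_space "incr \<nu>" by (rule prob_space_incr)
  have bd: "bdd_above (h ` carrier G)" "bdd_below (h ` carrier G)"
    using C by (auto intro!: bdd_aboveI[of _ C] bdd_belowI[of _ "-C"] simp: abs_le_iff minus_le_iff)
  have ne: "h ` carrier G \<noteq> {}" by auto
  define b where "b = Sup (h ` carrier G)"
  define a where "a = Inf (h ` carrier G)"
  have ab: "a \<le> h x" "h x \<le> b" if "x \<in> carrier G" for x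
    using that bd by (auto simp: a_def b_def intro: cInf_lower cSup_upper)
  have ab0: "\<bar>a\<bar> \<le> C" "\<bar>b\<bar> \<le> C"
    using C ne unfolding a_def b_def by (auto intro!: cSup_abs_le cInf_abs_ge)
  have "b \<le> a"
  proof (rule ccontr)
    assume "\<not> b \<le> a"
    define c where "c = (b - a) / 2"
    have c: "0 < c" using \<open>\<not> b \<le> a\<close> by (simp add: c_def)
    obtain x where x: "x \<in> carrier G" "h x > b - c"
      using less_cSupD[OF ne, of "b - c"] c by (auto simp: b_def)
    obtain y where y: "y \<in> carrier G" "h y < a + c"
      using cInf_lessD[OF ne, of "a + c"] c by (auto simp: a_def)
    let ?A = "{z. \<forall>\<^sub>F n in sequentially. -1 * h (z n) + b < c}"
    let ?B = "{z. \<forall>\<^sub>F n in sequentially. 1 * h (z n) + (-a) < c}"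
    have "hit G \<nu> ?A \<one> = 1"
    proof (rule harmonic_small_pos[OF G, where C = "2 * C" and x = x])
      show "harmonic G \<nu> (\<lambda>x. -1 * h x + b)" using C by (intro harmonic_affine[OF h]) auto
      show "\<bar>-1 * h x + b\<bar> \<le> 2 * C" for x using C[rule_format, of x] ab0 by linarith
    qed (use x ab c in auto)
    moreover have "hit G \<nu> ?B \<one> = 1"
    proof (rule harmonic_small_pos[OF G, where C = "2 * C" and x = y])
      show "harmonic G \<nu> (\<lambda>x. 1 * h x + (-a))" using C by (intro harmonic_affine[OF h]) auto
      show "\<bar>1 * h x + (-a)\<bar> \<le> 2 * C" for x using C[rule_format, of x] ab0 by linarith
    qed (use y ab c in auto)
    ultimately have AE: "AE X in incr \<nu>. X \<in> {X. chain G \<one> X \<in> ?A}"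
        "AE X in incr \<nu>. X \<in> {X. chain G \<one> X \<in> ?B}"
      unfolding hit_def by (blast intro: S.AE_prob_1)+
    from AE have "AE X in incr \<nu>. False"
    proof eventually_elim
      case (elim X)
      then have "\<forall>\<^sub>F n in sequentially. -1 * h (chain G \<one> X n) + b < c \<and> 1 * h (chain G \<one> X n) + (-a) < c"
        by (auto intro: eventually_conj)
      then have "\<forall>\<^sub>F n in sequentially. False" by eventually_elim (auto simp: c_def field_simps)
      then show ?case by simp
    qed
    then show False by (simp add: S.AE_False)
  qed
  then show "\<forall>x\<in>carrier G. h x = h \<one>"
    using ab by (metis dual_order.trans nle_le one_closed)
qed

section \<open>A zero-one law for shift-invariant events\<close>

lemma chain_comb_seq:
  "chain G x (comb_seq i \<omega> \<omega>') (n + i) = chain G (chain G x \<omega> i) \<omega>' n"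
proof -
  have "chain G x (comb_seq i \<omega> \<omega>') j = chain G x \<omega> j" if "j \<le> i" for j
    using that by (induction j) (auto simp: comb_seq_def)
  then show ?thesis by (induction n) (auto simp: comb_seq_def)
qed

lemma shift_invariant_iff_add:
  assumes "(\<lambda>z. z \<circ> Suc) -` A = A"
  shows "z \<in> A \<longleftrightarrow> (\<lambda>n. z (n + i)) \<in> A"
proof (induction i arbitrary: z)
  case (Suc i)
  show ?case by (subst shift_invariant_iff[OF assms], subst Suc) simp
qed simp

lemma AE_incr_carrier:
  assumes "group G" "prob_on G \<nu>" "x \<in> carrier G"
  shows "AE X in incr \<nu>. \<forall>n. chain G x X n \<in> carrier G"
proof -
  interpret sequence_space "measure_pmf \<nu>" by (rule sequence_space_pmf)
  interpret group G by fact
  have "AE X in incr \<nu>. \<forall>n. X n \<in> carrier G"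
    unfolding AE_all_countable using assms(2)
    by (intro allI AE_component) (auto simp: AE_measure_pmf_iff prob_on_def)
  then show ?thesis
  proof eventually_elim
    case (elim X)
    have "chain G x X n \<in> carrier G" for n by (induction n) (use elim assms in auto)
    then show ?case by blast
  qed
qed

text \<open>Constancy of \<open>hit\<close> says that the past does not influence the event. It is
  therefore independent of all cylinders, hence of itself.\<close>

lemma liouville_imp_poisson_trivial:
  fixes G :: "('a::countable, 'c) monoid_scheme" (structure)
  assumes G: "group G" "prob_on G \<nu>" "liouville G \<nu>"
  shows "poisson_trivial G \<nu>"
  unfolding poisson_trivial_iff_hit
proof (intro ballI impI)
  fix A :: "(nat \<Rightarrow> 'a) set"
  assume A: "A \<in> sets traj_space" "(\<lambda>z. z \<circ> Suc) -` A = A"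
  interpret group G by fact
  interpret S: prob_space "incr \<nu>" by (rule prob_space_incr)
  interpret sequence_space "measure_pmf \<nu>" by (rule sequence_space_pmf)
  define p where "p = hit G \<nu> A \<one>"
  have p: "hit G \<nu> A x = p" if "x \<in> carrier G" for x
  proof -
    have "harmonic G \<nu> (hit G \<nu> A)"
      unfolding harmonic_def using hit_first_step[OF A] by blast
    from G(3)[unfolded liouville_def, rule_format, OF this abs_hit_le that]
    show ?thesis by (simp add: p_def)
  qed
  define B where "B = {X. chain G \<one> X \<in> A}"
  have B: "B \<in> sets (incr \<nu>)" unfolding B_def by (rule sets_chain_vimage[OF A(1)])
  have pB: "measure (incr \<nu>) B = p" by (simp add: p_def B_def hit_def)
  \<comment> \<open>The cylinder depends on the first \<open>i\<close> increments. Invariance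
    rewrites the event for the walk restarted after them, which almost surely sits in the carrier,
    where \<open>hit\<close> equals \<open>p\<close>.\<close>
  have cyl: "emeasure (incr \<nu>) (B \<inter> C) = ennreal p * emeasure (incr \<nu>) C"
    if C: "C = prod_emb UNIV (\<lambda>_. measure_pmf \<nu>) J (Pi\<^sub>E J E)" and J: "finite J" for J E C
  proof -
    obtain i where i: "J \<subseteq> {..<i}" using J finite_nat_iff_bounded by blast
    have Cm: "C \<in> sets (incr \<nu>)" unfolding C using J by (intro sets_PiM_I) auto
    have Cc: "comb_seq i \<omega> \<omega>' \<in> C \<longleftrightarrow> \<omega> \<in> C" for \<omega> \<omega>'
      using i unfolding C by (auto simp: prod_emb_def PiE_iff comb_seq_def)
    have Bc: "comb_seq i \<omega> \<omega>' \<in> B \<longleftrightarrow> chain G (chain G \<one> \<omega> i) \<omega>' \<in> A" for \<omega> \<omega>'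
      unfolding B_def mem_Collect_eq
      by (subst shift_invariant_iff_add[OF A(2), where i = i]) (simp only: chain_comb_seq)
    let ?f = "\<lambda>(\<omega>, \<omega>'). comb_seq i \<omega> \<omega>' :: nat \<Rightarrow> 'a"
    have m: "?f \<in> measurable (incr \<nu> \<Otimes>\<^sub>M incr \<nu>) (incr \<nu>)"
      by (rule measurable_comb_seq)
    have "emeasure (incr \<nu>) (B \<inter> C) = emeasure (distr (incr \<nu> \<Otimes>\<^sub>M incr \<nu>) (incr \<nu>) ?f) (B \<inter> C)"
      by (simp add: PiM_comb_seq)
    also have "\<dots> = emeasure (incr \<nu> \<Otimes>\<^sub>M incr \<nu>) (?f -` (B \<inter> C) \<inter> space (incr \<nu> \<Otimes>\<^sub>M incr \<nu>))"
      by (rule emeasure_distr[OF m]) (use B Cm in auto)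
    also have "\<dots> = (\<integral>\<^sup>+\<omega>. emeasure (incr \<nu>) (Pair \<omega> -` (?f -` (B \<inter> C) \<inter> space (incr \<nu> \<Otimes>\<^sub>M incr \<nu>))) \<partial>incr \<nu>)"
      by (rule S.emeasure_pair_measure_alt) (rule measurable_sets[OF m], use B Cm in auto)
    also have "\<dots> = (\<integral>\<^sup>+\<omega>. ennreal p * indicator C \<omega> \<partial>incr \<nu>)"
    proof (rule nn_integral_cong_AE)
      show "AE \<omega> in incr \<nu>. emeasure (incr \<nu>) (Pair \<omega> -` (?f -` (B \<inter> C) \<inter> space (incr \<nu> \<Otimes>\<^sub>M incr \<nu>)))
          = ennreal p * indicator C \<omega>"
        using AE_incr_carrier[OF G(1,2) one_closed]
      proof eventually_elim
        case (elim \<omega>)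
        have "Pair \<omega> -` (?f -` (B \<inter> C) \<inter> space (incr \<nu> \<Otimes>\<^sub>M incr \<nu>)) =
            (if \<omega> \<in> C then {\<omega>'. chain G (chain G \<one> \<omega> i) \<omega>' \<in> A} else {})"
          by (auto simp: Cc Bc space_pair_measure space_incr)
        then show ?case
          using p[of "chain G \<one> \<omega> i"] elim by (simp add: hit_def S.emeasure_eq_measure)
      qed
    qed
    also have "\<dots> = ennreal p * emeasure (incr \<nu>) C"
      using Cm by (simp add: nn_integral_cmult_indicator)
    finally show ?thesis .
  qed
  \<comment> \<open>Independence of cylinders determines the measure restricted to \<open>B\<close>;
    evaluating it on \<open>B\<close> itself gives \<open>p = p * p\<close>.\<close>
  have "density (incr \<nu>) (indicator B) = scale_measure (ennreal p) (incr \<nu>)"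
  proof (rule measure_eqI_PiM_infinite[where I = UNIV and M = "\<lambda>_. measure_pmf \<nu>"])
    fix E :: "nat \<Rightarrow> 'a set" and J :: "nat set" assume J: "finite J"
    let ?C = "prod_emb UNIV (\<lambda>_. measure_pmf \<nu>) J (Pi\<^sub>E J E)"
    have Cm: "?C \<in> sets (incr \<nu>)" using J by (intro sets_PiM_I) auto
    have "emeasure (density (incr \<nu>) (indicator B)) ?C = emeasure (incr \<nu>) (B \<inter> ?C)"
      using B Cm by (simp add: emeasure_restricted)
    then show "emeasure (density (incr \<nu>) (indicator B)) ?C = emeasure (scale_measure (ennreal p) (incr \<nu>)) ?C"
      using cyl[OF refl J] by simp
  next
    show "finite_measure (density (incr \<nu>) (indicator B))"
      using B sets.top[of "incr \<nu>"] by (intro finite_measureI)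
        (simp add: emeasure_restricted space_incr S.emeasure_eq_measure)
  qed auto
  then have "emeasure (density (incr \<nu>) (indicator B)) B = emeasure (scale_measure (ennreal p) (incr \<nu>)) B"
    by simp
  then have "ennreal p = ennreal p * ennreal p"
    using B by (simp add: emeasure_restricted S.emeasure_eq_measure pB)
  then have "p = p * p"
    by (metis B ennreal_inj ennreal_mult'' measure_nonneg pB zero_le_mult_iff)
  then show "hit G \<nu> A \<one> = 0 \<or> hit G \<nu> A \<one> = 1"
    unfolding p_def by simp
qed

section \<open>Averaged limits and amenability\<close>

text \<open>By Tychonoff the sequence has a cluster point in a product of intervals. The index type
  is arbitrary (sets of group elements in one use), so a filter takes the place of a
  subsequence.\<close>

lemma bounded_family_limit:
  fixes f :: "nat \<Rightarrow> 'i \<Rightarrow> real"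
  assumes "\<And>n i. \<bar>f n i\<bar> \<le> C"
  obtains F \<phi> where "F \<noteq> bot" "F \<le> sequentially" "\<And>i. ((\<lambda>n. f n i) \<longlongrightarrow> \<phi> i) F"
proof -
  define K where "K = (PiE UNIV (\<lambda>_ :: 'i. {-C..C}) :: ('i \<Rightarrow> real) set)"
  have "compactin (product_topology (\<lambda>_ :: 'i. euclidean) UNIV) K"
    unfolding K_def compactin_PiE by simp
  then have "compact K" by (simp add: euclidean_product_topology)
  moreover have "eventually (\<lambda>x. x \<in> K) (filtermap f sequentially)"
    using assms by (auto simp: eventually_filtermap K_def PiE_iff abs_le_iff minus_le_iff)
  ultimately obtain \<phi> where \<phi>: "inf (nhds \<phi>) (filtermap f sequentially) \<noteq> bot"
    unfolding compact_filter by (metis filtermap_bot_iff sequentially_bot)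
  \<comment> \<open>The times at which \<open>f\<close> is close to the cluster point; the filter is
    proper exactly because such times occur arbitrarily late.\<close>
  define F where "F = inf sequentially (filtercomap f (nhds \<phi>))"
  have "F \<noteq> bot"
  proof
    assume "F = bot"
    then have "eventually (\<lambda>_. False) F" by simp
    then obtain P Q where PQ: "eventually P sequentially" "eventually Q (filtercomap f (nhds \<phi>))"
        "\<And>n. P n \<Longrightarrow> Q n \<Longrightarrow> False"
      unfolding F_def eventually_inf by blast
    then obtain Q' where Q': "eventually Q' (nhds \<phi>)" "\<And>n. Q' (f n) \<Longrightarrow> Q n"
      unfolding eventually_filtercomap by blast
    have "eventually (\<lambda>x. \<not> Q' x) (filtermap f sequentially)"
      unfolding eventually_filtermap using PQ(1) by eventually_elim (use PQ(3) Q'(2) in blast)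
    then have "eventually (\<lambda>_. False) (inf (nhds \<phi>) (filtermap f sequentially))"
      unfolding eventually_inf using Q'(1) by blast
    then show False using \<phi> by (simp add: trivial_limit_def)
  qed
  moreover have "F \<le> sequentially" by (simp add: F_def)
  moreover have "((\<lambda>n. f n i) \<longlongrightarrow> \<phi> i) F" for i
  proof (rule topological_tendstoI)
    fix U :: "real set" assume U: "open U" "\<phi> i \<in> U"
    have "filterlim f (nhds \<phi>) F"
      unfolding filterlim_iff_le_filtercomap F_def by simp
    moreover have "open ((\<lambda>x :: 'i \<Rightarrow> real. x i) -` U)"
      by (rule open_vimage[OF U(1) continuous_on_product_coordinates])
    ultimately show "\<forall>\<^sub>F n in F. f n i \<in> U"
      using topological_tendstoD[of f \<phi> F "(\<lambda>x. x i) -` U"] U(2) by simp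
  qed
  ultimately show ?thesis using that by blast
qed

lemma pmf_tight:
  fixes p :: "'a::countable pmf"
  assumes "0 < e"
  obtains K where "finite K" "measure (measure_pmf p) (- K) < e"
proof -
  let ?B = "\<lambda>n. {x :: 'a. n \<le> to_nat x}"
  have "(\<lambda>n. measure (measure_pmf p) (?B n)) \<longlonglongrightarrow> measure (measure_pmf p) (\<Inter>n. ?B n)"
    by (rule measure_pmf.finite_Lim_measure_decseq) (auto simp: decseq_def)
  moreover have "(\<Inter>n. ?B n) = {}" by (auto simp: not_le) (use Suc_n_not_le_n in blast)
  ultimately have "(\<lambda>n. measure (measure_pmf p) (?B n)) \<longlonglongrightarrow> 0" by simp
  then obtain n where "measure (measure_pmf p) (?B n) < e"
    using assms by (metis (no_types, lifting) LIMSEQ_iff abs_of_nonneg diff_zero le_refl measure_nonneg real_norm_def)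
  moreover have "?B n = - {x. to_nat x < n}" by auto
  moreover have "finite {x :: 'a. to_nat x < n}"
    by (rule finite_imageD[of to_nat]) (auto intro: finite_subset[of _ "{..<n}"] inj_on_subset[OF inj_to_nat])
  ultimately show ?thesis using that by metis
qed

text \<open>Bounded convergence along an arbitrary filter: tightness leaves finitely many points,
  where convergence is uniform, and a remainder of small mass where the difference is at most
  \<open>2 * C\<close>.\<close>

lemma tendsto_expect:
  fixes p :: "'a::countable pmf"
  assumes u: "\<And>s. ((\<lambda>n. u n s) \<longlongrightarrow> v s) F" and F: "F \<noteq> bot" and C: "\<And>n s. \<bar>u n s\<bar> \<le> C"
  shows "((\<lambda>n. expect p (u n)) \<longlongrightarrow> expect p v) F"
proof (rule tendstoI)
  fix e :: real assume e: "0 < e"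
  have C0: "0 \<le> C" using C[of undefined undefined] by linarith
  have v: "\<bar>v s\<bar> \<le> C" for s
    using tendsto_rabs[OF u] F C by (intro tendsto_upperbound[of "\<lambda>n. \<bar>u n s\<bar>"]) auto
  \<comment> \<open>The remainder then contributes at most \<open>2 * C * e / (4 * C + 1)\<close>,
    below \<open>e / 2\<close>; the added 1 keeps the divisor positive when
    \<open>C = 0\<close>.\<close>
  obtain K where K: "finite K" "measure (measure_pmf p) (- K) < e / (4 * C + 1)"
    using pmf_tight[of "e / (4 * C + 1)"] e C0 by auto
  have bound: "\<bar>expect p (u n) - expect p v\<bar> \<le> (\<Sum>k\<in>K. \<bar>u n k - v k\<bar>) + 2 * C * measure (measure_pmf p) (- K)" for n
  proof -
    have "expect p (u n) - expect p v = expect p (\<lambda>s. u n s - v s)"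
      by (subst Bochner_Integration.integral_diff) (auto intro: integrable_pmf_bounded C v)
    also have "\<bar>\<dots>\<bar> \<le> expect p (\<lambda>s. \<bar>u n s - v s\<bar>)"
      by (rule integral_abs_bound)
    also have "\<dots> \<le> expect p (\<lambda>s. (\<Sum>k\<in>K. \<bar>u n k - v k\<bar>) + 2 * C * indicator (- K) s)"
    proof (rule expect_mono)
      fix s
      have d: "\<bar>u n s - v s\<bar> \<le> 2 * C" using C[of n s] v[of s] by linarith
      then show "\<bar>\<bar>u n s - v s\<bar>\<bar> \<le> 2 * C" by simp
      show "\<bar>u n s - v s\<bar> \<le> (\<Sum>k\<in>K. \<bar>u n k - v k\<bar>) + 2 * C * indicator (- K) s"
      proof (cases "s \<in> K")
        case True
        then show ?thesis using member_le_sum[of s K "\<lambda>k. \<bar>u n k - v k\<bar>"] K by simp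
      next
        case False
        then show ?thesis using d by (simp add: sum_nonneg add_increasing)
      qed
      show "\<bar>(\<Sum>k\<in>K. \<bar>u n k - v k\<bar>) + 2 * C * indicator (- K) s\<bar> \<le> (\<Sum>k\<in>K. \<bar>u n k - v k\<bar>) + 2 * C"
        using C0 by (auto simp: indicator_def sum_nonneg)
    qed
    also have "\<dots> = (\<Sum>k\<in>K. \<bar>u n k - v k\<bar>) + 2 * C * measure (measure_pmf p) (- K)"
      by (subst Bochner_Integration.integral_add)
        (auto intro!: integrable_pmf_bounded[where C = 1] simp: indicator_abs_le_1)
    finally show ?thesis .
  qed
  have "((\<lambda>n. (\<Sum>k\<in>K. \<bar>u n k - v k\<bar>)) \<longlongrightarrow> (\<Sum>k\<in>K. \<bar>v k - v k\<bar>)) F"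
    by (intro tendsto_intros u)
  then have "eventually (\<lambda>n. (\<Sum>k\<in>K. \<bar>u n k - v k\<bar>) < e / 2) F"
    by (rule order_tendstoD) (use e in simp)
  then show "eventually (\<lambda>n. dist (expect p (u n)) (expect p v) < e) F"
  proof eventually_elim
    case (elim n)
    have "2 * C * measure (measure_pmf p) (- K) \<le> 2 * C * (e / (4 * C + 1))"
      using K C0 by (intro mult_left_mono) auto
    also have "\<dots> \<le> e / 2" using e C0 by (simp add: field_simps)
    finally show ?case using bound[of n] elim by (simp add: dist_real_def)
  qed
qed

text \<open>The iterated Markov operator: the expected value of \<open>f\<close> after
  \<open>n\<close> steps of the walk from \<open>x\<close>.\<close>

primrec pw :: "('a, 'c) monoid_scheme \<Rightarrow> 'a pmf \<Rightarrow> nat \<Rightarrow> ('a \<Rightarrow> real) \<Rightarrow> 'a \<Rightarrow> real" where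
  "pw G \<nu> 0 f x = f x"
| "pw G \<nu> (Suc n) f x = expect \<nu> (\<lambda>s. pw G \<nu> n f (x \<otimes>\<^bsub>G\<^esub> s))"

lemma abs_pw_le:
  assumes "\<And>x. \<bar>f x\<bar> \<le> C"
  shows "\<bar>pw G \<nu> n f x\<bar> \<le> C"
proof (induction n arbitrary: x)
  case (Suc n)
  show ?case unfolding pw.simps by (rule expect_abs_le) (rule Suc)
qed (simp add: assms)

text \<open>Applying the Markov operator to a Cesaro average changes it by a telescoped term of size
  at most \<open>2 * C / n\<close>, so limits of the averages are harmonic. A single filter serves
  all indices \<open>i\<close>, which keeps linear relations between the functions.\<close>

lemma averaged_harmonic:
  fixes G :: "('a::countable, 'c) monoid_scheme" (structure) and f :: "'i \<Rightarrow> 'a \<Rightarrow> real"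
  assumes C: "\<And>i x. \<bar>f i x\<bar> \<le> C"
  obtains F \<Phi> where "F \<noteq> bot" "F \<le> sequentially"
    "\<And>i x. ((\<lambda>n. (\<Sum>k<n. pw G \<nu> k (f i) x) / real n) \<longlongrightarrow> \<Phi> i x) F"
    "\<And>i. harmonic G \<nu> (\<Phi> i)" "\<And>i x. \<bar>\<Phi> i x\<bar> \<le> C"
proof -
  define a where "a n i x = (\<Sum>k<n. pw G \<nu> k (f i) x) / real n" for n i x
  have C0: "0 \<le> C" using C[of undefined undefined] by linarith
  have a: "\<bar>a n i x\<bar> \<le> C" for n i x
  proof (cases "n = 0")
    case False
    have "\<bar>\<Sum>k<n. pw G \<nu> k (f i) x\<bar> \<le> (\<Sum>k<n. C)"
      by (rule order_trans[OF sum_abs sum_mono]) (rule abs_pw_le[OF C])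
    then show ?thesis using False by (simp add: a_def divide_simps mult.commute)
  qed (simp add: a_def C0)
  obtain F \<phi> where F: "F \<noteq> bot" "F \<le> sequentially" and \<phi>: "\<And>ix. ((\<lambda>n. a n (fst ix) (snd ix)) \<longlongrightarrow> \<phi> ix) F"
    using bounded_family_limit[of "\<lambda>n ix. a n (fst ix) (snd ix)" C] a by metis
  have lim: "((\<lambda>n. a n i x) \<longlongrightarrow> \<phi> (i, x)) F" for i x using \<phi>[of "(i, x)"] by simp
  have "harmonic G \<nu> (\<lambda>x. \<phi> (i, x))" for i
    unfolding harmonic_def
  proof
    fix x
    have "((\<lambda>n. expect \<nu> (\<lambda>s. a n i (x \<otimes> s))) \<longlongrightarrow> expect \<nu> (\<lambda>s. \<phi> (i, x \<otimes> s))) F"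
      by (rule tendsto_expect[OF lim F(1) a])
    moreover have "((\<lambda>n. expect \<nu> (\<lambda>s. a n i (x \<otimes> s))) \<longlongrightarrow> \<phi> (i, x)) F"
    proof -
      have eq: "expect \<nu> (\<lambda>s. a n i (x \<otimes> s)) = a n i x + (pw G \<nu> n (f i) x - f i x) / real n" for n
      proof -
        have "expect \<nu> (\<lambda>s. a n i (x \<otimes> s)) = (\<Sum>k<n. pw G \<nu> (Suc k) (f i) x) / real n"
          unfolding a_def pw.simps
          by (subst integral_divide_zero, subst Bochner_Integration.integral_sum)
             (auto intro!: integrable_pmf_bounded abs_pw_le[OF C])
        also have "(\<Sum>k<n. pw G \<nu> (Suc k) (f i) x) = (\<Sum>k<n. pw G \<nu> k (f i) x) + (pw G \<nu> n (f i) x - f i x)"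
          by (induction n) (auto simp del: pw.simps(2))
        finally show ?thesis by (simp add: a_def add_divide_distrib)
      qed
      have "(\<lambda>n. (pw G \<nu> n (f i) x - f i x) / real n) \<longlonglongrightarrow> 0"
      proof (rule Lim_null_comparison)
        show "\<forall>\<^sub>F n in sequentially. norm ((pw G \<nu> n (f i) x - f i x) / real n) \<le> (2 * C) / real n"
        proof (intro always_eventually allI)
          fix n
          have "\<bar>pw G \<nu> n (f i) x - f i x\<bar> \<le> 2 * C"
            using abs_pw_le[where f = "f i", OF C, of G \<nu> n x] C[of i x] by linarith
          then show "norm ((pw G \<nu> n (f i) x - f i x) / real n) \<le> (2 * C) / real n"
            by (simp add: divide_right_mono)
        qed
      qed (rule lim_const_over_n)
      then have "((\<lambda>n. (pw G \<nu> n (f i) x - f i x) / real n) \<longlongrightarrow> 0) F"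
        by (rule tendsto_mono[OF F(2)])
      from tendsto_add[OF lim[of i x] this] show ?thesis by (simp add: eq)
    qed
    ultimately show "\<phi> (i, x) = expect \<nu> (\<lambda>s. \<phi> (i, x \<otimes> s))"
      using tendsto_unique F(1) by blast
  qed
  moreover have "\<bar>\<phi> (i, x)\<bar> \<le> C" for i x
    using tendsto_rabs[OF lim] F(1) a by (intro tendsto_upperbound[of "\<lambda>n. \<bar>a n i x\<bar>"]) auto
  ultimately show ?thesis
    using F lim unfolding a_def by (intro that[of F "\<lambda>i x. \<phi> (i, x)"])
qed

lemma pw_add:
  assumes "\<And>x. \<bar>f x\<bar> \<le> C" "\<And>x. \<bar>g x\<bar> \<le> D"
  shows "pw G \<nu> n (\<lambda>x. f x + g x) x = pw G \<nu> n f x + pw G \<nu> n g x"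
proof (induction n arbitrary: x)
  case (Suc n)
  show ?case unfolding pw.simps Suc
    by (intro Bochner_Integration.integral_add integrable_pmf_bounded[where C = C]
        integrable_pmf_bounded[where C = D] abs_pw_le assms)
qed simp

lemma pw_cong:
  assumes "group G" "prob_on G \<nu>" "x \<in> carrier G" "\<And>y. y \<in> carrier G \<Longrightarrow> f y = g y"
  shows "pw G \<nu> n f x = pw G \<nu> n g x"
  using assms(3)
proof (induction n arbitrary: x)
  case (Suc n)
  interpret group G by fact
  show ?case unfolding pw.simps
    by (rule expect_cong) (use Suc assms(2) in \<open>auto simp: prob_on_def\<close>)
qed (simp add: assms)

text \<open>Increments act on the right, so left translations commute with the Markov
  operator.\<close>

lemma pw_left_mult:
  fixes G (structure)
  assumes "group G" "prob_on G \<nu>" "x \<in> carrier G" "a \<in> carrier G"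
  shows "pw G \<nu> n (\<lambda>y. f (a \<otimes> y)) x = pw G \<nu> n f (a \<otimes> x)"
  using assms(3)
proof (induction n arbitrary: x)
  case (Suc n)
  interpret group G by fact
  show ?case unfolding pw.simps
    by (rule expect_cong) (use Suc assms(2,4) in \<open>auto simp: prob_on_def m_assoc subset_iff\<close>)
qed simp

lemma pw_const: "pw G \<nu> n (\<lambda>_. c) x = c"
  by (induction n arbitrary: x) auto

text \<open>The averaged limits of all indicators are taken along one filter, hence are additive in
  the set. Translating the set by \<open>g\<close> moves the starting point to the inverse of
  \<open>g\<close>, and constancy of bounded harmonic functions moves it back.\<close>

lemma liouville_imp_amenable:
  fixes G :: "('a::countable, 'c) monoid_scheme" (structure)
  assumes G: "group G" "prob_on G \<nu>" "liouville G \<nu>"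
  shows "amenable G"
proof -
  interpret group G by fact
  let ?f = "\<lambda>A x. indicator A x :: real"
  have C: "\<bar>?f A x\<bar> \<le> 1" for A x by (simp add: indicator_def)
  obtain F \<Phi> where F: "F \<noteq> bot" "F \<le> sequentially"
    and lim: "\<And>A x. ((\<lambda>n. (\<Sum>k<n. pw G \<nu> k (?f A) x) / real n) \<longlongrightarrow> \<Phi> A x) F"
    and har: "\<And>A. harmonic G \<nu> (\<Phi> A)" "\<And>A x. \<bar>\<Phi> A x\<bar> \<le> 1"
    using averaged_harmonic[of ?f 1 G \<nu>, OF C] by blast
  have const: "\<Phi> A x = \<Phi> A \<one>" if "x \<in> carrier G" for A x
    using G(3) har that unfolding liouville_def by blast
  have ev: "\<Phi> A x = c" if "\<forall>\<^sub>F n in sequentially. (\<Sum>k<n. pw G \<nu> k (?f A) x) / real n = b n" "(b \<longlongrightarrow> c) F" for A x b c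
  proof -
    have "((\<lambda>n. (\<Sum>k<n. pw G \<nu> k (?f A) x) / real n) \<longlongrightarrow> c) F"
      by (rule Lim_transform_eventually[OF that(2)])
         (use filter_leD[OF F(2) that(1)] in \<open>auto elim: eventually_mono\<close>)
    then show ?thesis using lim F(1) tendsto_unique by blast
  qed
  show ?thesis
    unfolding amenable_def
  proof (intro exI[of _ "\<lambda>A. \<Phi> A \<one>"] conjI allI impI ballI)
    have "pw G \<nu> k (?f (carrier G)) \<one> = 1" for k
      using pw_cong[OF G(1,2) one_closed, of "?f (carrier G)" "\<lambda>_. 1" k] by (simp add: pw_const)
    then show "\<Phi> (carrier G) \<one> = 1"
      by (intro ev[OF _ tendsto_const]) (auto intro!: eventually_mono[OF eventually_gt_at_top[of 0]])
  next
    fix A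
    have "0 \<le> pw G \<nu> k (?f A) x" for k x
      by (induction k arbitrary: x) (auto intro: integral_nonneg_AE)
    then show "0 \<le> \<Phi> A \<one>"
      using F(1) by (intro tendsto_lowerbound[OF lim]) (auto intro!: always_eventually sum_nonneg divide_nonneg_nonneg)
  next
    fix A B :: "'a set" assume "A \<inter> B = {}"
    then have "?f (A \<union> B) = (\<lambda>x. ?f A x + ?f B x)" by (auto simp: indicator_def fun_eq_iff)
    then have "pw G \<nu> k (?f (A \<union> B)) x = pw G \<nu> k (?f A) x + pw G \<nu> k (?f B) x" for k x
      using pw_add[of "?f A" 1 "?f B" 1, OF C C] by simp
    then show "\<Phi> (A \<union> B) \<one> = \<Phi> A \<one> + \<Phi> B \<one>"
      by (intro ev[OF _ tendsto_add[OF lim lim]]) (simp add: sum.distrib add_divide_distrib)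
  next
    fix g A assume g: "g \<in> carrier G" and A: "A \<subseteq> carrier G"
    have "?f (g <#\<^bsub>G\<^esub> A) x = ?f A (inv\<^bsub>G\<^esub> g \<otimes> x)" if "x \<in> carrier G" for x
    proof -
      have "x \<in> g <#\<^bsub>G\<^esub> A \<longleftrightarrow> inv\<^bsub>G\<^esub> g \<otimes> x \<in> A"
      proof
        assume "x \<in> g <#\<^bsub>G\<^esub> A"
        then show "inv\<^bsub>G\<^esub> g \<otimes> x \<in> A"
          using g A by (auto simp: l_coset_def m_assoc[symmetric] subset_iff)
      next
        assume "inv\<^bsub>G\<^esub> g \<otimes> x \<in> A"
        moreover have "x = g \<otimes> (inv\<^bsub>G\<^esub> g \<otimes> x)" using g that by (simp add: m_assoc[symmetric])
        ultimately show "x \<in> g <#\<^bsub>G\<^esub> A" by (auto simp: l_coset_def)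
      qed
      then show ?thesis by (simp add: indicator_def)
    qed
    then have "pw G \<nu> k (?f (g <#\<^bsub>G\<^esub> A)) \<one> = pw G \<nu> k (?f A) (inv\<^bsub>G\<^esub> g)" for k
      using g pw_cong[OF G(1,2) one_closed, of "?f (g <#\<^bsub>G\<^esub> A)" "\<lambda>x. ?f A (inv\<^bsub>G\<^esub> g \<otimes> x)" k]
        pw_left_mult[OF G(1,2) one_closed, of "inv\<^bsub>G\<^esub> g" k "?f A"] by simp
    then have "\<Phi> (g <#\<^bsub>G\<^esub> A) \<one> = \<Phi> A (inv\<^bsub>G\<^esub> g)"
      by (intro ev[OF _ lim]) simp
    then show "\<Phi> (g <#\<^bsub>G\<^esub> A) \<one> = \<Phi> A \<one>"
      using const[of "inv\<^bsub>G\<^esub> g" A] g by simp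
  qed
qed

section \<open>Finite conjugacy classes act trivially on bounded harmonic functions\<close>

text \<open>The recursion splits off the first step; here the last step is split off, as needed for
  telescoping.\<close>

lemma pw_Suc': "pw G \<nu> (Suc n) f x = pw G \<nu> n (\<lambda>y. expect \<nu> (\<lambda>s. f (y \<otimes>\<^bsub>G\<^esub> s))) x"
proof (induction n arbitrary: x)
  case (Suc n)
  show ?case by (subst pw.simps, subst Suc) simp
qed simp

lemma pw_mono:
  assumes "group G" "prob_on G \<nu>" "x \<in> carrier G" "\<And>y. \<bar>f y\<bar> \<le> C" "\<And>y. \<bar>g y\<bar> \<le> D"
    "\<And>y. y \<in> carrier G \<Longrightarrow> f y \<le> g y"
  shows "pw G \<nu> n f x \<le> pw G \<nu> n g x"
  using assms(3)
proof (induction n arbitrary: x)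
  case (Suc n)
  interpret group G by fact
  show ?case unfolding pw.simps
    by (rule expect_mono[where C = C and D = D])
      (use Suc assms(2) in \<open>auto simp: prob_on_def intro!: abs_pw_le assms(4,5)\<close>)
qed (simp add: assms)

lemma pw_scale: "pw G \<nu> n (\<lambda>y. c * f y) x = c * pw G \<nu> n f x"
  by (induction n arbitrary: x) auto

lemma pw_sum:
  assumes "\<And>i x. \<bar>f i x\<bar> \<le> C" "finite I"
  shows "pw G \<nu> n (\<lambda>x. \<Sum>i\<in>I. f i x) x = (\<Sum>i\<in>I. pw G \<nu> n (f i) x)"
proof (induction n arbitrary: x)
  case (Suc n)
  show ?case unfolding pw.simps Suc
    by (intro Bochner_Integration.integral_sum integrable_pmf_bounded[where C = C] abs_pw_le assms)
qed simp

lemma abs_square_diff_le: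
  fixes a b :: real
  assumes "\<bar>a\<bar> \<le> C" "\<bar>b\<bar> \<le> C"
  shows "\<bar>(a - b)\<^sup>2\<bar> \<le> (2 * C)\<^sup>2"
proof -
  have "\<bar>a - b\<bar> \<le> \<bar>2 * C\<bar>" using assms by linarith
  then have "(a - b)\<^sup>2 \<le> (2 * C)\<^sup>2" by (simp only: abs_le_square_iff)
  then show ?thesis by simp
qed

lemma abs_square_le:
  fixes a :: real
  assumes "\<bar>a\<bar> \<le> C"
  shows "\<bar>a\<^sup>2\<bar> \<le> C\<^sup>2"
  using power_mono[OF assms, of 2] by simp

lemma expect_square_diff:
  assumes "\<And>x. \<bar>f x\<bar> \<le> C"
  shows "expect p (\<lambda>x. (f x - expect p f)\<^sup>2) = expect p (\<lambda>x. (f x)\<^sup>2) - (expect p f)\<^sup>2"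
proof -
  have i: "integrable (measure_pmf p) f" "integrable (measure_pmf p) (\<lambda>x. (f x)\<^sup>2)"
    by (rule integrable_pmf_bounded[where C = C], rule assms)
      (rule integrable_pmf_bounded[where C = "C\<^sup>2"], rule abs_square_le, rule assms)
  have "(f x - expect p f)\<^sup>2 = (f x)\<^sup>2 - 2 * expect p f * f x + (expect p f)\<^sup>2" for x
    by (simp add: power2_eq_square algebra_simps)
  then show ?thesis using i by (simp add: power2_eq_square)
qed

lemma expect_square_le:
  assumes "\<And>x. \<bar>f x\<bar> \<le> C"
  shows "(expect p f)\<^sup>2 \<le> expect p (\<lambda>x. (f x)\<^sup>2)"
proof -
  have "0 \<le> expect p (\<lambda>x. (f x - expect p f)\<^sup>2)" by (rule integral_nonneg_AE) simp
  then show ?thesis using expect_square_diff[of f C p] assms by simp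
qed

text \<open>Squares rather than absolute values, because martingale increments are orthogonal and
  their squared sizes telescope.\<close>

definition incr_sq :: "('a, 'c) monoid_scheme \<Rightarrow> ('a \<Rightarrow> real) \<Rightarrow> 'a \<Rightarrow> 'a \<Rightarrow> real" where
  "incr_sq G h c x = (h (x \<otimes>\<^bsub>G\<^esub> c) - h x)\<^sup>2"

text \<open>For harmonic \<open>h\<close> the variance of one step equals the increase of the
  expectation of the square of \<open>h\<close>. These expectations increase and are bounded by the
  square of \<open>C\<close>, so consecutive differences vanish in the limit.\<close>

lemma energy_tendsto_0:
  fixes G (structure)
  assumes G: "group G" "prob_on G \<nu>" and h: "harmonic G \<nu> h" and C: "\<And>x. \<bar>h x\<bar> \<le> C" and x: "x \<in> carrier G"
  shows "(\<lambda>n. pw G \<nu> n (\<lambda>y. expect \<nu> (\<lambda>s. incr_sq G h s y)) x) \<longlonglongrightarrow> 0"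
proof -
  let ?e = "\<lambda>y. expect \<nu> (\<lambda>s. incr_sq G h s y)"
  let ?h2 = "\<lambda>y. (h y)\<^sup>2"
  have C2: "\<bar>?h2 y\<bar> \<le> C\<^sup>2" for y by (rule abs_square_le[OF C])
  have eq: "pw G \<nu> n ?e x = pw G \<nu> (Suc n) ?h2 x - pw G \<nu> n ?h2 x" for n
  proof -
    have "pw G \<nu> n ?e x = pw G \<nu> n (\<lambda>y. expect \<nu> (\<lambda>s. ?h2 (y \<otimes> s)) + (-1) * ?h2 y) x"
    proof (rule pw_cong[OF G x])
      fix y assume y: "y \<in> carrier G"
      then have "h y = expect \<nu> (\<lambda>s. h (y \<otimes> s))" using h by (simp add: harmonic_def)
      then show "?e y = expect \<nu> (\<lambda>s. ?h2 (y \<otimes> s)) + (-1) * ?h2 y"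
        unfolding incr_sq_def using expect_square_diff[of "\<lambda>s. h (y \<otimes> s)" C \<nu>, OF C] by simp
    qed
    also have "\<dots> = pw G \<nu> n (\<lambda>y. expect \<nu> (\<lambda>s. ?h2 (y \<otimes> s))) x + pw G \<nu> n (\<lambda>y. (-1) * ?h2 y) x"
    proof (rule pw_add[where C = "C\<^sup>2" and D = "C\<^sup>2"])
      fix y
      show "\<bar>expect \<nu> (\<lambda>s. ?h2 (y \<otimes> s))\<bar> \<le> C\<^sup>2" by (rule expect_abs_le) (rule C2)
      show "\<bar>(-1) * ?h2 y\<bar> \<le> C\<^sup>2" using C2[of y] by simp
    qed
    finally show ?thesis
      using pw_Suc'[of G \<nu> n ?h2 x] pw_scale[of G \<nu> n "-1" ?h2 x] by (simp del: pw.simps)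
  qed
  have "0 \<le> ?e y" for y by (rule integral_nonneg_AE) (simp add: incr_sq_def)
  then have nn: "0 \<le> pw G \<nu> n ?e x" for n
    by (induction n arbitrary: x) (auto intro!: integral_nonneg_AE)
  have "incseq (\<lambda>n. pw G \<nu> n ?h2 x)"
    by (rule incseq_SucI) (use eq nn in \<open>metis diff_ge_0_iff_ge\<close>)
  moreover have "pw G \<nu> n ?h2 x \<le> C\<^sup>2" for n using abs_pw_le[of ?h2 "C\<^sup>2" G \<nu> n x] C2 by (simp add: abs_le_iff)
  ultimately obtain l where l: "(\<lambda>n. pw G \<nu> n ?h2 x) \<longlonglongrightarrow> l"
    using incseq_convergent by blast
  from tendsto_diff[OF LIMSEQ_Suc[OF this] this] show ?thesis by (simp add: eq del: pw.simps)
qed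

text \<open>For an atom \<open>s\<close> of \<open>\<nu>\<close> the squared increment is at most
  the energy divided by \<open>pmf \<nu> s\<close>. For \<open>s \<otimes> t\<close> the second
  increment starts at \<open>y \<otimes> s\<close> and is dominated in the same way by an average
  over one more step, which turns \<open>n\<close> into \<open>Suc n\<close>.\<close>

lemma incr_sq_tendsto_0:
  fixes G (structure)
  assumes G: "group G" "prob_on G \<nu>" and h: "harmonic G \<nu> h" and C: "\<And>x. \<bar>h x\<bar> \<le> C" and x: "x \<in> carrier G"
    and c: "c \<in> sgp_gen G (set_pmf \<nu>)"
  shows "(\<lambda>n. pw G \<nu> n (incr_sq G h c) x) \<longlonglongrightarrow> 0"
proof -
  interpret group G by fact
  define good where "good c \<longleftrightarrow> (\<forall>x\<in>carrier G. (\<lambda>n. pw G \<nu> n (incr_sq G h c) x) \<longlonglongrightarrow> 0)" for c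
  have bd: "\<bar>incr_sq G h c y\<bar> \<le> (2 * C)\<^sup>2" for c y
    unfolding incr_sq_def by (rule abs_square_diff_le[OF C C])
  have nn: "0 \<le> incr_sq G h c y" for c y by (simp add: incr_sq_def)
  have pnn: "0 \<le> pw G \<nu> n f x" if "\<And>y. 0 \<le> f y" for f n x
    using that by (induction n arbitrary: x) (auto intro!: integral_nonneg_AE)
  have base: "good s" if s: "s \<in> set_pmf \<nu>" for s
    unfolding good_def
  proof
    fix x assume x: "x \<in> carrier G"
    let ?e = "\<lambda>y. expect \<nu> (\<lambda>s. incr_sq G h s y)"
    have le: "pw G \<nu> n (incr_sq G h s) x \<le> (1 / pmf \<nu> s) * pw G \<nu> n ?e x" for n
      unfolding pw_scale[symmetric]
    proof (rule pw_mono[OF G x])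
      fix y
      show "\<bar>1 / pmf \<nu> s * ?e y\<bar> \<le> 1 / pmf \<nu> s * (2 * C)\<^sup>2"
        using bd by (simp add: abs_mult divide_right_mono expect_abs_le)
      have "pmf \<nu> s * incr_sq G h s y \<le> ?e y"
        by (rule pmf_times_le_expect[where C = "(2 * C)\<^sup>2"]) (use bd nn s in auto)
      then show "incr_sq G h s y \<le> 1 / pmf \<nu> s * ?e y"
        using pmf_positive[OF s] by (simp add: field_simps)
    qed (rule bd)
    show "(\<lambda>n. pw G \<nu> n (incr_sq G h s) x) \<longlonglongrightarrow> 0"
      by (rule tendsto_sandwich[OF _ _ tendsto_const tendsto_mult_right_zero[where c = "1 / pmf \<nu> s", OF energy_tendsto_0[OF G h C x]]])
        (use le in \<open>auto intro!: always_eventually pnn nn\<close>)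
  qed
  have step: "good (s \<otimes> t)" if s: "s \<in> set_pmf \<nu>" and t: "good t" "t \<in> carrier G" for s t
    unfolding good_def
  proof
    fix x assume x: "x \<in> carrier G"
    have sG: "s \<in> carrier G" using s G(2) by (auto simp: prob_on_def)
    let ?g = "\<lambda>y. expect \<nu> (\<lambda>s. incr_sq G h t (y \<otimes> s))"
    have le: "pw G \<nu> n (incr_sq G h (s \<otimes> t)) x
        \<le> 2 * pw G \<nu> n (incr_sq G h s) x + (2 / pmf \<nu> s) * pw G \<nu> (Suc n) (incr_sq G h t) x" for n
    proof -
      have "pw G \<nu> n (incr_sq G h (s \<otimes> t)) x \<le> pw G \<nu> n (\<lambda>y. 2 * incr_sq G h s y + (2 / pmf \<nu> s) * ?g y) x"
      proof (rule pw_mono[OF G x])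
        fix y
        have "\<bar>?g y\<bar> \<le> (2 * C)\<^sup>2" by (rule expect_abs_le) (rule bd)
        then have "\<bar>(2 / pmf \<nu> s) * ?g y\<bar> \<le> (2 / pmf \<nu> s) * (2 * C)\<^sup>2"
          by (simp add: abs_mult divide_right_mono)
        then show "\<bar>2 * incr_sq G h s y + (2 / pmf \<nu> s) * ?g y\<bar> \<le> 2 * (2 * C)\<^sup>2 + (2 / pmf \<nu> s) * (2 * C)\<^sup>2"
          using bd[of s y] by linarith
        assume y: "y \<in> carrier G"
        have "pmf \<nu> s * incr_sq G h t (y \<otimes> s) \<le> ?g y"
          by (rule pmf_times_le_expect[where C = "(2 * C)\<^sup>2"]) (use bd nn s in auto)
        then have 1: "incr_sq G h t (y \<otimes> s) \<le> 1 / pmf \<nu> s * ?g y"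
          using pmf_positive[OF s] by (simp add: field_simps)
        have "(u - w)\<^sup>2 \<le> 2 * (v - w)\<^sup>2 + 2 * (u - v)\<^sup>2" for u v w :: real
          using zero_le_power2[of "(v - w) - (u - v)"] by (simp add: power2_eq_square algebra_simps)
        from this[of "h (y \<otimes> s \<otimes> t)" "h y" "h (y \<otimes> s)"]
        have "incr_sq G h (s \<otimes> t) y \<le> 2 * incr_sq G h s y + 2 * incr_sq G h t (y \<otimes> s)"
          using y sG t(2) by (simp add: incr_sq_def m_assoc)
        with 1 show "incr_sq G h (s \<otimes> t) y \<le> 2 * incr_sq G h s y + (2 / pmf \<nu> s) * ?g y"
          by simp
      qed (rule bd)
      also have "\<dots> = pw G \<nu> n (\<lambda>y. 2 * incr_sq G h s y) x + pw G \<nu> n (\<lambda>y. (2 / pmf \<nu> s) * ?g y) x"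
      proof (rule pw_add[where C = "2 * (2 * C)\<^sup>2" and D = "(2 / pmf \<nu> s) * (2 * C)\<^sup>2"])
        fix y
        show "\<bar>2 * incr_sq G h s y\<bar> \<le> 2 * (2 * C)\<^sup>2" using bd[of s y] by simp
        have "\<bar>?g y\<bar> \<le> (2 * C)\<^sup>2" by (rule expect_abs_le) (rule bd)
        then show "\<bar>(2 / pmf \<nu> s) * ?g y\<bar> \<le> (2 / pmf \<nu> s) * (2 * C)\<^sup>2"
          by (simp add: abs_mult divide_right_mono)
      qed
      finally show ?thesis
        using pw_Suc'[of G \<nu> n "incr_sq G h t" x] pw_scale[of G \<nu> n 2 "incr_sq G h s" x]
          pw_scale[of G \<nu> n "2 / pmf \<nu> s" ?g x] by (simp del: pw.simps)
    qed
    have "(\<lambda>n. 2 * pw G \<nu> n (incr_sq G h s) x + (2 / pmf \<nu> s) * pw G \<nu> (Suc n) (incr_sq G h t) x)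
        \<longlonglongrightarrow> 2 * 0 + (2 / pmf \<nu> s) * 0"
      using base[OF s] t(1) x unfolding good_def by (intro tendsto_intros LIMSEQ_Suc) auto
    then have "(\<lambda>n. 2 * pw G \<nu> n (incr_sq G h s) x + (2 / pmf \<nu> s) * pw G \<nu> (Suc n) (incr_sq G h t) x)
        \<longlonglongrightarrow> 0" by (simp only: mult_zero_right add_0)
    then show "(\<lambda>n. pw G \<nu> n (incr_sq G h (s \<otimes> t)) x) \<longlonglongrightarrow> 0"
      by (rule tendsto_sandwich[OF always_eventually always_eventually tendsto_const, rotated 2])
        (intro allI pnn nn, intro allI le)
  qed
  \<comment> \<open>\<open>step\<close> can only prepend one generator, whereas
    \<open>sgp_gen\<close> multiplies arbitrary words; the induction therefore carries closure under
    left multiplication by \<open>c\<close>.\<close>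
  have "good c \<and> (\<forall>t\<in>carrier G. good t \<longrightarrow> good (c \<otimes> t))"
    using c
  proof induction
    case (base s)
    then show ?case using \<open>\<And>s. s \<in> set_pmf \<nu> \<Longrightarrow> good s\<close> step by blast
  next
    case (mult a b)
    have ab: "a \<in> carrier G" "b \<in> carrier G"
      using mult.hyps sgp_gen_subset[OF G(1) G(2)[unfolded prob_on_def]] by blast+
    show ?case
      using mult.IH ab by (metis m_assoc m_closed)
  qed
  then show ?thesis using x by (simp add: good_def)
qed

lemma harmonic_eq_pw:
  fixes G (structure)
  assumes "group G" "prob_on G \<nu>" "harmonic G \<nu> h" "x \<in> carrier G"
  shows "pw G \<nu> n h x = h x"
  using assms(4)
proof (induction n arbitrary: x)
  case (Suc n)
  interpret group G by fact
  have "pw G \<nu> (Suc n) h x = expect \<nu> (\<lambda>s. h (x \<otimes> s))"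
    unfolding pw.simps by (rule expect_cong) (use Suc assms(2) in \<open>auto simp: prob_on_def\<close>)
  then show ?case using assms(3) Suc(2) by (simp add: harmonic_def)
qed simp

lemma square_le_pw:
  fixes G (structure)
  assumes "\<And>x. \<bar>f x\<bar> \<le> C"
  shows "(pw G \<nu> n f x)\<^sup>2 \<le> pw G \<nu> n (\<lambda>y. (f y)\<^sup>2) x"
proof (induction n arbitrary: x)
  case (Suc n)
  have C2: "\<bar>(f y)\<^sup>2\<bar> \<le> C\<^sup>2" for y by (rule abs_square_le[OF assms])
  have "(pw G \<nu> (Suc n) f x)\<^sup>2 \<le> expect \<nu> (\<lambda>s. (pw G \<nu> n f (x \<otimes> s))\<^sup>2)"
    unfolding pw.simps by (rule expect_square_le) (rule abs_pw_le[OF assms])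
  also have "\<dots> \<le> expect \<nu> (\<lambda>s. pw G \<nu> n (\<lambda>y. (f y)\<^sup>2) (x \<otimes> s))"
  proof (rule expect_mono[where C = "C\<^sup>2" and D = "C\<^sup>2"])
    fix s
    show "\<bar>(pw G \<nu> n f (x \<otimes> s))\<^sup>2\<bar> \<le> C\<^sup>2"
      by (rule abs_square_le[OF abs_pw_le[OF assms]])
  qed (auto intro: Suc abs_pw_le C2)
  finally show ?case by simp
qed simp

lemma harmonic_left_translate:
  fixes G (structure)
  assumes "group G" "prob_on G \<nu>" "harmonic G \<nu> h" "a \<in> carrier G"
  shows "harmonic G \<nu> (\<lambda>x. h (a \<otimes> x))"
  unfolding harmonic_def
proof
  interpret group G by fact
  fix x assume x: "x \<in> carrier G"
  have "h (a \<otimes> x) = expect \<nu> (\<lambda>s. h (a \<otimes> x \<otimes> s))"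
    using assms x by (simp add: harmonic_def)
  also have "\<dots> = expect \<nu> (\<lambda>s. h (a \<otimes> (x \<otimes> s)))"
    by (rule expect_cong) (use assms x in \<open>auto simp: prob_on_def m_assoc subset_iff\<close>)
  finally show "h (a \<otimes> x) = expect \<nu> (\<lambda>s. h (a \<otimes> (x \<otimes> s)))" .
qed

lemma harmonic_diff:
  fixes G (structure)
  assumes "harmonic G \<nu> f" "harmonic G \<nu> g" "\<And>x. \<bar>f x\<bar> \<le> C" "\<And>x. \<bar>g x\<bar> \<le> D"
  shows "harmonic G \<nu> (\<lambda>x. f x - g x)"
  unfolding harmonic_def
proof
  fix x assume x: "x \<in> carrier G"
  have "expect \<nu> (\<lambda>s. f (x \<otimes> s) - g (x \<otimes> s)) = expect \<nu> (\<lambda>s. f (x \<otimes> s)) - expect \<nu> (\<lambda>s. g (x \<otimes> s))"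
    by (intro Bochner_Integration.integral_diff integrable_pmf_bounded[where C = C]
        integrable_pmf_bounded[where C = D] assms)
  then show "f x - g x = expect \<nu> (\<lambda>s. f (x \<otimes> s) - g (x \<otimes> s))"
    using assms(1,2) x by (simp add: harmonic_def)
qed

text \<open>Left translation by \<open>a\<close> is at each point right translation by an element of a finite set,
  and right increments of a bounded harmonic function vanish along the walk.\<close>

lemma harmonic_invariant_finite_conj:
  fixes G (structure)
  assumes G: "group G" "prob_on G \<nu>" "nondegenerate G \<nu>" and h: "harmonic G \<nu> h" and C: "\<And>x. \<bar>h x\<bar> \<le> C"
    and a: "a \<in> carrier G" and S: "finite S" "S \<subseteq> carrier G"
    and conj: "\<And>x. x \<in> carrier G \<Longrightarrow> \<exists>c\<in>S. h (a \<otimes> x) = h (x \<otimes> c)"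
    and x: "x \<in> carrier G"
  shows "h (a \<otimes> x) = h x"
proof -
  let ?D = "\<lambda>x. h (a \<otimes> x) - h x"
  have har: "harmonic G \<nu> ?D"
    by (rule harmonic_diff[OF harmonic_left_translate[OF G(1,2) h a] h C C])
  have bd: "\<bar>incr_sq G h c y\<bar> \<le> (2 * C)\<^sup>2" for c y
    unfolding incr_sq_def by (rule abs_square_diff_le[OF C C])
  have DC: "\<bar>?D x\<bar> \<le> 2 * C" for x using C[of "a \<otimes> x"] C[of x] by linarith
  \<comment> \<open>The left side is independent of \<open>n\<close> since \<open>?D\<close> is
    harmonic, while each of the finitely many terms on the right tends to 0.\<close>
  have "(?D x)\<^sup>2 \<le> (\<Sum>c\<in>S. pw G \<nu> n (incr_sq G h c) x)" for n
  proof -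
    have "(?D x)\<^sup>2 = (pw G \<nu> n ?D x)\<^sup>2" by (simp add: harmonic_eq_pw[OF G(1,2) har x])
    also have "\<dots> \<le> pw G \<nu> n (\<lambda>y. (?D y)\<^sup>2) x" by (rule square_le_pw[OF DC])
    also have "\<dots> \<le> pw G \<nu> n (\<lambda>y. \<Sum>c\<in>S. incr_sq G h c y) x"
    proof (rule pw_mono[OF G(1,2) x])
      fix y
      show "\<bar>(?D y)\<^sup>2\<bar> \<le> (2 * C)\<^sup>2" by (rule abs_square_diff_le[OF C C])
      show "\<bar>\<Sum>c\<in>S. incr_sq G h c y\<bar> \<le> (\<Sum>c\<in>S. (2 * C)\<^sup>2)"
        by (rule order_trans[OF sum_abs sum_mono]) (rule bd)
      assume "y \<in> carrier G"
      from conj[OF this] obtain c where c: "c \<in> S" "(?D y)\<^sup>2 = incr_sq G h c y" by (auto simp: incr_sq_def)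
      then show "(?D y)\<^sup>2 \<le> (\<Sum>c\<in>S. incr_sq G h c y)"
        using S(1) member_le_sum[of c S "\<lambda>c. incr_sq G h c y"] by (simp add: incr_sq_def)
    qed
    also have "\<dots> = (\<Sum>c\<in>S. pw G \<nu> n (incr_sq G h c) x)" by (rule pw_sum[OF bd S(1)])
    finally show ?thesis .
  qed
  moreover have "(\<lambda>n. \<Sum>c\<in>S. pw G \<nu> n (incr_sq G h c) x) \<longlonglongrightarrow> (\<Sum>c\<in>S. 0)"
    using S(2) G(3) by (intro tendsto_sum incr_sq_tendsto_0[OF G(1,2) h C x]) (auto simp: nondegenerate_def)
  ultimately have "(?D x)\<^sup>2 \<le> 0" by (intro LIMSEQ_le_const[of _ "0"]) auto
  then show ?thesis by simp
qed

text \<open>The quotient is \<open>L\<close> modulo the kernel of its action on bounded harmonic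
  functions. By \<open>conj\<close>, every \<open>x\<close> acts on the image of \<open>L\<close>
  like an inner automorphism of \<open>L\<close>, so a finite conjugacy class in the quotient
  leaves, up to the kernel, finitely many right translations to consider.\<close>

lemma icc_factor_of_not_liouville:
  fixes G (structure) and \<iota> :: "'b \<Rightarrow> 'a"
  assumes G: "group G" "prob_on G \<nu>" "nondegenerate G \<nu>" and nl: "\<not> liouville G \<nu>"
    and L: "group L" and \<iota>: "\<iota> \<in> hom L G"
    and conj: "\<And>x. x \<in> carrier G \<Longrightarrow> \<exists>l\<in>carrier L. \<forall>a\<in>carrier L.
       \<iota> a \<otimes> x = x \<otimes> \<iota> (inv\<^bsub>L\<^esub> l \<otimes>\<^bsub>L\<^esub> a \<otimes>\<^bsub>L\<^esub> l)"
    and inv: "\<And>h C. harmonic G \<nu> h \<Longrightarrow> (\<And>x. \<bar>h x\<bar> \<le> C) \<Longrightarrow>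
       (\<And>a x. a \<in> carrier L \<Longrightarrow> x \<in> carrier G \<Longrightarrow> h (\<iota> a \<otimes> x) = h x) \<Longrightarrow>
       \<forall>x\<in>carrier G. h x = h \<one>"
  shows "has_nontrivial_icc_factor L"
proof -
  interpret G: group G by fact
  interpret L: group L by fact
  have \<iota>c: "\<iota> a \<in> carrier G" if "a \<in> carrier L" for a using \<iota> that by (auto simp: hom_def)
  have \<iota>m: "\<iota> (a \<otimes>\<^bsub>L\<^esub> b) = \<iota> a \<otimes> \<iota> b" if "a \<in> carrier L" "b \<in> carrier L" for a b
    using \<iota> that by (auto simp: hom_def)
  have \<iota>1: "\<iota> \<one>\<^bsub>L\<^esub> = \<one>" using \<iota> by (rule hom_one[OF _ L G(1)])
  define bh where "bh h \<longleftrightarrow> harmonic G \<nu> h \<and> (\<exists>C. \<forall>x. \<bar>h x\<bar> \<le> C)" for h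
  \<comment> \<open>Normality will follow because left translates of bounded harmonic functions are
    again bounded and harmonic.\<close>
  define N where "N = {a \<in> carrier L. \<forall>h. bh h \<longrightarrow> (\<forall>x\<in>carrier G. h (\<iota> a \<otimes> x) = h x)}"
  have NL: "a \<in> carrier L" if "a \<in> N" for a using that by (simp add: N_def)
  have Nh: "h (\<iota> a \<otimes> x) = h x" if "a \<in> N" "bh h" "x \<in> carrier G" for a h x
    using that by (auto simp: N_def)
  have NI: "a \<in> N" if "a \<in> carrier L" "\<And>h x. bh h \<Longrightarrow> x \<in> carrier G \<Longrightarrow> h (\<iota> a \<otimes> x) = h x" for a
    using that by (auto simp: N_def)
  have sub: "subgroup N L"
  proof (rule L.subgroupI)
    show "N \<subseteq> carrier L" using NL by blast
    have "\<one>\<^bsub>L\<^esub> \<in> N" by (rule NI) (auto simp: \<iota>1)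
    then show "N \<noteq> {}" by blast
  next
    fix a assume a: "a \<in> N"
    show "inv\<^bsub>L\<^esub> a \<in> N"
    proof (rule NI)
      fix h x assume h: "bh h" "x \<in> carrier G"
      have "h (\<iota> (inv\<^bsub>L\<^esub> a) \<otimes> x) = h (\<iota> a \<otimes> (\<iota> (inv\<^bsub>L\<^esub> a) \<otimes> x))"
        using Nh[OF a h(1)] h(2) NL[OF a] \<iota>c by simp
      also have "\<iota> a \<otimes> (\<iota> (inv\<^bsub>L\<^esub> a) \<otimes> x) = x"
        using h(2) NL[OF a] \<iota>c by (simp add: G.m_assoc[symmetric] \<iota>m[symmetric] \<iota>1)
      finally show "h (\<iota> (inv\<^bsub>L\<^esub> a) \<otimes> x) = h x" .
    qed (use NL[OF a] in simp)
  next
    fix a b assume ab: "a \<in> N" "b \<in> N"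
    show "a \<otimes>\<^bsub>L\<^esub> b \<in> N"
    proof (rule NI)
      fix h x assume h: "bh h" "x \<in> carrier G"
      show "h (\<iota> (a \<otimes>\<^bsub>L\<^esub> b) \<otimes> x) = h x"
        using Nh[OF ab(1) h(1)] Nh[OF ab(2) h] NL[OF ab(1)] NL[OF ab(2)] h(2) \<iota>c by (simp add: \<iota>m G.m_assoc)
    qed (use NL ab in simp)
  qed
  have normal: "N \<lhd> L"
    unfolding L.normal_inv_iff
  proof (intro conjI ballI)
    fix l a assume l: "l \<in> carrier L" and a: "a \<in> N"
    show "l \<otimes>\<^bsub>L\<^esub> a \<otimes>\<^bsub>L\<^esub> inv\<^bsub>L\<^esub> l \<in> N"
    proof (rule NI)
      fix h x assume h: "bh h" "x \<in> carrier G"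
      have bh': "bh (\<lambda>y. h (\<iota> l \<otimes> y))"
        using h(1) harmonic_left_translate[OF G(1,2) _ \<iota>c[OF l]] by (auto simp: bh_def)
      have "h (\<iota> (l \<otimes>\<^bsub>L\<^esub> a \<otimes>\<^bsub>L\<^esub> inv\<^bsub>L\<^esub> l) \<otimes> x) = h (\<iota> l \<otimes> (\<iota> a \<otimes> (\<iota> (inv\<^bsub>L\<^esub> l) \<otimes> x)))"
        using l NL[OF a] h(2) \<iota>c by (simp add: \<iota>m G.m_assoc)
      also have "\<dots> = h (\<iota> l \<otimes> (\<iota> (inv\<^bsub>L\<^esub> l) \<otimes> x))"
        using Nh[OF a bh'] l h(2) \<iota>c by simp
      also have "\<iota> l \<otimes> (\<iota> (inv\<^bsub>L\<^esub> l) \<otimes> x) = x"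
        using h(2) l \<iota>c by (simp add: G.m_assoc[symmetric] \<iota>m[symmetric] \<iota>1)
      finally show "h (\<iota> (l \<otimes>\<^bsub>L\<^esub> a \<otimes>\<^bsub>L\<^esub> inv\<^bsub>L\<^esub> l) \<otimes> x) = h x" .
    qed (use NL[OF a] l in simp)
  qed (rule sub)
  interpret N: normal N L by (rule normal)
  have "N \<noteq> carrier L"
  proof
    assume "N = carrier L"
    then have "liouville G \<nu>"
      unfolding liouville_def using Nh inv by (metis bh_def)
    then show False using nl by simp
  qed
  moreover have "icc (L Mod N)"
    unfolding icc_def
  proof (intro ballI impI notI)
    fix X assume X: "X \<in> carrier (L Mod N)" "X \<noteq> \<one>\<^bsub>L Mod N\<^esub>"
    let ?K = "{g \<otimes>\<^bsub>L Mod N\<^esub> X \<otimes>\<^bsub>L Mod N\<^esub> inv\<^bsub>L Mod N\<^esub> g |g. g \<in> carrier (L Mod N)}"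
    assume fin: "finite ?K"
    obtain a where a: "a \<in> carrier L" "X = N #>\<^bsub>L\<^esub> a"
      using X(1) by (auto simp: FactGroup_def RCOSETS_def)
    define rep where "rep Y = (SOME y. y \<in> Y)" for Y :: "'b set"
    \<comment> \<open>One representative for each coset in the supposedly finite class.
      Representatives are only correct up to \<open>N\<close>, an error which \<open>h\<close>
      absorbs.\<close>
    define S where "S = \<iota> ` rep ` (?K \<inter> rcosets\<^bsub>L\<^esub> N)"
    have rep: "rep Y \<in> Y" if "Y \<in> rcosets\<^bsub>L\<^esub> N" for Y
    proof -
      from that obtain b where "b \<in> carrier L" "Y = N #>\<^bsub>L\<^esub> b" by (auto simp: RCOSETS_def)
      then have "b \<in> Y" using L.rcos_self[OF _ sub] by simp
      then show ?thesis unfolding rep_def by (rule someI)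
    qed
    have repL: "rep Y \<in> carrier L" if "Y \<in> rcosets\<^bsub>L\<^esub> N" for Y
      using rep[OF that] N.rcosets_carrier[OF L that] by blast
    have "a \<in> N"
    proof (rule NI[OF a(1)])
      fix h x assume h: "bh h" and x: "x \<in> carrier G"
      from h obtain C where C: "harmonic G \<nu> h" "\<And>x. \<bar>h x\<bar> \<le> C" by (auto simp: bh_def)
      show "h (\<iota> a \<otimes> x) = h x"
      proof (rule harmonic_invariant_finite_conj[OF G C \<iota>c[OF a(1)] _ _ _ x])
        show "finite S" using fin by (simp add: S_def)
        show "S \<subseteq> carrier G" using repL \<iota>c by (auto simp: S_def)
        fix x assume x: "x \<in> carrier G"
        obtain l where l: "l \<in> carrier L" and conj': "\<And>a. a \<in> carrier L \<Longrightarrow>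
           \<iota> a \<otimes> x = x \<otimes> \<iota> (inv\<^bsub>L\<^esub> l \<otimes>\<^bsub>L\<^esub> a \<otimes>\<^bsub>L\<^esub> l)" using conj[OF x] by blast
        define b where "b = inv\<^bsub>L\<^esub> l \<otimes>\<^bsub>L\<^esub> a \<otimes>\<^bsub>L\<^esub> l"
        have b: "b \<in> carrier L" using l a by (simp add: b_def)
        define Y where "Y = N #>\<^bsub>L\<^esub> b"
        have YR: "Y \<in> rcosets\<^bsub>L\<^esub> N" using b by (auto simp: Y_def RCOSETS_def)
        have "Y \<in> ?K"
        proof -
          have 1: "N #>\<^bsub>L\<^esub> inv\<^bsub>L\<^esub> l \<in> carrier (L Mod N)" using l by (auto simp: FactGroup_def RCOSETS_def)
          have "Y = (N #>\<^bsub>L\<^esub> inv\<^bsub>L\<^esub> l) \<otimes>\<^bsub>L Mod N\<^esub> X \<otimes>\<^bsub>L Mod N\<^esub> (N #>\<^bsub>L\<^esub> l)"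
            using a l by (simp add: FactGroup_def N.rcos_sum Y_def b_def)
          also have "N #>\<^bsub>L\<^esub> l = inv\<^bsub>L Mod N\<^esub> (N #>\<^bsub>L\<^esub> inv\<^bsub>L\<^esub> l)"
            using 1 l by (simp add: N.inv_FactGroup N.rcos_inv)
          finally show ?thesis using 1 by blast
        qed
        define r where "r = rep Y"
        have r: "r \<in> carrier L" "r \<in> Y" using rep[OF YR] repL[OF YR] by (auto simp: r_def)
        obtain n where n: "n \<in> N" "r = n \<otimes>\<^bsub>L\<^esub> b" using r(2) by (auto simp: Y_def r_coset_def)
        define m where "m = inv\<^bsub>L\<^esub> n"
        have m: "m \<in> N" "b = m \<otimes>\<^bsub>L\<^esub> r"
          using n b NL[OF n(1)] by (auto simp: m_def N.m_inv_closed L.m_assoc[symmetric])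
        \<comment> \<open>The error \<open>m\<close> stands to the right of \<open>x\<close>, where
          \<open>h\<close> need not ignore it; conjugating by \<open>l\<close> moves it to the left
          of \<open>x\<close>, inside \<open>N\<close>.\<close>
        define m' where "m' = l \<otimes>\<^bsub>L\<^esub> m \<otimes>\<^bsub>L\<^esub> inv\<^bsub>L\<^esub> l"
        have m': "m' \<in> N" unfolding m'_def by (rule N.inv_op_closed2[OF l m(1)])
        have "inv\<^bsub>L\<^esub> l \<otimes>\<^bsub>L\<^esub> m' \<otimes>\<^bsub>L\<^esub> l = m"
        proof -
          have "inv\<^bsub>L\<^esub> l \<otimes>\<^bsub>L\<^esub> m' \<otimes>\<^bsub>L\<^esub> l = (inv\<^bsub>L\<^esub> l \<otimes>\<^bsub>L\<^esub> l) \<otimes>\<^bsub>L\<^esub> m \<otimes>\<^bsub>L\<^esub> (inv\<^bsub>L\<^esub> l \<otimes>\<^bsub>L\<^esub> l)"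
            unfolding m'_def using l NL[OF m(1)] by (simp only: L.m_assoc L.m_closed L.inv_closed)
          then show ?thesis using l NL[OF m(1)] by simp
        qed
        then have mx: "\<iota> m' \<otimes> x = x \<otimes> \<iota> m" using conj'[OF NL[OF m']] by simp
        have "\<iota> a \<otimes> x = x \<otimes> \<iota> b" unfolding b_def by (rule conj'[OF a(1)])
        also have "\<dots> = x \<otimes> \<iota> m \<otimes> \<iota> r" using x NL[OF m(1)] r \<iota>c by (simp add: m(2) \<iota>m G.m_assoc)
        also have "\<dots> = \<iota> m' \<otimes> (x \<otimes> \<iota> r)"
          using x NL[OF m'] r \<iota>c by (simp add: mx[symmetric] G.m_assoc)
        finally have "h (\<iota> a \<otimes> x) = h (x \<otimes> \<iota> r)"
          using Nh[OF m' h] x r \<iota>c by simp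
        moreover have "\<iota> r \<in> S" unfolding S_def r_def using \<open>Y \<in> ?K\<close> YR by blast
        ultimately show "\<exists>c\<in>S. h (\<iota> a \<otimes> x) = h (x \<otimes> c)" by blast
      qed
    qed
    then have "X = N" using a sub by (simp add: L.coset_join2)
    then show False using X(2) by (simp add: FactGroup_def)
  qed
  ultimately show ?thesis using normal unfolding has_nontrivial_icc_factor_def by blast
qed

section \<open>Almost invariant finitely supported measures\<close>

text \<open>A second-order bound for the smooth substitute of the absolute value, whose second
  derivative is at most \<open>1 / \<eta>\<close>. It comes from the tangent line of the concave
  square root, checked by comparing squares.\<close>

lemma sqrt_smoothing_le:
  fixes u t \<eta> :: real
  assumes "0 < \<eta>"
  shows "sqrt ((u + t)\<^sup>2 + \<eta>\<^sup>2) \<le> sqrt (u\<^sup>2 + \<eta>\<^sup>2) + u / sqrt (u\<^sup>2 + \<eta>\<^sup>2) * t + t\<^sup>2 / (2 * \<eta>)"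
proof -
  define r where "r = sqrt (u\<^sup>2 + \<eta>\<^sup>2)"
  have r2: "r\<^sup>2 = u\<^sup>2 + \<eta>\<^sup>2" by (simp add: r_def)
  have r\<eta>: "\<eta> \<le> r" unfolding r_def using assms by (intro real_le_rsqrt) simp
  then have r0: "0 < r" using assms by simp
  define B where "B = r + (2 * u * t + t\<^sup>2) / (2 * r)"
  have sq: "(u + t)\<^sup>2 + \<eta>\<^sup>2 = r\<^sup>2 + (2 * u * t + t\<^sup>2)" by (simp add: r2 power2_sum)
  have B2: "B\<^sup>2 = r\<^sup>2 + (2 * u * t + t\<^sup>2) + ((2 * u * t + t\<^sup>2) / (2 * r))\<^sup>2"
    using r0 by (simp add: B_def power2_sum)
  have B0: "0 \<le> B"
  proof -
    have "0 \<le> r\<^sup>2 + (2 * u * t + t\<^sup>2)" unfolding sq[symmetric] by simp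
    then have "0 \<le> 2 * r\<^sup>2 + (2 * u * t + t\<^sup>2)" using zero_le_power2[of r] by linarith
    then have "0 \<le> (2 * r\<^sup>2 + (2 * u * t + t\<^sup>2)) / (2 * r)" using r0 by (intro divide_nonneg_pos) auto
    also have "\<dots> = B" using r0 by (simp add: B_def field_simps power2_eq_square)
    finally show ?thesis .
  qed
  have "sqrt ((u + t)\<^sup>2 + \<eta>\<^sup>2) \<le> B"
    unfolding sq by (rule real_le_lsqrt) (use B0 B2 in auto)
  also have "B = r + u / r * t + t\<^sup>2 / (2 * r)"
    using r0 by (simp add: B_def field_simps)
  also have "\<dots> \<le> r + u / r * t + t\<^sup>2 / (2 * \<eta>)"
    using r\<eta> assms by (simp add: frac_le)
  finally show ?thesis by (simp add: r_def)
qed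

text \<open>The derivative of the smoothed absolute value, paired with its argument, recovers the
  absolute value up to \<open>\<eta>\<close>.\<close>

lemma square_div_sqrt_ge:
  fixes v \<eta> :: real
  assumes "0 < \<eta>"
  shows "\<bar>v\<bar> - \<eta> \<le> v / sqrt (v\<^sup>2 + \<eta>\<^sup>2) * v"
proof -
  define r where "r = sqrt (v\<^sup>2 + \<eta>\<^sup>2)"
  have r0: "0 < r" unfolding r_def using assms by (simp add: add_nonneg_pos)
  have rle: "r \<le> \<bar>v\<bar> + \<eta>" unfolding r_def using assms by (intro real_le_lsqrt) (auto simp: power2_sum)
  have "(\<bar>v\<bar> - \<eta>) * r \<le> v\<^sup>2"
  proof (cases "\<eta> \<le> \<bar>v\<bar>")
    case True
    then have "(\<bar>v\<bar> - \<eta>) * r \<le> (\<bar>v\<bar> - \<eta>) * (\<bar>v\<bar> + \<eta>)" using rle by (intro mult_left_mono) auto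
    also have "\<dots> = v\<^sup>2 - \<eta>\<^sup>2" by (simp add: algebra_simps power2_eq_square flip: abs_mult)
    finally show ?thesis using zero_le_power2[of \<eta>] by linarith
  next
    case False
    then have "(\<bar>v\<bar> - \<eta>) * r \<le> 0" using r0 by (simp add: mult_nonpos_nonneg)
    then show ?thesis using zero_le_power2[of v] by linarith
  qed
  then show ?thesis using r0 unfolding r_def[symmetric] by (simp add: field_simps power2_eq_square)
qed

text \<open>A finite-dimensional separation theorem: the functional \<open>f\<close> is the gradient, at an approximate
  minimiser, of a smoothed \<open>\<ell>\<^sup>1\<close>-norm.\<close>

lemma simplex_l1_alternative:
  fixes d :: "'i \<Rightarrow> 'x \<Rightarrow> real"
  assumes I: "finite I" and E: "finite E" "E \<noteq> {}" and d: "\<And>i x. \<bar>d i x\<bar> \<le> 1" and e: "0 < e"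
    and lb: "\<And>w. (\<And>x. x \<in> E \<Longrightarrow> 0 \<le> w x) \<Longrightarrow> (\<Sum>x\<in>E. w x) = 1 \<Longrightarrow> e \<le> (\<Sum>i\<in>I. \<bar>\<Sum>x\<in>E. w x * d i x\<bar>)"
  obtains f where "\<And>i. \<bar>f i\<bar> \<le> 1" "\<And>x. x \<in> E \<Longrightarrow> e / 2 \<le> (\<Sum>i\<in>I. f i * d i x)"
proof -
  define v where "v w i = (\<Sum>x\<in>E. w x * d i x)" for w i
  define W where "W = {w. (\<forall>x\<in>E. 0 \<le> w x) \<and> (\<Sum>x\<in>E. w x) = (1::real)}"
  define m where "m = real (card I)"
  \<comment> \<open>Error budget: smoothing loses \<open>e / 4\<close>, the second-order term for
    step length \<open>s\<close> and the inexact minimum lose \<open>e / 8\<close> each, which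
    leaves \<open>e / 2\<close>. The minimum is taken up to \<open>s * (e / 8)\<close> because the
    comparison is later divided by \<open>s\<close>.\<close>
  define \<eta> where "\<eta> = e / (4 * (m + 1))"
  define s where "s = min 1 (e * \<eta> / (16 * (m + 1)))"
  have m0: "0 \<le> m" by (simp add: m_def)
  have \<eta>: "0 < \<eta>" "m * \<eta> \<le> e / 4"
    using e m0 by (auto simp: \<eta>_def field_simps)
  have s: "0 < s" "s \<le> 1" "2 * s * m / \<eta> \<le> e / 8"
  proof -
    show "0 < s" "s \<le> 1" using e \<eta> m0 by (auto simp: s_def)
    have "s \<le> e * \<eta> / (16 * (m + 1))" by (simp add: s_def)
    then have "s * (16 * (m + 1)) \<le> e * \<eta>" using m0 by (subst (asm) pos_le_divide_eq) auto
    moreover have "s * (16 * m) \<le> s * (16 * (m + 1))" using \<open>0 < s\<close> by simp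
    ultimately show "2 * s * m / \<eta> \<le> e / 8" using \<eta> by (simp add: field_simps)
  qed
  define \<Psi> where "\<Psi> w = (\<Sum>i\<in>I. sqrt ((v w i)\<^sup>2 + \<eta>\<^sup>2))" for w
  have \<Psi>0: "0 \<le> \<Psi> w" for w by (simp add: \<Psi>_def sum_nonneg)
  have Wne: "W \<noteq> {}"
  proof -
    have "(\<lambda>x. 1 / real (card E)) \<in> W" using E by (simp add: W_def)
    then show ?thesis by blast
  qed
  have "\<exists>y\<in>\<Psi> ` W. y < Inf (\<Psi> ` W) + s * (e / 8)"
    using Wne s e by (intro cInf_lessD) auto
  then obtain w where w: "w \<in> W" "\<Psi> w < Inf (\<Psi> ` W) + s * (e / 8)" by auto
  have near: "\<Psi> w \<le> \<Psi> w' + s * (e / 8)" if "w' \<in> W" for w'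
    using cInf_lower[of "\<Psi> w'" "\<Psi> ` W"] that \<Psi>0 w(2) by (fastforce intro: bdd_belowI[of _ 0])
  define f where "f i = v w i / sqrt ((v w i)\<^sup>2 + \<eta>\<^sup>2)" for i
  have f1: "\<bar>f i\<bar> \<le> 1" for i
  proof -
    have "\<bar>v w i\<bar> \<le> sqrt ((v w i)\<^sup>2 + \<eta>\<^sup>2)" by (intro real_le_rsqrt) simp
    moreover have "0 < sqrt ((v w i)\<^sup>2 + \<eta>\<^sup>2)" using \<eta> by (simp add: add_nonneg_pos)
    ultimately show ?thesis by (simp add: f_def abs_divide)
  qed
  have v1: "\<bar>v w i\<bar> \<le> 1" for i
  proof -
    have "\<bar>v w i\<bar> \<le> (\<Sum>x\<in>E. w x * 1)"
      unfolding v_def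
    proof (rule order_trans[OF sum_abs sum_mono])
      fix x assume "x \<in> E"
      then have "0 \<le> w x" using w(1) by (simp add: W_def)
      then show "\<bar>w x * d i x\<bar> \<le> w x * 1"
        unfolding abs_mult using d[of i x] by (simp add: mult_left_le)
    qed
    then show ?thesis using w(1) by (simp add: W_def)
  qed
  have lower: "e - m * \<eta> \<le> (\<Sum>i\<in>I. f i * v w i)"
  proof -
    have "e \<le> (\<Sum>i\<in>I. \<bar>v w i\<bar>)" unfolding v_def using w(1) by (intro lb) (auto simp: W_def)
    moreover have "(\<Sum>i\<in>I. \<bar>v w i\<bar>) - m * \<eta> = (\<Sum>i\<in>I. \<bar>v w i\<bar> - \<eta>)" by (simp add: m_def sum_subtractf)
    moreover have "\<dots> \<le> (\<Sum>i\<in>I. f i * v w i)"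
      unfolding f_def by (intro sum_mono square_div_sqrt_ge \<eta>)
    ultimately show ?thesis by linarith
  qed
  have "e / 2 \<le> (\<Sum>i\<in>I. f i * d i x)" if x: "x \<in> E" for x
  proof -
    \<comment> \<open>A short move of the weights towards the vertex \<open>x\<close> tests the
      directional derivative there.\<close>
    define w' where "w' y = (1 - s) * w y + s * of_bool (y = x)" for y
    have "w' \<in> W"
    proof -
      have "(\<Sum>y\<in>E. w' y) = (1 - s) * (\<Sum>y\<in>E. w y) + s * (\<Sum>y\<in>E. of_bool (y = x))"
        by (simp add: w'_def sum.distrib sum_distrib_left)
      also have "(\<Sum>y\<in>E. of_bool (y = x)) = (1::real)" using E x by (simp add: of_bool_def)
      finally show ?thesis using w(1) s by (auto simp: W_def w'_def)
    qed
    have v': "v w' i = v w i + s * (d i x - v w i)" for i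
    proof -
      have "v w' i = (1 - s) * v w i + s * (\<Sum>y\<in>E. of_bool (y = x) * d i y)"
      proof -
        have "v w' i = (\<Sum>y\<in>E. (1 - s) * (w y * d i y) + s * (of_bool (y = x) * d i y))"
          unfolding v_def w'_def by (intro sum.cong refl) (simp add: algebra_simps)
        then show ?thesis by (simp add: v_def sum.distrib sum_distrib_left)
      qed
      also have "(\<Sum>y\<in>E. of_bool (y = x) * d i y) = d i x" using E x by (simp add: of_bool_def if_distrib if_distribR cong: if_cong)
      finally show ?thesis by (simp add: algebra_simps)
    qed
    have "\<Psi> w' \<le> (\<Sum>i\<in>I. sqrt ((v w i)\<^sup>2 + \<eta>\<^sup>2) + f i * (s * (d i x - v w i)) + 4 * s\<^sup>2 / (2 * \<eta>))"
      unfolding \<Psi>_def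
    proof (rule sum_mono)
      fix i
      have "\<bar>s * (d i x - v w i)\<bar> \<le> \<bar>2 * s\<bar>"
        using d[of i x] v1[of i] s by (simp add: abs_mult)
      then have "(s * (d i x - v w i))\<^sup>2 \<le> (2 * s)\<^sup>2" by (simp only: abs_le_square_iff)
      then have "(s * (d i x - v w i))\<^sup>2 / (2 * \<eta>) \<le> 4 * s\<^sup>2 / (2 * \<eta>)"
        using \<eta> by (intro divide_right_mono) (auto simp: power_mult_distrib)
      then show "sqrt ((v w' i)\<^sup>2 + \<eta>\<^sup>2) \<le> sqrt ((v w i)\<^sup>2 + \<eta>\<^sup>2) + f i * (s * (d i x - v w i)) + 4 * s\<^sup>2 / (2 * \<eta>)"
        using sqrt_smoothing_le[OF \<eta>(1), of "v w i" "s * (d i x - v w i)"] unfolding v' f_def by linarith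
    qed
    also have "\<dots> = \<Psi> w + s * ((\<Sum>i\<in>I. f i * d i x) - (\<Sum>i\<in>I. f i * v w i)) + s * (2 * s * m / \<eta>)"
    proof -
      have "(\<Sum>i\<in>I. f i * (s * (d i x - v w i))) = s * ((\<Sum>i\<in>I. f i * d i x) - (\<Sum>i\<in>I. f i * v w i))"
        by (simp add: sum_subtractf[symmetric] sum_distrib_left algebra_simps)
      then show ?thesis by (simp add: \<Psi>_def sum.distrib m_def power2_eq_square)
    qed
    finally have "0 \<le> s * (e / 8 + ((\<Sum>i\<in>I. f i * d i x) - (\<Sum>i\<in>I. f i * v w i)) + 2 * s * m / \<eta>)"
      using near[OF \<open>w' \<in> W\<close>] by (simp add: algebra_simps)
    then have "0 \<le> e / 8 + ((\<Sum>i\<in>I. f i * d i x) - (\<Sum>i\<in>I. f i * v w i)) + 2 * s * m / \<eta>"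
      using s(1) by (simp add: zero_le_mult_iff)
    then show ?thesis using lower \<eta>(2) s(3) by linarith
  qed
  then show ?thesis using f1 that by blast
qed

section \<open>Finitely additive means and almost invariant measures\<close>

lemma amenableE:
  fixes G (structure)
  assumes "amenable G"
  obtains m :: "'a set \<Rightarrow> real" where "m (carrier G) = 1" "\<And>A. A \<subseteq> carrier G \<Longrightarrow> 0 \<le> m A"
    "\<And>A B. A \<subseteq> carrier G \<Longrightarrow> B \<subseteq> carrier G \<Longrightarrow> A \<inter> B = {} \<Longrightarrow> m (A \<union> B) = m A + m B"
    "\<And>g A. g \<in> carrier G \<Longrightarrow> A \<subseteq> carrier G \<Longrightarrow> m (g <#\<^bsub>G\<^esub> A) = m A"
  using assms unfolding amenable_def
proof (elim exE conjE)
  fix m :: "'a set \<Rightarrow> real"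
  assume a: "m (carrier G) = 1" "\<forall>A. A \<subseteq> carrier G \<longrightarrow> 0 \<le> m A"
    "\<forall>A B. A \<subseteq> carrier G \<longrightarrow> B \<subseteq> carrier G \<longrightarrow> A \<inter> B = {} \<longrightarrow> m (A \<union> B) = m A + m B"
    "\<forall>g\<in>carrier G. \<forall>A. A \<subseteq> carrier G \<longrightarrow> m (g <#\<^bsub>G\<^esub> A) = m A"
  show thesis by (rule that[of m]) (use a in simp_all)
qed

locale finitely_additive =
  fixes G :: "('a, 'c) monoid_scheme" and m :: "'a set \<Rightarrow> real"
  assumes m1: "m (carrier G) = 1" and m0: "\<And>A. A \<subseteq> carrier G \<Longrightarrow> 0 \<le> m A"
    and madd: "\<And>A B. A \<subseteq> carrier G \<Longrightarrow> B \<subseteq> carrier G \<Longrightarrow> A \<inter> B = {} \<Longrightarrow> m (A \<union> B) = m A + m B"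
begin

lemma mean_empty: "m {} = 0"
  using madd[of "{}" "{}"] by simp

lemma mean_fibres:
  assumes "finite V"
  shows "m {x \<in> carrier G. \<sigma> x \<in> V} = (\<Sum>w\<in>V. m {x \<in> carrier G. \<sigma> x = w})"
  using assms
proof induction
  case (insert w V)
  have "{x \<in> carrier G. \<sigma> x \<in> insert w V} = {x \<in> carrier G. \<sigma> x = w} \<union> {x \<in> carrier G. \<sigma> x \<in> V}" by auto
  moreover have "m ({x \<in> carrier G. \<sigma> x = w} \<union> {x \<in> carrier G. \<sigma> x \<in> V})
      = m {x \<in> carrier G. \<sigma> x = w} + m {x \<in> carrier G. \<sigma> x \<in> V}"
    by (rule madd) (use insert in auto)
  ultimately show ?case using insert by simp
qed (simp add: mean_empty)

text \<open>An integral may be computed from the fibres of a finer map: in the application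
  \<open>\<sigma>\<close> records many rounded values at once and \<open>g\<close> selects one of
  them.\<close>

lemma mean_sum_image:
  fixes g :: "'v \<Rightarrow> real"
  assumes V: "finite V" "\<And>x. x \<in> carrier G \<Longrightarrow> \<sigma> x \<in> V" and J: "finite J" "g ` V \<subseteq> J"
  shows "(\<Sum>w\<in>V. g w * m {x \<in> carrier G. \<sigma> x = w}) = (\<Sum>j\<in>J. j * m {x \<in> carrier G. g (\<sigma> x) = j})"
proof -
  have "(\<Sum>w\<in>V. g w * m {x \<in> carrier G. \<sigma> x = w}) =
      (\<Sum>j\<in>J. \<Sum>w\<in>{w\<in>V. g w = j}. g w * m {x \<in> carrier G. \<sigma> x = w})"
    by (rule sum.group[symmetric]) (use V J in auto)
  also have "\<dots> = (\<Sum>j\<in>J. j * m {x \<in> carrier G. g (\<sigma> x) = j})"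
  proof (rule sum.cong[OF refl])
    fix j
    have "(\<Sum>w\<in>{w\<in>V. g w = j}. g w * m {x \<in> carrier G. \<sigma> x = w}) = j * (\<Sum>w\<in>{w\<in>V. g w = j}. m {x \<in> carrier G. \<sigma> x = w})"
      by (simp add: sum_distrib_left)
    also have "(\<Sum>w\<in>{w\<in>V. g w = j}. m {x \<in> carrier G. \<sigma> x = w}) = m {x \<in> carrier G. \<sigma> x \<in> {w\<in>V. g w = j}}"
      by (rule mean_fibres[symmetric]) (use V in simp)
    also have "{x \<in> carrier G. \<sigma> x \<in> {w\<in>V. g w = j}} = {x \<in> carrier G. g (\<sigma> x) = j}" using V(2) by auto
    finally show "(\<Sum>w\<in>{w\<in>V. g w = j}. g w * m {x \<in> carrier G. \<sigma> x = w}) = j * m {x \<in> carrier G. g (\<sigma> x) = j}" .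
  qed
  finally show ?thesis .
qed

end

text \<open>The functions are rounded to finitely many values, since the mean is only given on sets.\<close>

lemma amenable_no_gap:
  fixes G (structure) and \<phi> :: "'a \<Rightarrow> 'a \<Rightarrow> real"
  assumes G: "group G" "amenable G" and K: "finite K" "K \<subseteq> carrier G" and e: "0 < e"
    and \<phi>: "\<And>k x. \<bar>\<phi> k x\<bar> \<le> 1"
  obtains x where "x \<in> carrier G" "(\<Sum>k\<in>K. \<phi> k (k \<otimes> x) - \<phi> k x) < e"
proof (rule ccontr)
  assume "\<not> thesis"
  then have gap: "e \<le> (\<Sum>k\<in>K. \<phi> k (k \<otimes> x) - \<phi> k x)" if "x \<in> carrier G" for x
    using that \<open>\<And>x. \<lbrakk>x \<in> carrier G; (\<Sum>k\<in>K. \<phi> k (k \<otimes> x) - \<phi> k x) < e\<rbrakk> \<Longrightarrow> thesis\<close> by force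
  interpret group G by fact
  obtain m where m1: "m (carrier G) = (1::real)" and m0: "\<And>A. A \<subseteq> carrier G \<Longrightarrow> 0 \<le> m A"
    and madd: "\<And>A B. A \<subseteq> carrier G \<Longrightarrow> B \<subseteq> carrier G \<Longrightarrow> A \<inter> B = {} \<Longrightarrow> m (A \<union> B) = m A + m B"
    and minv: "\<And>g A. g \<in> carrier G \<Longrightarrow> A \<subseteq> carrier G \<Longrightarrow> m (g <#\<^bsub>G\<^esub> A) = m A"
    using G(2) by (rule amenableE) blast
  interpret M: finitely_additive G m
    by unfold_locales (fact m1, fact m0, fact madd)
  \<comment> \<open>Rounding down after scaling by \<open>N\<close> costs at most 1 for each
    \<open>k\<close>, so the rounded gap is at least \<open>N * e - card K\<close>, which exceeds
    1.\<close>
  obtain N :: nat where N: "(card K + 1) / e < N" using reals_Archimedean2 by blast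
  define b where "b k x = real_of_int \<lfloor>N * \<phi> k x\<rfloor>" for k x
  define J where "J = real_of_int ` {- int N..int N}"
  have bJ: "b k x \<in> J" for k x
  proof -
    have "- real N \<le> real N * \<phi> k x" "real N * \<phi> k x \<le> real N"
      using \<phi>[of k x] mult_left_mono[of "-1" "\<phi> k x" "real N"] mult_left_mono[of "\<phi> k x" 1 "real N"] by auto
    then have "- int N \<le> \<lfloor>N * \<phi> k x\<rfloor>" "\<lfloor>N * \<phi> k x\<rfloor> \<le> int N"
      by (auto simp: le_floor_iff floor_le_iff)
    then show ?thesis by (auto simp: b_def J_def)
  qed
  have J: "finite J" by (simp add: J_def)
  \<comment> \<open>All values entering the gap are functions of this one finitely valued map, so
    its sum can be integrated over a single finite partition.\<close>
  define \<sigma> where "\<sigma> x = (\<lambda>k\<in>K. (b k (k \<otimes> x), b k x))" for x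
  define V where "V = (K \<rightarrow>\<^sub>E J \<times> J)"
  have V: "finite V" "\<And>x. \<sigma> x \<in> V" using K J bJ by (auto simp: V_def \<sigma>_def intro!: finite_PiE)
  let ?\<mu> = "\<lambda>w. m {x \<in> carrier G. \<sigma> x = w}"
  have ge1: "1 \<le> (\<Sum>k\<in>K. fst (\<sigma> x k) - snd (\<sigma> x k))" if "x \<in> carrier G" for x
  proof -
    have "real N * e - card K \<le> (\<Sum>k\<in>K. N * \<phi> k (k \<otimes> x) - 1 - N * \<phi> k x)"
    proof -
      have "real N * e \<le> real N * (\<Sum>k\<in>K. \<phi> k (k \<otimes> x) - \<phi> k x)"
        using gap[OF that] by (intro mult_left_mono) auto
      then show ?thesis by (simp add: sum_subtractf sum.distrib sum_distrib_left right_diff_distrib)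
    qed
    also have "\<dots> \<le> (\<Sum>k\<in>K. b k (k \<otimes> x) - b k x)"
      unfolding b_def by (intro sum_mono) linarith
    also have "\<dots> = (\<Sum>k\<in>K. fst (\<sigma> x k) - snd (\<sigma> x k))" by (simp add: \<sigma>_def)
    finally show ?thesis using N e by (simp add: field_simps)
  qed
  have "1 = (\<Sum>w\<in>V. ?\<mu> w)"
    using M.mean_fibres[OF V(1), of \<sigma>] V(2) m1 by simp
  also have "\<dots> \<le> (\<Sum>w\<in>V. (\<Sum>k\<in>K. fst (w k) - snd (w k)) * ?\<mu> w)"
  proof (rule sum_mono)
    fix w
    show "?\<mu> w \<le> (\<Sum>k\<in>K. fst (w k) - snd (w k)) * ?\<mu> w"
    proof (cases "\<exists>x\<in>carrier G. \<sigma> x = w")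
      case True
      then have "1 \<le> (\<Sum>k\<in>K. fst (w k) - snd (w k))" using ge1 by blast
      then have "1 * ?\<mu> w \<le> (\<Sum>k\<in>K. fst (w k) - snd (w k)) * ?\<mu> w"
        by (rule mult_right_mono) (rule m0, auto)
      then show ?thesis by simp
    next
      case False
      then have "{x \<in> carrier G. \<sigma> x = w} = {}" by blast
      then show ?thesis by (simp only: M.mean_empty)
    qed
  qed
  also have "\<dots> = (\<Sum>k\<in>K. (\<Sum>w\<in>V. fst (w k) * ?\<mu> w) - (\<Sum>w\<in>V. snd (w k) * ?\<mu> w))"
    by (simp add: sum_distrib_right left_diff_distrib sum_subtractf sum.swap[of _ K V])
  also have "\<dots> = 0"
  proof (rule sum.neutral, rule ballI)
    fix k assume k: "k \<in> K"
    have kG: "k \<in> carrier G" using k K by blast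
    have "(\<Sum>w\<in>V. fst (w k) * ?\<mu> w) = (\<Sum>j\<in>J. j * m {x \<in> carrier G. fst (\<sigma> x k) = j})"
      by (rule M.mean_sum_image[OF V J])
        (use k in \<open>auto simp: V_def PiE_iff mem_Times_iff\<close>)
    also have "\<dots> = (\<Sum>j\<in>J. j * m {x \<in> carrier G. snd (\<sigma> x k) = j})"
    proof (rule sum.cong[OF refl])
      fix j
      let ?A = "{x \<in> carrier G. snd (\<sigma> x k) = j}"
      \<comment> \<open>The level sets before and after translation by \<open>k\<close> are
        translates of each other, so invariance gives both functions the same integral.\<close>
      have "inv\<^bsub>G\<^esub> k <#\<^bsub>G\<^esub> ?A = {x \<in> carrier G. fst (\<sigma> x k) = j}"
      proof (intro equalityI subsetI)
        fix x assume "x \<in> inv\<^bsub>G\<^esub> k <#\<^bsub>G\<^esub> ?A"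
        then obtain y where "y \<in> ?A" "x = inv\<^bsub>G\<^esub> k \<otimes> y" by (auto simp: l_coset_def)
        then show "x \<in> {x \<in> carrier G. fst (\<sigma> x k) = j}"
          using k kG by (simp add: \<sigma>_def m_assoc[symmetric])
      next
        fix x assume x: "x \<in> {x \<in> carrier G. fst (\<sigma> x k) = j}"
        then have "x = inv\<^bsub>G\<^esub> k \<otimes> (k \<otimes> x)" using kG by (simp add: m_assoc[symmetric])
        moreover have "k \<otimes> x \<in> ?A" using x k kG by (simp add: \<sigma>_def)
        ultimately show "x \<in> inv\<^bsub>G\<^esub> k <#\<^bsub>G\<^esub> ?A" by (auto simp: l_coset_def)
      qed
      then show "j * m {x \<in> carrier G. fst (\<sigma> x k) = j} = j * m ?A"
        using minv[of "inv\<^bsub>G\<^esub> k" ?A] kG by simp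
    qed
    also have "\<dots> = (\<Sum>w\<in>V. snd (w k) * ?\<mu> w)"
      by (rule M.mean_sum_image[OF V J, symmetric])
        (use k in \<open>auto simp: V_def PiE_iff mem_Times_iff\<close>)
    finally show "(\<Sum>w\<in>V. fst (w k) * ?\<mu> w) - (\<Sum>w\<in>V. snd (w k) * ?\<mu> w) = 0" by simp
  qed
  finally show False by simp
qed

text \<open>Day's passage from a mean to Reiter's condition. If no weights on any \<open>E n\<close>
  work, separation gives uniformly bounded test functions that gain \<open>e / 2\<close> at every
  point of \<open>E n\<close>. These sets exhaust the carrier, so a limit of the test functions
  gains everywhere, which \<open>amenable_no_gap\<close> excludes.\<close>

lemma amenable_almost_invariant:
  fixes G :: "('a::countable, 'c) monoid_scheme" (structure)
  assumes G: "group G" "amenable G" and K: "finite K" "K \<subseteq> carrier G" and e: "0 < e"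
  obtains \<theta> :: "'a pmf" where "finite (set_pmf \<theta>)" "set_pmf \<theta> \<subseteq> carrier G"
    "\<And>k f. k \<in> K \<Longrightarrow> (\<And>x. \<bar>f x\<bar> \<le> 1) \<Longrightarrow> \<bar>expect \<theta> (\<lambda>x. f (k \<otimes> x)) - expect \<theta> f\<bar> \<le> e"
proof -
  interpret group G by fact
  \<comment> \<open>For \<open>i = (k, g)\<close> this is the value at \<open>g\<close> of the point
    mass at \<open>k \<otimes> x\<close> minus the one at \<open>x\<close>; the sum of absolute
    values over \<open>i\<close> measures the displacement of the weights.\<close>
  define d where "d i x = of_bool (fst i \<otimes> x = snd i) - (of_bool (x = snd i) :: real)" for i x
  define E where "E n = insert \<one> {x \<in> carrier G. to_nat x < n}" for n :: nat
  define R where "R n = E n \<union> (\<lambda>(k, x). k \<otimes> x) ` (K \<times> E n)" for n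
  have finE: "finite (E n)" for n
  proof -
    have "finite {x :: 'a. to_nat x < n}"
      by (rule finite_imageD[of to_nat]) (auto intro: finite_subset[of _ "{..<n}"] inj_on_subset[OF inj_to_nat])
    then have "finite {x \<in> carrier G. to_nat x < n}" by (rule rev_finite_subset) auto
    then show ?thesis by (simp add: E_def)
  qed
  have EG: "E n \<subseteq> carrier G" for n by (auto simp: E_def)
  have finR: "finite (R n)" for n using finE K by (simp add: R_def)
  have d1: "\<bar>d i x\<bar> \<le> 1" for i x by (simp add: d_def of_bool_def)
  have sumd: "(\<Sum>g\<in>R n. F g * d (k, g) x) = F (k \<otimes> x) - F x" if "k \<in> K" "x \<in> E n" for n k x and F :: "'a \<Rightarrow> real"
  proof -
    have "k \<otimes> x \<in> R n" "x \<in> R n" using that by (auto simp: R_def)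
    then have "(\<Sum>g\<in>R n. if k \<otimes> x = g then F g else 0) = F (k \<otimes> x)" "(\<Sum>g\<in>R n. if x = g then F g else 0) = F x"
      using finR[of n] by simp_all
    moreover have "F g * d (k, g) x = (if k \<otimes> x = g then F g else 0) - (if x = g then F g else 0)" for g
      by (simp add: d_def)
    ultimately show ?thesis by (simp add: sum_subtractf)
  qed
  show ?thesis
  proof (cases "\<exists>n w. (\<forall>x\<in>E n. 0 \<le> w x) \<and> (\<Sum>x\<in>E n. w x) = 1 \<and> (\<Sum>i\<in>K \<times> R n. \<bar>\<Sum>x\<in>E n. w x * d i x\<bar>) < e")
    case True
    then obtain n w where w: "\<And>x. x \<in> E n \<Longrightarrow> 0 \<le> w x" "(\<Sum>x\<in>E n. w x) = 1"
      "(\<Sum>i\<in>K \<times> R n. \<bar>\<Sum>x\<in>E n. w x * d i x\<bar>) < e" by blast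
    define p where "p x = (if x \<in> E n then w x else 0)" for x
    define \<theta> where "\<theta> = embed_pmf p"
    have pmf: "pmf \<theta> x = p x" for x
      unfolding \<theta>_def
    proof (rule pmf_embed_pmf)
      show "0 \<le> p x" for x by (simp add: p_def w)
      have "(\<integral>\<^sup>+x. ennreal (p x) \<partial>count_space UNIV) = (\<integral>\<^sup>+x. ennreal (w x) * indicator (E n) x \<partial>count_space UNIV)"
        by (intro nn_integral_cong) (simp add: p_def)
      also have "\<dots> = (\<Sum>x\<in>E n. ennreal (w x))"
        using finE[of n] by (simp add: nn_integral_count_space_indicator[symmetric] nn_integral_count_space_finite)
      also have "\<dots> = 1" using w by (simp add: sum_ennreal)
      finally show "(\<integral>\<^sup>+x. ennreal (p x) \<partial>count_space UNIV) = 1" .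
    qed
    have set: "set_pmf \<theta> \<subseteq> E n" by (auto simp: set_pmf_eq pmf p_def)
    have ex: "expect \<theta> f = (\<Sum>x\<in>E n. w x * f x)" for f
      by (subst integral_measure_pmf[OF finE[of n]]) (use set in \<open>auto simp: pmf p_def\<close>)
    show ?thesis
    proof (rule that[of \<theta>])
      show "finite (set_pmf \<theta>)" using set finE finite_subset by blast
      show "set_pmf \<theta> \<subseteq> carrier G" using set EG by blast
      fix k and f :: "'a \<Rightarrow> real" assume k: "k \<in> K" and f: "\<And>x. \<bar>f x\<bar> \<le> 1"
      have "expect \<theta> (\<lambda>x. f (k \<otimes> x)) - expect \<theta> f = (\<Sum>x\<in>E n. w x * (\<Sum>g\<in>R n. f g * d (k, g) x))"
        by (simp add: ex sumd[OF k] right_diff_distrib sum_subtractf)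
      also have "\<dots> = (\<Sum>g\<in>R n. f g * (\<Sum>x\<in>E n. w x * d (k, g) x))"
        by (simp add: sum_distrib_left sum.swap[of _ "R n" "E n"] mult.left_commute)
      also have "\<bar>\<dots>\<bar> \<le> (\<Sum>g\<in>R n. \<bar>\<Sum>x\<in>E n. w x * d (k, g) x\<bar>)"
        using f by (intro order_trans[OF sum_abs sum_mono]) (simp add: abs_mult mult_left_le_one_le)
      also have "\<dots> = (\<Sum>i\<in>{k} \<times> R n. \<bar>\<Sum>x\<in>E n. w x * d i x\<bar>)"
        by (simp add: sum.cartesian_product')
      also have "\<dots> \<le> (\<Sum>i\<in>K \<times> R n. \<bar>\<Sum>x\<in>E n. w x * d i x\<bar>)"
        using k K finR by (intro sum_mono2) auto
      finally show "\<bar>expect \<theta> (\<lambda>x. f (k \<otimes> x)) - expect \<theta> f\<bar> \<le> e" using w(3) by linarith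
    qed
  next
    case False
    have "\<exists>f. (\<forall>i. \<bar>f i\<bar> \<le> 1) \<and> (\<forall>x\<in>E n. e / 2 \<le> (\<Sum>i\<in>K \<times> R n. f i * d i x))" for n
    proof (rule simplex_l1_alternative[of "K \<times> R n" "E n" d e])
      fix w :: "'a \<Rightarrow> real" assume w: "\<And>x. x \<in> E n \<Longrightarrow> 0 \<le> w x" "(\<Sum>x\<in>E n. w x) = 1"
      then show "e \<le> (\<Sum>i\<in>K \<times> R n. \<bar>\<Sum>x\<in>E n. w x * d i x\<bar>)" using False by (meson not_le)
    qed (use K finR finE e d1 in \<open>auto simp: E_def\<close>)
    then obtain f where f: "\<And>n i. \<bar>f n i\<bar> \<le> 1"
      "\<And>n x. x \<in> E n \<Longrightarrow> e / 2 \<le> (\<Sum>i\<in>K \<times> R n. f n i * d i x)" by metis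
    obtain F \<phi> where F: "F \<noteq> bot" "F \<le> sequentially" and \<phi>: "\<And>i. ((\<lambda>n. f n i) \<longlongrightarrow> \<phi> i) F"
      using bounded_family_limit[of f 1] f(1) by metis
    have \<phi>1: "\<bar>\<phi> i\<bar> \<le> 1" for i
      using tendsto_rabs[OF \<phi>] F(1) f(1) by (intro tendsto_upperbound[of "\<lambda>n. \<bar>f n i\<bar>"]) auto
    have gap: "e / 2 \<le> (\<Sum>k\<in>K. \<phi> (k, k \<otimes> x) - \<phi> (k, x))" if x: "x \<in> carrier G" for x
    proof (rule tendsto_lowerbound[OF _ _ F(1)])
      show "((\<lambda>n. \<Sum>k\<in>K. f n (k, k \<otimes> x) - f n (k, x)) \<longlongrightarrow> (\<Sum>k\<in>K. \<phi> (k, k \<otimes> x) - \<phi> (k, x))) F"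
        by (intro tendsto_intros \<phi>)
      have "eventually (\<lambda>n. to_nat x < n) sequentially" by (rule eventually_gt_at_top)
      then have "eventually (\<lambda>n. to_nat x < n) F" by (rule filter_leD[OF F(2)])
      then show "\<forall>\<^sub>F n in F. e / 2 \<le> (\<Sum>k\<in>K. f n (k, k \<otimes> x) - f n (k, x))"
      proof eventually_elim
        case (elim n)
        then have xE: "x \<in> E n" using x by (simp add: E_def)
        have "e / 2 \<le> (\<Sum>i\<in>K \<times> R n. f n i * d i x)" by (rule f(2)[OF xE])
        also have "\<dots> = (\<Sum>k\<in>K. \<Sum>g\<in>R n. f n (k, g) * d (k, g) x)"
          by (simp add: sum.cartesian_product')
        also have "\<dots> = (\<Sum>k\<in>K. f n (k, k \<otimes> x) - f n (k, x))"
          by (rule sum.cong[OF refl]) (rule sumd[OF _ xE], assumption)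
        finally show ?case .
      qed
    qed
    obtain x where "x \<in> carrier G" "(\<Sum>k\<in>K. \<phi> (k, k \<otimes> x) - \<phi> (k, x)) < e / 2"
      by (rule amenable_no_gap[OF G K, of "e / 2" "\<lambda>k x. \<phi> (k, x)"]) (use e \<phi>1 in auto)
    then show ?thesis using gap by fastforce
  qed
qed

section \<open>Generic elements of amenable groups with ICC factors\<close>

locale invariant_mean = group G + finitely_additive G m
  for G :: "('a, 'c) monoid_scheme" (structure) and m :: "'a set \<Rightarrow> real" +
  assumes minv: "\<And>g A. g \<in> carrier G \<Longrightarrow> A \<subseteq> carrier G \<Longrightarrow> m (g <#\<^bsub>G\<^esub> A) = m A"
begin

lemma mean_mono:
  assumes "A \<subseteq> B" "B \<subseteq> carrier G"
  shows "m A \<le> m B"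
proof -
  have "m (A \<union> (B - A)) = m A + m (B - A)" using assms by (intro madd) auto
  moreover have "A \<union> (B - A) = B" using assms by auto
  moreover have "0 \<le> m (B - A)" using assms by (intro m0) auto
  ultimately show ?thesis by simp
qed

text \<open>Translates of the fibre fall into infinitely many disjoint fibres and each has the same
  mean; a positive mean would exceed the total mass 1.\<close>

lemma mean_fibre_zero:
  assumes act: "\<And>t g. t \<in> carrier G \<Longrightarrow> g \<in> carrier G \<Longrightarrow> \<psi> (t \<otimes> g) = act t (\<psi> g)"
    and inf: "infinite {act t q | t. t \<in> carrier G}"
  shows "m {g \<in> carrier G. \<psi> g = q} = 0"
proof (rule ccontr)
  let ?B = "{g \<in> carrier G. \<psi> g = q}"
  assume "m ?B \<noteq> 0"
  then have pos: "0 < m ?B" using m0[of ?B] by force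
  then obtain n :: nat where n: "1 < n * m ?B" using reals_Archimedean3[OF pos] by blast
  obtain Y where Y: "finite Y" "card Y = n" "Y \<subseteq> {act t q | t. t \<in> carrier G}"
    using infinite_arbitrarily_large[OF inf, of n] by (elim exE conjE)
  have "real n * m ?B \<le> (\<Sum>y\<in>Y. m {g \<in> carrier G. \<psi> g = y})"
  proof -
    have "m ?B \<le> m {g \<in> carrier G. \<psi> g = y}" if y: "y \<in> Y" for y
    proof -
      obtain t where t: "t \<in> carrier G" "y = act t q" using subsetD[OF Y(3) y] by blast
      have "m ?B = m (t <#\<^bsub>G\<^esub> ?B)" using t by (intro minv[symmetric]) auto
      also have "\<dots> \<le> m {g \<in> carrier G. \<psi> g = y}"
      proof (rule mean_mono)
        show "t <#\<^bsub>G\<^esub> ?B \<subseteq> {g \<in> carrier G. \<psi> g = y}"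
          using t act[OF t(1)] by (auto simp: l_coset_def)
      qed auto
      finally show ?thesis .
    qed
    then have "(\<Sum>y\<in>Y. m ?B) \<le> (\<Sum>y\<in>Y. m {g \<in> carrier G. \<psi> g = y})" by (rule sum_mono)
    then show ?thesis using Y(2) by simp
  qed
  also have "\<dots> = m {g \<in> carrier G. \<psi> g \<in> Y}" by (rule mean_fibres[symmetric, OF Y(1)])
  also have "\<dots> \<le> m (carrier G)" by (rule mean_mono) auto
  finally show False using n m1 by simp
qed

lemma mean_zero_UN:
  assumes "finite I" "\<And>i. i \<in> I \<Longrightarrow> B i \<subseteq> carrier G" "\<And>i. i \<in> I \<Longrightarrow> m (B i) = 0"
  shows "m (\<Union>i\<in>I. B i) = 0"
  using assms
proof (induction I)
  case (insert i I)
  let ?U = "\<Union>i\<in>I. B i"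
  have "m (?U \<union> (B i - ?U)) = m ?U + m (B i - ?U)" by (rule madd) (use insert.prems in auto)
  moreover have "m (B i - ?U) \<le> m (B i)" by (rule mean_mono) (use insert.prems in auto)
  moreover have "0 \<le> m (B i - ?U)" by (rule m0) (use insert.prems in auto)
  moreover have "?U \<union> (B i - ?U) = (\<Union>i\<in>insert i I. B i)" by auto
  ultimately show ?case using insert by simp
qed (simp add: mean_empty)

end

text \<open>Besides membership the clauses are what decoding needs: words through \<open>h j\<close>
  are new, they reveal their left factor modulo \<open>\<pi>\<close>, and they reveal the index
  \<open>j\<close>.\<close>

definition generic_choice ::
  "('a, 'c) monoid_scheme \<Rightarrow> ('a \<Rightarrow> 'q) \<Rightarrow> 'a set \<Rightarrow> 'j set \<Rightarrow> ('j \<Rightarrow> 'a) \<Rightarrow> bool" where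
  "generic_choice G \<pi> B J h \<longleftrightarrow> (\<forall>j\<in>J. h j \<in> carrier G) \<and>
    (\<forall>j\<in>J. \<forall>u\<in>B. \<forall>w\<in>B. \<pi> (u \<otimes>\<^bsub>G\<^esub> h j \<otimes>\<^bsub>G\<^esub> w) \<notin> \<pi> ` B) \<and>
    (\<forall>j\<in>J. \<forall>u\<in>B. \<forall>u'\<in>B. \<forall>w\<in>B. \<forall>w'\<in>B.
       \<pi> (u \<otimes>\<^bsub>G\<^esub> h j \<otimes>\<^bsub>G\<^esub> w) = \<pi> (u' \<otimes>\<^bsub>G\<^esub> h j \<otimes>\<^bsub>G\<^esub> w') \<longrightarrow> \<pi> u = \<pi> u') \<and>
    (\<forall>j\<in>J. \<forall>j'\<in>J. j \<noteq> j' \<longrightarrow> (\<forall>u\<in>B. \<forall>u'\<in>B. \<forall>w\<in>B. \<forall>w'\<in>B.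
       \<pi> (u \<otimes>\<^bsub>G\<^esub> h j \<otimes>\<^bsub>G\<^esub> w) \<noteq> \<pi> (u' \<otimes>\<^bsub>G\<^esub> h j' \<otimes>\<^bsub>G\<^esub> w')))"

lemma generic_choiceD:
  fixes G (structure)
  assumes "generic_choice G \<pi> B J h"
  shows "j \<in> J \<Longrightarrow> h j \<in> carrier G"
    and "j \<in> J \<Longrightarrow> u \<in> B \<Longrightarrow> w \<in> B \<Longrightarrow> \<pi> (u \<otimes> h j \<otimes> w) \<notin> \<pi> ` B"
    and "j \<in> J \<Longrightarrow> u \<in> B \<Longrightarrow> u' \<in> B \<Longrightarrow> w \<in> B \<Longrightarrow> w' \<in> B \<Longrightarrow>
       \<pi> (u \<otimes> h j \<otimes> w) = \<pi> (u' \<otimes> h j \<otimes> w') \<Longrightarrow> \<pi> u = \<pi> u'"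
    and "j \<in> J \<Longrightarrow> j' \<in> J \<Longrightarrow> j \<noteq> j' \<Longrightarrow> u \<in> B \<Longrightarrow> u' \<in> B \<Longrightarrow> w \<in> B \<Longrightarrow> w' \<in> B \<Longrightarrow>
       \<pi> (u \<otimes> h j \<otimes> w) \<noteq> \<pi> (u' \<otimes> h j' \<otimes> w')"
proof -
  note H = assms[unfolded generic_choice_def]
  note H1 = conjunct1[OF H] and H2 = conjunct1[OF conjunct2[OF H]]
    and H3 = conjunct1[OF conjunct2[OF conjunct2[OF H]]] and H4 = conjunct2[OF conjunct2[OF conjunct2[OF H]]]
  show "j \<in> J \<Longrightarrow> h j \<in> carrier G" by (rule H1[rule_format])
  show "j \<in> J \<Longrightarrow> u \<in> B \<Longrightarrow> w \<in> B \<Longrightarrow> \<pi> (u \<otimes> h j \<otimes> w) \<notin> \<pi> ` B"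
    by (rule H2[rule_format])
  show "j \<in> J \<Longrightarrow> u \<in> B \<Longrightarrow> u' \<in> B \<Longrightarrow> w \<in> B \<Longrightarrow> w' \<in> B \<Longrightarrow>
       \<pi> (u \<otimes> h j \<otimes> w) = \<pi> (u' \<otimes> h j \<otimes> w') \<Longrightarrow> \<pi> u = \<pi> u'"
    by (rule H3[rule_format])
  show "j \<in> J \<Longrightarrow> j' \<in> J \<Longrightarrow> j \<noteq> j' \<Longrightarrow> u \<in> B \<Longrightarrow> u' \<in> B \<Longrightarrow> w \<in> B \<Longrightarrow> w' \<in> B \<Longrightarrow>
       \<pi> (u \<otimes> h j \<otimes> w) \<noteq> \<pi> (u' \<otimes> h j' \<otimes> w')"
    by (rule H4[rule_format])
qed

section \<open>Generic elements through an ICC quotient\<close>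

locale icc_quotient = G: group G + Q: group Q
  for G :: "('a, 'c) monoid_scheme" (structure) and Q :: "('q, 'd) monoid_scheme" and \<pi> :: "'a \<Rightarrow> 'q" +
  assumes am: "amenable G" and hom: "\<pi> \<in> hom G Q" and surj: "\<pi> ` carrier G = carrier Q"
    and icc: "icc Q" and nontriv: "\<exists>q\<in>carrier Q. q \<noteq> \<one>\<^bsub>Q\<^esub>"
begin

lemma \<pi>_closed [simp]: "x \<in> carrier G \<Longrightarrow> \<pi> x \<in> carrier Q"
  using surj by blast

lemma \<pi>_mult [simp]: "x \<in> carrier G \<Longrightarrow> y \<in> carrier G \<Longrightarrow> \<pi> (x \<otimes> y) = \<pi> x \<otimes>\<^bsub>Q\<^esub> \<pi> y"
  using hom by (auto simp: hom_def)

lemma \<pi>_one [simp]: "\<pi> \<one> = \<one>\<^bsub>Q\<^esub>"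
  using hom_one[OF hom G.is_group Q.is_group] .

lemma \<pi>_inv [simp]: "x \<in> carrier G \<Longrightarrow> \<pi> (inv\<^bsub>G\<^esub> x) = inv\<^bsub>Q\<^esub> (\<pi> x)"
  using group_hom.hom_inv[of G Q \<pi>] hom by (simp add: group_hom_def group_hom_axioms_def G.is_group Q.is_group)

lemma infinite_conj_class:
  assumes "q \<in> carrier Q" "q \<noteq> \<one>\<^bsub>Q\<^esub>"
  shows "infinite {\<pi> t \<otimes>\<^bsub>Q\<^esub> q \<otimes>\<^bsub>Q\<^esub> inv\<^bsub>Q\<^esub> (\<pi> t) | t. t \<in> carrier G}"
proof -
  have "{\<pi> t \<otimes>\<^bsub>Q\<^esub> q \<otimes>\<^bsub>Q\<^esub> inv\<^bsub>Q\<^esub> (\<pi> t) | t. t \<in> carrier G} = {g \<otimes>\<^bsub>Q\<^esub> q \<otimes>\<^bsub>Q\<^esub> inv\<^bsub>Q\<^esub> g | g. g \<in> carrier Q}"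
    unfolding surj[symmetric] by auto
  then show ?thesis using icc assms unfolding icc_def by simp
qed

lemma infinite_Q: "infinite (carrier Q)"
proof -
  obtain q where q: "q \<in> carrier Q" "q \<noteq> \<one>\<^bsub>Q\<^esub>" using nontriv by blast
  have "{\<pi> t \<otimes>\<^bsub>Q\<^esub> q \<otimes>\<^bsub>Q\<^esub> inv\<^bsub>Q\<^esub> (\<pi> t) | t. t \<in> carrier G} \<subseteq> carrier Q" using q by auto
  then show ?thesis using infinite_conj_class[OF q] finite_subset by blast
qed

text \<open>Each violation prescribes either \<open>\<pi> g\<close> itself or a conjugate by
  \<open>\<pi> g\<close>, the latter with a nontrivial value. As \<open>Q\<close> and all nontrivial
  conjugacy classes are infinite, such fibres have mean 0, and finitely many of them cannot cover
  the group.\<close>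

lemma generic_element:
  assumes B: "finite B" "B \<subseteq> carrier G" and R: "finite R"
  obtains g where "g \<in> carrier G"
    "\<And>u w. u \<in> B \<Longrightarrow> w \<in> B \<Longrightarrow> \<pi> (u \<otimes> g \<otimes> w) \<notin> R"
    "\<And>u u' w w'. u \<in> B \<Longrightarrow> u' \<in> B \<Longrightarrow> w \<in> B \<Longrightarrow> w' \<in> B \<Longrightarrow>
       \<pi> (u \<otimes> g \<otimes> w) = \<pi> (u' \<otimes> g \<otimes> w') \<Longrightarrow> \<pi> u = \<pi> u'"
proof -
  obtain m where m1: "m (carrier G) = (1::real)" and m0: "\<And>A. A \<subseteq> carrier G \<Longrightarrow> 0 \<le> m A"
    and madd: "\<And>A B. A \<subseteq> carrier G \<Longrightarrow> B \<subseteq> carrier G \<Longrightarrow> A \<inter> B = {} \<Longrightarrow> m (A \<union> B) = m A + m B"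
    and minv: "\<And>g A. g \<in> carrier G \<Longrightarrow> A \<subseteq> carrier G \<Longrightarrow> m (g <#\<^bsub>G\<^esub> A) = m A"
    using am by (rule amenableE) blast
  interpret M: invariant_mean G m by unfold_locales (fact m1, fact m0, fact madd, fact minv)
  define I1 where "I1 = B \<times> B \<times> R"
  define S1 where "S1 = (\<lambda>(u, w, r). {g \<in> carrier G. \<pi> g = inv\<^bsub>Q\<^esub> (\<pi> u) \<otimes>\<^bsub>Q\<^esub> r \<otimes>\<^bsub>Q\<^esub> inv\<^bsub>Q\<^esub> (\<pi> w)})"
  define I2 where "I2 = {(u, u', w, w'). u \<in> B \<and> u' \<in> B \<and> w \<in> B \<and> w' \<in> B \<and> \<pi> u \<noteq> \<pi> u'}"
  define S2 where "S2 = (\<lambda>(u, u', w, w'). {g \<in> carrier G.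
     \<pi> g \<otimes>\<^bsub>Q\<^esub> (\<pi> w' \<otimes>\<^bsub>Q\<^esub> inv\<^bsub>Q\<^esub> (\<pi> w)) \<otimes>\<^bsub>Q\<^esub> inv\<^bsub>Q\<^esub> (\<pi> g) = inv\<^bsub>Q\<^esub> (\<pi> u') \<otimes>\<^bsub>Q\<^esub> \<pi> u})"
  have BG: "u \<in> carrier G" if "u \<in> B" for u using B that by blast
  have "m (\<Union>i\<in>I1. S1 i) = 0"
  proof (rule M.mean_zero_UN)
    show "finite I1" using B R by (simp add: I1_def)
    fix i assume i: "i \<in> I1"
    show "S1 i \<subseteq> carrier G" by (auto simp: S1_def)
    obtain u w r where uwr: "i = (u, w, r)" by (cases i)
    define q where "q = inv\<^bsub>Q\<^esub> (\<pi> u) \<otimes>\<^bsub>Q\<^esub> r \<otimes>\<^bsub>Q\<^esub> inv\<^bsub>Q\<^esub> (\<pi> w)"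
    have S: "S1 i = {g \<in> carrier G. \<pi> g = q}" by (simp add: S1_def uwr q_def)
    show "m (S1 i) = 0"
    proof (cases "q \<in> carrier Q")
      case True
      have "{\<pi> t \<otimes>\<^bsub>Q\<^esub> q | t. t \<in> carrier G} = (\<lambda>p. p \<otimes>\<^bsub>Q\<^esub> q) ` carrier Q"
        unfolding surj[symmetric] by auto
      moreover have "inj_on (\<lambda>p. p \<otimes>\<^bsub>Q\<^esub> q) (carrier Q)" using True by (auto intro!: inj_onI)
      ultimately have "infinite {\<pi> t \<otimes>\<^bsub>Q\<^esub> q | t. t \<in> carrier G}"
        using infinite_Q by (simp add: finite_image_iff)
      then show ?thesis unfolding S by (rule M.mean_fibre_zero[rotated]) simp
    next
      case False
      then have "S1 i = {}" unfolding S by auto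
      then show ?thesis by (simp only: M.mean_empty)
    qed
  qed
  moreover have "m (\<Union>i\<in>I2. S2 i) = 0"
  proof (rule M.mean_zero_UN)
    have "I2 \<subseteq> B \<times> B \<times> B \<times> B" by (auto simp: I2_def)
    then show "finite I2" using B(1) by (meson finite_SigmaI finite_subset)
    fix i assume i: "i \<in> I2"
    show "S2 i \<subseteq> carrier G" by (auto simp: S2_def)
    obtain u u' w w' where uw: "i = (u, u', w, w')" by (cases i)
    have c: "u \<in> carrier G" "u' \<in> carrier G" "w \<in> carrier G" "w' \<in> carrier G" "\<pi> u \<noteq> \<pi> u'"
      using i BG by (auto simp: I2_def uw)
    define q where "q = inv\<^bsub>Q\<^esub> (\<pi> u') \<otimes>\<^bsub>Q\<^esub> \<pi> u"
    have q: "q \<in> carrier Q" "q \<noteq> \<one>\<^bsub>Q\<^esub>"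
    proof -
      show "q \<in> carrier Q" using c by (simp add: q_def)
      show "q \<noteq> \<one>\<^bsub>Q\<^esub>"
      proof
        assume "q = \<one>\<^bsub>Q\<^esub>"
        then have "\<pi> u' \<otimes>\<^bsub>Q\<^esub> (inv\<^bsub>Q\<^esub> (\<pi> u') \<otimes>\<^bsub>Q\<^esub> \<pi> u) = \<pi> u'" using c by (simp add: q_def)
        then show False using c by (simp add: Q.m_assoc[symmetric])
      qed
    qed
    let ?x = "\<pi> w' \<otimes>\<^bsub>Q\<^esub> inv\<^bsub>Q\<^esub> (\<pi> w)"
    have S: "S2 i = {g \<in> carrier G. \<pi> g \<otimes>\<^bsub>Q\<^esub> ?x \<otimes>\<^bsub>Q\<^esub> inv\<^bsub>Q\<^esub> (\<pi> g) = q}" by (simp add: S2_def uw q_def)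
    show "m (S2 i) = 0"
      unfolding S
    proof (rule M.mean_fibre_zero[where act = "\<lambda>t y. \<pi> t \<otimes>\<^bsub>Q\<^esub> y \<otimes>\<^bsub>Q\<^esub> inv\<^bsub>Q\<^esub> (\<pi> t)", OF _ infinite_conj_class[OF q]])
      fix t g assume "t \<in> carrier G" "g \<in> carrier G"
      then show "\<pi> (t \<otimes> g) \<otimes>\<^bsub>Q\<^esub> ?x \<otimes>\<^bsub>Q\<^esub> inv\<^bsub>Q\<^esub> (\<pi> (t \<otimes> g))
          = \<pi> t \<otimes>\<^bsub>Q\<^esub> (\<pi> g \<otimes>\<^bsub>Q\<^esub> ?x \<otimes>\<^bsub>Q\<^esub> inv\<^bsub>Q\<^esub> (\<pi> g)) \<otimes>\<^bsub>Q\<^esub> inv\<^bsub>Q\<^esub> (\<pi> t)"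
        using c by (simp add: Q.inv_mult_group Q.m_assoc)
    qed
  qed
  ultimately have "m (\<Union>i\<in>{False, True}. if i then \<Union>(S1 ` I1) else \<Union>(S2 ` I2)) = 0"
    by (intro M.mean_zero_UN) (auto simp: S1_def S2_def)
  moreover have "(\<Union>i\<in>{False, True}. if i then \<Union>(S1 ` I1) else \<Union>(S2 ` I2)) = \<Union>(S1 ` I1) \<union> \<Union>(S2 ` I2)" by auto
  ultimately have "\<Union>(S1 ` I1) \<union> \<Union>(S2 ` I2) \<noteq> carrier G" using m1 by auto
  moreover have "\<Union>(S1 ` I1) \<union> \<Union>(S2 ` I2) \<subseteq> carrier G" by (auto simp: S1_def S2_def)
  ultimately obtain g where g: "g \<in> carrier G" "\<And>i. i \<in> I1 \<Longrightarrow> g \<notin> S1 i" "\<And>i. i \<in> I2 \<Longrightarrow> g \<notin> S2 i" by blast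
  show ?thesis
  proof (rule that[OF g(1)])
    fix u w assume uw: "u \<in> B" "w \<in> B"
    show "\<pi> (u \<otimes> g \<otimes> w) \<notin> R"
    proof
      assume r: "\<pi> (u \<otimes> g \<otimes> w) \<in> R"
      have "\<pi> g = inv\<^bsub>Q\<^esub> (\<pi> u) \<otimes>\<^bsub>Q\<^esub> \<pi> (u \<otimes> g \<otimes> w) \<otimes>\<^bsub>Q\<^esub> inv\<^bsub>Q\<^esub> (\<pi> w)"
      proof -
        have "inv\<^bsub>Q\<^esub> (\<pi> u) \<otimes>\<^bsub>Q\<^esub> \<pi> (u \<otimes> g \<otimes> w) \<otimes>\<^bsub>Q\<^esub> inv\<^bsub>Q\<^esub> (\<pi> w)
            = (inv\<^bsub>Q\<^esub> (\<pi> u) \<otimes>\<^bsub>Q\<^esub> \<pi> u) \<otimes>\<^bsub>Q\<^esub> \<pi> g \<otimes>\<^bsub>Q\<^esub> (\<pi> w \<otimes>\<^bsub>Q\<^esub> inv\<^bsub>Q\<^esub> (\<pi> w))"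
          using BG[OF uw(1)] BG[OF uw(2)] g(1) by (simp only: \<pi>_mult \<pi>_closed G.m_closed Q.m_assoc Q.m_closed Q.inv_closed)
        then show ?thesis using BG[OF uw(1)] BG[OF uw(2)] g(1) by simp
      qed
      then have "g \<in> S1 (u, w, \<pi> (u \<otimes> g \<otimes> w))" using g(1) by (simp only: S1_def prod.case mem_Collect_eq)
      then show False using g(2)[of "(u, w, \<pi> (u \<otimes> g \<otimes> w))"] uw r by (simp add: I1_def)
    qed
  next
    fix u u' w w' assume uw: "u \<in> B" "u' \<in> B" "w \<in> B" "w' \<in> B"
      and eq: "\<pi> (u \<otimes> g \<otimes> w) = \<pi> (u' \<otimes> g \<otimes> w')"
    show "\<pi> u = \<pi> u'"
    proof (rule ccontr)
      assume ne: "\<pi> u \<noteq> \<pi> u'"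
      define a b c d k where "a = \<pi> u" and "b = \<pi> u'" and "c = \<pi> w" and "d = \<pi> w'" and "k = \<pi> g"
      have cl: "a \<in> carrier Q" "b \<in> carrier Q" "c \<in> carrier Q" "d \<in> carrier Q" "k \<in> carrier Q"
        using BG uw g(1) by (simp_all add: a_def b_def c_def d_def k_def)
      have "a \<otimes>\<^bsub>Q\<^esub> k \<otimes>\<^bsub>Q\<^esub> c = b \<otimes>\<^bsub>Q\<^esub> k \<otimes>\<^bsub>Q\<^esub> d"
        using eq BG uw g(1) by (simp add: a_def b_def c_def d_def k_def)
      \<comment> \<open>Moving the outer letters to one side turns the equality of two words into a
        conjugation equation for \<open>k\<close>.\<close>
      then have "inv\<^bsub>Q\<^esub> b \<otimes>\<^bsub>Q\<^esub> (a \<otimes>\<^bsub>Q\<^esub> k \<otimes>\<^bsub>Q\<^esub> c) \<otimes>\<^bsub>Q\<^esub> inv\<^bsub>Q\<^esub> c \<otimes>\<^bsub>Q\<^esub> inv\<^bsub>Q\<^esub> k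
          = inv\<^bsub>Q\<^esub> b \<otimes>\<^bsub>Q\<^esub> (b \<otimes>\<^bsub>Q\<^esub> k \<otimes>\<^bsub>Q\<^esub> d) \<otimes>\<^bsub>Q\<^esub> inv\<^bsub>Q\<^esub> c \<otimes>\<^bsub>Q\<^esub> inv\<^bsub>Q\<^esub> k" by simp
      moreover have "inv\<^bsub>Q\<^esub> b \<otimes>\<^bsub>Q\<^esub> (a \<otimes>\<^bsub>Q\<^esub> k \<otimes>\<^bsub>Q\<^esub> c) \<otimes>\<^bsub>Q\<^esub> inv\<^bsub>Q\<^esub> c \<otimes>\<^bsub>Q\<^esub> inv\<^bsub>Q\<^esub> k = inv\<^bsub>Q\<^esub> b \<otimes>\<^bsub>Q\<^esub> a"
      proof -
        have "c \<otimes>\<^bsub>Q\<^esub> (inv\<^bsub>Q\<^esub> c \<otimes>\<^bsub>Q\<^esub> inv\<^bsub>Q\<^esub> k) = inv\<^bsub>Q\<^esub> k"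
          using cl by (simp add: Q.m_assoc[symmetric])
        then show ?thesis using cl by (simp add: Q.m_assoc)
      qed
      moreover have "inv\<^bsub>Q\<^esub> b \<otimes>\<^bsub>Q\<^esub> (b \<otimes>\<^bsub>Q\<^esub> k \<otimes>\<^bsub>Q\<^esub> d) \<otimes>\<^bsub>Q\<^esub> inv\<^bsub>Q\<^esub> c \<otimes>\<^bsub>Q\<^esub> inv\<^bsub>Q\<^esub> k
          = k \<otimes>\<^bsub>Q\<^esub> (d \<otimes>\<^bsub>Q\<^esub> inv\<^bsub>Q\<^esub> c) \<otimes>\<^bsub>Q\<^esub> inv\<^bsub>Q\<^esub> k"
        using cl by (simp add: Q.m_assoc[symmetric])
      ultimately have "g \<in> S2 (u, u', w, w')"
        using g(1) by (simp add: S2_def a_def b_def c_def d_def k_def)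
      then show False using g(3)[of "(u, u', w, w')"] uw ne by (simp add: I2_def)
    qed
  qed
qed

text \<open>Elements are chosen one by one; the words through earlier choices join the finite set
  \<open>R\<close> that the next one must avoid.\<close>

lemma generic_family:
  fixes J :: "'j set"
  assumes B: "finite B" "B \<subseteq> carrier G" and J: "finite J"
  obtains h where "generic_choice G \<pi> B J h"
proof -
  have "\<exists>h. generic_choice G \<pi> B J h"
    using J
  proof induction
    case empty
    show ?case by (simp add: generic_choice_def)
  next
    case (insert j J)
    then obtain h where h: "generic_choice G \<pi> B J h" by blast
    define R where "R = \<pi> ` B \<union> (\<lambda>(u, j, w). \<pi> (u \<otimes> h j \<otimes> w)) ` (B \<times> J \<times> B)"
    have "finite R" using B insert by (simp add: R_def)
    from generic_element[OF B this] obtain g where g: "g \<in> carrier G"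
      "\<And>u w. u \<in> B \<Longrightarrow> w \<in> B \<Longrightarrow> \<pi> (u \<otimes> g \<otimes> w) \<notin> R"
      "\<And>u u' w w'. u \<in> B \<Longrightarrow> u' \<in> B \<Longrightarrow> w \<in> B \<Longrightarrow> w' \<in> B \<Longrightarrow>
         \<pi> (u \<otimes> g \<otimes> w) = \<pi> (u' \<otimes> g \<otimes> w') \<Longrightarrow> \<pi> u = \<pi> u'" by metis
    have g2: "\<pi> (u \<otimes> g \<otimes> w) \<noteq> \<pi> (u' \<otimes> h j' \<otimes> w')"
      if "u \<in> B" "w \<in> B" "u' \<in> B" "w' \<in> B" "j' \<in> J" for u w u' w' j'
      using g(2)[OF that(1,2)] that(3-) unfolding R_def by force
    have g3: "\<pi> (u \<otimes> g \<otimes> w) \<notin> \<pi> ` B" if "u \<in> B" "w \<in> B" for u w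
      using g(2)[OF that] unfolding R_def by blast
    define h' where "h' = h(j := g)"
    have h': "h' j = g" "\<And>i. i \<in> J \<Longrightarrow> h' i = h i" using insert(2) by (auto simp: h'_def)
    have "generic_choice G \<pi> B (insert j J) h'"
      unfolding generic_choice_def
    proof (intro conjI ballI impI)
      fix i assume "i \<in> insert j J"
      then show "h' i \<in> carrier G" using h h' g(1) by (auto simp: generic_choice_def)
    next
      fix i u w assume "i \<in> insert j J" "u \<in> B" "w \<in> B"
      then show "\<pi> (u \<otimes> h' i \<otimes> w) \<notin> \<pi> ` B"
        using h h' g3 unfolding generic_choice_def by (cases "i = j") simp_all
    next
      fix i u u' w w' assume "i \<in> insert j J" "u \<in> B" "u' \<in> B" "w \<in> B" "w' \<in> B"
        "\<pi> (u \<otimes> h' i \<otimes> w) = \<pi> (u' \<otimes> h' i \<otimes> w')"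
      then show "\<pi> u = \<pi> u'"
        using h h' g(3)[of u u' w w'] unfolding generic_choice_def by (cases "i = j") (simp, metis insertE)
    next
      fix i i' u u' w w' assume a: "i \<in> insert j J" "i' \<in> insert j J" "i \<noteq> i'" "u \<in> B" "u' \<in> B" "w \<in> B" "w' \<in> B"
      consider "i \<in> J" "i' \<in> J" | "i = j" "i' \<in> J" | "i \<in> J" "i' = j" using a by blast
      then show "\<pi> (u \<otimes> h' i \<otimes> w) \<noteq> \<pi> (u' \<otimes> h' i' \<otimes> w')"
      proof cases
        case 1
        then show ?thesis using a h h' unfolding generic_choice_def by simp
      next
        case 2
        then show ?thesis using a g2 h' by simp
      next
        case 3
        then show ?thesis using a g2[of u' w' u w i] h' by simp
      qed
    qed
    then show ?case by blast
  qed
  then show ?thesis using that by blast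
qed

end

text \<open>In the decoding clauses \<open>y\<close> stands for the position before the increment
  and \<open>w\<close> for the later increments of smaller scale, so that decoding works long after
  the step. Keeping \<open>\<rho>\<close> and \<open>F\<close> abstract separates the walk from the
  product structure.\<close>

definition scale_step ::
  "('a, 'c) monoid_scheme \<Rightarrow> ('a \<Rightarrow> 'q) \<Rightarrow> ('a \<Rightarrow> real) set \<Rightarrow> 'a set \<Rightarrow> real \<Rightarrow> 'a pmf \<Rightarrow> bool" where
  "scale_step G \<rho> F A e \<sigma> \<longleftrightarrow> finite (set_pmf \<sigma>) \<and> set_pmf \<sigma> \<subseteq> carrier G \<and>
     (\<forall>y\<in>A. \<forall>y'\<in>A. \<forall>w\<in>A. \<forall>w'\<in>A. \<forall>s\<in>set_pmf \<sigma>. \<forall>s'\<in>set_pmf \<sigma>.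
        \<rho> (y \<otimes>\<^bsub>G\<^esub> s \<otimes>\<^bsub>G\<^esub> w) = \<rho> (y' \<otimes>\<^bsub>G\<^esub> s' \<otimes>\<^bsub>G\<^esub> w') \<longrightarrow> \<rho> y = \<rho> y') \<and>
     (\<forall>y\<in>A. \<forall>w\<in>A. \<forall>s\<in>set_pmf \<sigma>. \<rho> (y \<otimes>\<^bsub>G\<^esub> s \<otimes>\<^bsub>G\<^esub> w) \<notin> \<rho> ` A) \<and>
     (\<forall>f\<in>F. \<forall>x\<in>A. \<bar>expect \<sigma> (\<lambda>s. f (x \<otimes>\<^bsub>G\<^esub> s)) - expect \<sigma> f\<bar> \<le> e)"

text \<open>Almost invariance is confined to these functions: harmonic functions of the marginal
  walks pull back to them, while functions of both coordinates must be able to distinguish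
  positions.\<close>

definition coord_functions :: "('a \<times> 'b \<Rightarrow> real) set" where
  "coord_functions = {f \<circ> fst | f. \<forall>x. \<bar>f x\<bar> \<le> 1} \<union> {f \<circ> snd | f. \<forall>x. \<bar>f x\<bar> \<le> 1}"

text \<open>Secret sharing: the law of \<open>(i h\<^sub>j, j g\<^sub>i)\<close> for independent \<open>i\<close>, \<open>j\<close> with almost invariant laws has
  almost invariant coordinates, while the generic \<open>h\<close> and \<open>g\<close> make the pair decodable.\<close>

lemma product_scale_step:
  fixes G1 :: "('a::countable, 'c) monoid_scheme" and G2 :: "('b::countable, 'd) monoid_scheme"
  assumes Q1: "icc_quotient G1 Q1 \<pi>1" and Q2: "icc_quotient G2 Q2 \<pi>2"
    and A: "finite A" "A \<subseteq> carrier (G1 \<times>\<times> G2)" and e: "0 < e"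
  obtains \<sigma> where "scale_step (G1 \<times>\<times> G2) (map_prod \<pi>1 \<pi>2) coord_functions A e \<sigma>"
proof -
  interpret Q1: icc_quotient G1 Q1 \<pi>1 by fact
  interpret Q2: icc_quotient G2 Q2 \<pi>2 by fact
  define K1 where "K1 = fst ` A"
  define K2 where "K2 = snd ` A"
  have K: "finite K1" "K1 \<subseteq> carrier G1" "finite K2" "K2 \<subseteq> carrier G2"
    using A by (auto simp: K1_def K2_def DirProd_def)
  obtain \<theta>1 where \<theta>1: "finite (set_pmf \<theta>1)" "set_pmf \<theta>1 \<subseteq> carrier G1"
    "\<And>k f. k \<in> K1 \<Longrightarrow> (\<And>x. \<bar>f x\<bar> \<le> 1) \<Longrightarrow> \<bar>expect \<theta>1 (\<lambda>x. f (k \<otimes>\<^bsub>G1\<^esub> x)) - expect \<theta>1 f\<bar> \<le> e"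
    using amenable_almost_invariant[OF Q1.G.is_group Q1.am K(1,2) e] by metis
  obtain \<theta>2 where \<theta>2: "finite (set_pmf \<theta>2)" "set_pmf \<theta>2 \<subseteq> carrier G2"
    "\<And>k f. k \<in> K2 \<Longrightarrow> (\<And>x. \<bar>f x\<bar> \<le> 1) \<Longrightarrow> \<bar>expect \<theta>2 (\<lambda>x. f (k \<otimes>\<^bsub>G2\<^esub> x)) - expect \<theta>2 f\<bar> \<le> e"
    using amenable_almost_invariant[OF Q2.G.is_group Q2.am K(3,4) e] by metis
  define E1 where "E1 = set_pmf \<theta>1"
  define E2 where "E2 = set_pmf \<theta>2"
  have E: "finite E1" "E1 \<subseteq> carrier G1" "finite E2" "E2 \<subseteq> carrier G2"
    using \<theta>1 \<theta>2 by (auto simp: E1_def E2_def)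
  \<comment> \<open>In the first coordinate the word in front of \<open>h j\<close> is
    \<open>y\<close> times \<open>i\<close>, so the generic family must be chosen after the almost
    invariant laws and tested against these products.\<close>
  define B1 where "B1 = K1 \<union> (\<lambda>(y, i). y \<otimes>\<^bsub>G1\<^esub> i) ` (K1 \<times> E1)"
  define B2 where "B2 = K2 \<union> (\<lambda>(y, i). y \<otimes>\<^bsub>G2\<^esub> i) ` (K2 \<times> E2)"
  have "finite B1" "B1 \<subseteq> carrier G1" using K E by (auto simp: B1_def intro!: Q1.G.m_closed)
  then obtain h where "generic_choice G1 \<pi>1 B1 E2 h"
    using Q1.generic_family E(3) by blast
  note h = generic_choiceD[OF this]
  have "finite B2" "B2 \<subseteq> carrier G2" using K E by (auto simp: B2_def intro!: Q2.G.m_closed)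
  then obtain g where "generic_choice G2 \<pi>2 B2 E1 g"
    using Q2.generic_family E(1) by blast
  note g = generic_choiceD[OF this]
  define \<sigma> where "\<sigma> = map_pmf (\<lambda>(i, j). (i \<otimes>\<^bsub>G1\<^esub> h j, j \<otimes>\<^bsub>G2\<^esub> g i)) (pair_pmf \<theta>1 \<theta>2)"
  have set\<sigma>: "set_pmf \<sigma> = (\<lambda>(i, j). (i \<otimes>\<^bsub>G1\<^esub> h j, j \<otimes>\<^bsub>G2\<^esub> g i)) ` (E1 \<times> E2)"
    by (simp add: \<sigma>_def E1_def E2_def)
  have A1: "fst y \<in> K1" "snd y \<in> K2" "fst y \<in> carrier G1" "snd y \<in> carrier G2" if "y \<in> A" for y
    using that K by (auto simp: K1_def K2_def)
  have iE: "i \<in> carrier G1" if "i \<in> E1" for i using E that by blast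
  have jE: "j \<in> carrier G2" if "j \<in> E2" for j using E that by blast
  have B1: "fst y \<in> B1" "fst y \<otimes>\<^bsub>G1\<^esub> i \<in> B1" if "y \<in> A" "i \<in> E1" for y i
    using A1[OF that(1)] that(2) by (auto simp: B1_def)
  have B2: "snd y \<in> B2" "snd y \<otimes>\<^bsub>G2\<^esub> j \<in> B2" if "y \<in> A" "j \<in> E2" for y j
    using A1[OF that(1)] that(2) by (auto simp: B2_def)
  have \<rho>: "map_prod \<pi>1 \<pi>2 (y \<otimes>\<^bsub>G1 \<times>\<times> G2\<^esub> (i \<otimes>\<^bsub>G1\<^esub> h j, j \<otimes>\<^bsub>G2\<^esub> g i) \<otimes>\<^bsub>G1 \<times>\<times> G2\<^esub> w) =
      (\<pi>1 ((fst y \<otimes>\<^bsub>G1\<^esub> i) \<otimes>\<^bsub>G1\<^esub> h j \<otimes>\<^bsub>G1\<^esub> fst w), \<pi>2 ((snd y \<otimes>\<^bsub>G2\<^esub> j) \<otimes>\<^bsub>G2\<^esub> g i \<otimes>\<^bsub>G2\<^esub> snd w))"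
    if "y \<in> A" "w \<in> A" "i \<in> E1" "j \<in> E2" for y w i j
    using A1[OF that(1)] A1[OF that(2)] iE[OF that(3)] jE[OF that(4)] h(1)[OF that(4)] g(1)[OF that(3)]
    by (cases y; cases w) (simp add: DirProd_def Q1.G.m_assoc Q2.G.m_assoc)
  have dec: "map_prod \<pi>1 \<pi>2 y = map_prod \<pi>1 \<pi>2 y'"
    if yw: "y \<in> A" "y' \<in> A" "w \<in> A" "w' \<in> A" and ij: "i \<in> E1" "j \<in> E2" "i' \<in> E1" "j' \<in> E2"
      and eq1: "\<pi>1 ((fst y \<otimes>\<^bsub>G1\<^esub> i) \<otimes>\<^bsub>G1\<^esub> h j \<otimes>\<^bsub>G1\<^esub> fst w) = \<pi>1 ((fst y' \<otimes>\<^bsub>G1\<^esub> i') \<otimes>\<^bsub>G1\<^esub> h j' \<otimes>\<^bsub>G1\<^esub> fst w')"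
      and eq2: "\<pi>2 ((snd y \<otimes>\<^bsub>G2\<^esub> j) \<otimes>\<^bsub>G2\<^esub> g i \<otimes>\<^bsub>G2\<^esub> snd w) = \<pi>2 ((snd y' \<otimes>\<^bsub>G2\<^esub> j') \<otimes>\<^bsub>G2\<^esub> g i' \<otimes>\<^bsub>G2\<^esub> snd w')"
    for y y' w w' i j i' j'
  proof -
    \<comment> \<open>Each coordinate betrays the index used by its generic element: the first gives
      \<open>j\<close>, the second gives \<open>i\<close>. Once both are known, they cancel from the
      recovered left words.\<close>
    have j: "j = j'"
      using h(4)[OF ij(2,4) _ B1(2)[OF yw(1) ij(1)] B1(2)[OF yw(2) ij(3)] B1(1)[OF yw(3) ij(1)] B1(1)[OF yw(4) ij(1)]] eq1
      by blast
    have i: "i = i'"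
      using g(4)[OF ij(1,3) _ B2(2)[OF yw(1) ij(2)] B2(2)[OF yw(2) ij(4)] B2(1)[OF yw(3) ij(2)] B2(1)[OF yw(4) ij(2)]] eq2
      by blast
    have "\<pi>1 (fst y \<otimes>\<^bsub>G1\<^esub> i) = \<pi>1 (fst y' \<otimes>\<^bsub>G1\<^esub> i)"
      using h(3)[OF ij(2) B1(2)[OF yw(1) ij(1)] B1(2)[OF yw(2) ij(1)] B1(1)[OF yw(3) ij(1)] B1(1)[OF yw(4) ij(1)]] eq1 i j
      by blast
    then have "\<pi>1 (fst y) = \<pi>1 (fst y')" using A1[OF yw(1)] A1[OF yw(2)] iE[OF ij(1)] by simp
    moreover have "\<pi>2 (snd y \<otimes>\<^bsub>G2\<^esub> j) = \<pi>2 (snd y' \<otimes>\<^bsub>G2\<^esub> j)"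
      using g(3)[OF ij(1) B2(2)[OF yw(1) ij(2)] B2(2)[OF yw(2) ij(2)] B2(1)[OF yw(3) ij(2)] B2(1)[OF yw(4) ij(2)]] eq2 i j
      by blast
    then have "\<pi>2 (snd y) = \<pi>2 (snd y')" using A1[OF yw(1)] A1[OF yw(2)] jE[OF ij(2)] by simp
    ultimately show ?thesis by (simp add: map_prod_def case_prod_beta)
  qed
  have "scale_step (G1 \<times>\<times> G2) (map_prod \<pi>1 \<pi>2) coord_functions A e \<sigma>"
    unfolding scale_step_def
  proof (intro conjI ballI impI)
    show "finite (set_pmf \<sigma>)" using E by (simp add: set\<sigma>)
    show "set_pmf \<sigma> \<subseteq> carrier (G1 \<times>\<times> G2)" using h(1) g(1) iE jE by (auto simp: set\<sigma> DirProd_def)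
  next
    fix y y' w w' s s' assume yw: "y \<in> A" "y' \<in> A" "w \<in> A" "w' \<in> A" and s: "s \<in> set_pmf \<sigma>" "s' \<in> set_pmf \<sigma>"
      and eq: "map_prod \<pi>1 \<pi>2 (y \<otimes>\<^bsub>G1 \<times>\<times> G2\<^esub> s \<otimes>\<^bsub>G1 \<times>\<times> G2\<^esub> w) = map_prod \<pi>1 \<pi>2 (y' \<otimes>\<^bsub>G1 \<times>\<times> G2\<^esub> s' \<otimes>\<^bsub>G1 \<times>\<times> G2\<^esub> w')"
    obtain i j where ij: "i \<in> E1" "j \<in> E2" "s = (i \<otimes>\<^bsub>G1\<^esub> h j, j \<otimes>\<^bsub>G2\<^esub> g i)" using s(1) by (auto simp: set\<sigma>)
    obtain i' j' where ij': "i' \<in> E1" "j' \<in> E2" "s' = (i' \<otimes>\<^bsub>G1\<^esub> h j', j' \<otimes>\<^bsub>G2\<^esub> g i')" using s(2) by (auto simp: set\<sigma>)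
    show "map_prod \<pi>1 \<pi>2 y = map_prod \<pi>1 \<pi>2 y'"
      using eq unfolding ij(3) ij'(3) \<rho>[OF yw(1,3) ij(1,2)] \<rho>[OF yw(2,4) ij'(1,2)] prod.inject
      using dec[OF yw ij(1,2) ij'(1,2)] by blast
  next
    fix y w s assume yw: "y \<in> A" "w \<in> A" and s: "s \<in> set_pmf \<sigma>"
    obtain i j where ij: "i \<in> E1" "j \<in> E2" "s = (i \<otimes>\<^bsub>G1\<^esub> h j, j \<otimes>\<^bsub>G2\<^esub> g i)" using s by (auto simp: set\<sigma>)
    have "fst z \<in> B1" if "z \<in> A" for z using that A1 by (simp add: B1_def)
    then show "map_prod \<pi>1 \<pi>2 (y \<otimes>\<^bsub>G1 \<times>\<times> G2\<^esub> s \<otimes>\<^bsub>G1 \<times>\<times> G2\<^esub> w) \<notin> map_prod \<pi>1 \<pi>2 ` A"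
      unfolding ij(3) \<rho>[OF yw ij(1,2)]
      using h(2)[OF ij(2) B1(2)[OF yw(1) ij(1)] B1(1)[OF yw(2) ij(1)]] by force
  next
    fix F0 :: "'a \<times> 'b \<Rightarrow> real" and x assume F0: "F0 \<in> coord_functions" and x: "x \<in> A"
    have ave: "\<bar>expect p u - expect p v\<bar> \<le> e"
      if "\<And>j. j \<in> set_pmf p \<Longrightarrow> \<bar>u j - v j\<bar> \<le> e" "\<And>j. \<bar>u j\<bar> \<le> 1" "\<And>j. \<bar>v j\<bar> \<le> 1" for p :: "'z pmf" and u v
    proof -
      have "expect p u - expect p v = expect p (\<lambda>j. u j - v j)"
        by (intro Bochner_Integration.integral_diff[symmetric] integrable_pmf_bounded[where C = 1] that)
      then show ?thesis using expect_abs_le[of p "\<lambda>j. u j - v j" e] that(1) by simp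
    qed
    from F0 consider f where "F0 = f \<circ> fst" "\<And>x. \<bar>f x\<bar> \<le> 1" | f where "F0 = f \<circ> snd" "\<And>x. \<bar>f x\<bar> \<le> 1"
      unfolding coord_functions_def by blast
    then show "\<bar>expect \<sigma> (\<lambda>s. F0 (x \<otimes>\<^bsub>G1 \<times>\<times> G2\<^esub> s)) - expect \<sigma> F0\<bar> \<le> e"
    proof cases
      case (1 f)
      \<comment> \<open>With \<open>j\<close> fixed, the right factor \<open>h j\<close> only
        changes the test function, so averaging over \<open>i\<close> first makes the almost
        invariance of \<open>\<theta>1\<close> applicable.\<close>
      have "expect \<sigma> (\<lambda>s. F0 (x \<otimes>\<^bsub>G1 \<times>\<times> G2\<^esub> s)) = expect \<theta>2 (\<lambda>j. expect \<theta>1 (\<lambda>i. f (fst x \<otimes>\<^bsub>G1\<^esub> (i \<otimes>\<^bsub>G1\<^esub> h j))))"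
        unfolding \<sigma>_def integral_map_pmf by (subst expect_pair(2)[where C = 1]) (use 1 in \<open>auto simp: DirProd_def case_prod_beta\<close>)
      also have "\<dots> = expect \<theta>2 (\<lambda>j. expect \<theta>1 (\<lambda>i. f ((fst x \<otimes>\<^bsub>G1\<^esub> i) \<otimes>\<^bsub>G1\<^esub> h j)))"
        by (intro expect_cong arg_cong[where f = f])
          (use A1[OF x] iE h(1) in \<open>simp add: Q1.G.m_assoc E1_def E2_def\<close>)
      finally have l: "expect \<sigma> (\<lambda>s. F0 (x \<otimes>\<^bsub>G1 \<times>\<times> G2\<^esub> s)) = expect \<theta>2 (\<lambda>j. expect \<theta>1 (\<lambda>i. f ((fst x \<otimes>\<^bsub>G1\<^esub> i) \<otimes>\<^bsub>G1\<^esub> h j)))" .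
      have r: "expect \<sigma> F0 = expect \<theta>2 (\<lambda>j. expect \<theta>1 (\<lambda>i. f (i \<otimes>\<^bsub>G1\<^esub> h j)))"
        unfolding \<sigma>_def integral_map_pmf by (subst expect_pair(2)[where C = 1]) (use 1 in \<open>auto simp: case_prod_beta\<close>)
      show ?thesis unfolding l r
        by (intro ave \<theta>1(3)[where f = "\<lambda>z. f (z \<otimes>\<^bsub>G1\<^esub> h _)"] expect_abs_le 1(2) A1(1) x)
    next
      case (2 f)
      have "expect \<sigma> (\<lambda>s. F0 (x \<otimes>\<^bsub>G1 \<times>\<times> G2\<^esub> s)) = expect \<theta>1 (\<lambda>i. expect \<theta>2 (\<lambda>j. f (snd x \<otimes>\<^bsub>G2\<^esub> (j \<otimes>\<^bsub>G2\<^esub> g i))))"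
        unfolding \<sigma>_def integral_map_pmf by (subst expect_pair(1)[where C = 1]) (use 2 in \<open>auto simp: DirProd_def case_prod_beta\<close>)
      also have "\<dots> = expect \<theta>1 (\<lambda>i. expect \<theta>2 (\<lambda>j. f ((snd x \<otimes>\<^bsub>G2\<^esub> j) \<otimes>\<^bsub>G2\<^esub> g i)))"
        by (intro expect_cong arg_cong[where f = f])
          (use A1[OF x] jE g(1) in \<open>simp add: Q2.G.m_assoc E1_def E2_def\<close>)
      finally have l: "expect \<sigma> (\<lambda>s. F0 (x \<otimes>\<^bsub>G1 \<times>\<times> G2\<^esub> s)) = expect \<theta>1 (\<lambda>i. expect \<theta>2 (\<lambda>j. f ((snd x \<otimes>\<^bsub>G2\<^esub> j) \<otimes>\<^bsub>G2\<^esub> g i)))" .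
      have r: "expect \<sigma> F0 = expect \<theta>1 (\<lambda>i. expect \<theta>2 (\<lambda>j. f (j \<otimes>\<^bsub>G2\<^esub> g i)))"
        unfolding \<sigma>_def integral_map_pmf by (subst expect_pair(1)[where C = 1]) (use 2 in \<open>auto simp: case_prod_beta\<close>)
      show ?thesis unfolding l r
        by (intro ave \<theta>2(3)[where f = "\<lambda>z. f (z \<otimes>\<^bsub>G2\<^esub> g _)"] expect_abs_le 2(2) A1(2) x)
    qed
  qed
  then show ?thesis by (rule that)
qed

lemma icc_quotient_Mod:
  fixes G (structure)
  assumes G: "group G" "amenable G" and N: "N \<lhd> G" "N \<noteq> carrier G" "icc (G Mod N)"
  shows "icc_quotient G (G Mod N) (\<lambda>x. N #>\<^bsub>G\<^esub> x)"
proof -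
  interpret G: group G by fact
  interpret N: normal N G by fact
  interpret Q: group "G Mod N" by (rule N.factorgroup_is_group)
  show ?thesis
  proof unfold_locales
    show "(\<lambda>x. N #>\<^bsub>G\<^esub> x) \<in> hom G (G Mod N)" by (rule N.r_coset_hom_Mod)
    show "(\<lambda>x. N #>\<^bsub>G\<^esub> x) ` carrier G = carrier (G Mod N)"
      by (auto simp: FactGroup_def RCOSETS_def)
    obtain x where x: "x \<in> carrier G" "x \<notin> N" using N(2) N.subset by blast
    have "N #>\<^bsub>G\<^esub> x \<noteq> N" using x G.rcos_self[OF x(1) N.is_subgroup] by auto
    then show "\<exists>q\<in>carrier (G Mod N). q \<noteq> \<one>\<^bsub>G Mod N\<^esub>"
      using x by (intro bexI[of _ "N #>\<^bsub>G\<^esub> x"]) (auto simp: FactGroup_def RCOSETS_def)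
  qed (use G N in auto)
qed

section \<open>A random walk with rapidly growing scales\<close>

text \<open>\<open>tail k\<close> is the probability of a scale \<open>\<ge> k\<close>. It decays so slowly that the hazards
  \<open>mass k / tail k = 1 / (k + 17)\<close> have a small sum of squares, which makes ties between records unlikely.\<close>

definition tail :: "nat \<Rightarrow> real" where "tail k = 16 / (real k + 16)"
definition mass :: "nat \<Rightarrow> real" where "mass k = 16 / ((real k + 16) * (real k + 17))"
definition scale_pmf :: "nat pmf" where "scale_pmf = embed_pmf mass"

lemma tail_bounds: "0 < tail k" "tail k \<le> 1" "tail (Suc k) < 1"
  by (auto simp: tail_def)

lemma tail_mono: "tail (Suc k) \<le> tail k"
  by (simp add: tail_def frac_le)

lemma mass_eq: "mass k = tail k - tail (Suc k)"
  by (simp add: mass_def tail_def field_simps)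

lemma mass_pos: "0 < mass k"
  by (simp add: mass_def)

lemma tail_tendsto_0: "tail \<longlonglongrightarrow> 0"
proof -
  have "(\<lambda>k. 16 * (1 / real (k + 16))) \<longlonglongrightarrow> 16 * 0"
    by (intro tendsto_mult tendsto_const LIMSEQ_ignore_initial_segment lim_1_over_n)
  then show ?thesis by (simp add: tail_def[abs_def])
qed

lemma mass_sums: "mass sums 1"
proof -
  have "(\<lambda>k. tail k - tail (Suc k)) sums (tail 0 - 0)"
    by (rule telescope_sums'[OF tail_tendsto_0])
  then show ?thesis by (simp add: mass_eq[symmetric]) (simp add: tail_def)
qed

lemma pmf_scale_pmf: "pmf scale_pmf k = mass k"
  unfolding scale_pmf_def
proof (rule pmf_embed_pmf)
  show "0 \<le> mass k" for k using mass_pos[of k] by simp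
  show "(\<integral>\<^sup>+k. ennreal (mass k) \<partial>count_space UNIV) = 1"
    using suminf_ennreal_eq[OF less_imp_le[OF mass_pos] mass_sums]
    by (simp add: nn_integral_count_space_nat)
qed

lemma scale_pmf_lessThan: "measure (measure_pmf scale_pmf) {..<k} = 1 - tail k"
proof -
  have "measure (measure_pmf scale_pmf) {..<k} = (\<Sum>j<k. mass j)"
    by (simp add: measure_measure_pmf_finite pmf_scale_pmf)
  also have "\<dots> = 1 - tail k"
    by (induction k) (auto simp: mass_eq, simp add: tail_def)
  finally show ?thesis .
qed

lemma expect_scale_split:
  "expect scale_pmf (\<lambda>j. if j < k then a else b) = (1 - tail k) * a + tail k * b"
proof -
  have "expect scale_pmf (\<lambda>j. if j < k then a else b) = expect scale_pmf (\<lambda>j. (a - b) * indicator {..<k} j + b)"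
    by (intro expect_cong) (simp add: indicator_def)
  also have "\<dots> = (a - b) * (1 - tail k) + b"
    by (subst Bochner_Integration.integral_add)
      (auto intro!: integrable_pmf_bounded[where C = 1] simp: scale_pmf_lessThan indicator_abs_le_1)
  finally show ?thesis by (simp add: algebra_simps)
qed

text \<open>\<open>(1 - tail (Suc k)) ^ Suc n\<close> is the probability that the first \<open>Suc n\<close> increments all have scale \<open>\<le> k\<close>.\<close>

definition horizon :: "nat \<Rightarrow> nat" where
  "horizon k = (SOME n. k \<le> n \<and> (1 - tail (Suc k)) ^ Suc n \<le> (1/2) ^ k / 32)"

lemma horizon: "k \<le> horizon k" "(1 - tail (Suc k)) ^ Suc (horizon k) \<le> (1/2) ^ k / 32"
proof -
  have "(\<lambda>n. (1 - tail (Suc k)) ^ Suc n) \<longlonglongrightarrow> 0"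
    using tail_bounds[of k] tail_bounds[of "Suc k"] by (intro LIMSEQ_Suc LIMSEQ_realpow_zero) auto
  then have "\<forall>\<^sub>F n in sequentially. (1 - tail (Suc k)) ^ Suc n < (1/2) ^ k / 32"
    by (rule order_tendstoD) simp
  then have "\<forall>\<^sub>F n in sequentially. k \<le> n \<and> (1 - tail (Suc k)) ^ Suc n \<le> (1/2) ^ k / 32"
    using eventually_ge_at_top[of k] by eventually_elim simp
  then have "\<exists>n. k \<le> n \<and> (1 - tail (Suc k)) ^ Suc n \<le> (1/2) ^ k / 32"
    using eventually_happens by fastforce
  from someI_ex[OF this] show "k \<le> horizon k" "(1 - tail (Suc k)) ^ Suc (horizon k) \<le> (1/2) ^ k / 32"
    unfolding horizon_def by blast+
qed

text \<open>Used both as the error of almost invariance and as the weight of the exceptional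
  increment. The factor \<open>horizon k + 1\<close> pays for a union over all steps up to
  \<open>horizon k\<close>.\<close>

definition eps :: "nat \<Rightarrow> real" where
  "eps k = (1/2) ^ k / (32 * (real (horizon k) + 1))"

lemma eps_pos: "0 < eps k" by (simp add: eps_def)

lemma eps_le: "eps k \<le> (1/2) ^ k / 32"
  unfolding eps_def by (intro divide_left_mono) auto

section \<open>Words over a finite alphabet and positions of the walk\<close>

primrec words :: "('a, 'c) monoid_scheme \<Rightarrow> 'a set \<Rightarrow> nat \<Rightarrow> 'a set" where
  "words G U 0 = {\<one>\<^bsub>G\<^esub>}"
| "words G U (Suc n) = words G U n \<union> {x \<otimes>\<^bsub>G\<^esub> u | x u. x \<in> words G U n \<and> u \<in> U}"

lemma finite_words: "finite U \<Longrightarrow> finite (words G U n)"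
  by (induction n) (auto intro: finite_image_set2)

lemma words_mono: "m \<le> n \<Longrightarrow> words G U m \<subseteq> words G U n"
  by (rule lift_Suc_mono_le[of "words G U"]) auto

lemma one_in_words: "\<one>\<^bsub>G\<^esub> \<in> words G U n"
  using words_mono[of 0 n G U] by auto

lemma words_snoc: "x \<in> words G U n \<Longrightarrow> u \<in> U \<Longrightarrow> x \<otimes>\<^bsub>G\<^esub> u \<in> words G U (Suc n)"
  by auto

context group
begin

lemma words_subset: "U \<subseteq> carrier G \<Longrightarrow> words G U n \<subseteq> carrier G"
  by (induction n) auto

lemma generator_in_words:
  assumes "U \<subseteq> carrier G" "u \<in> U" "1 \<le> n"
  shows "u \<in> words G U n"
proof -
  have "\<one> \<otimes> u \<in> words G U (Suc 0)" by (rule words_snoc) (use assms in auto)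
  moreover have "u \<in> carrier G" using assms by blast
  ultimately show ?thesis using words_mono[of "Suc 0" n G U] assms by auto
qed

lemma chain_in_words:
  assumes "x \<in> words G U m" "\<And>i. i < n \<Longrightarrow> X i \<in> U"
  shows "chain G x X n \<in> words G U (m + n)"
  using assms(2) by (induction n) (auto simp: assms(1) intro: words_snoc simp del: words.simps(2))

lemma chain_closed:
  assumes "x \<in> carrier G" "\<And>i. i < n \<Longrightarrow> X i \<in> carrier G"
  shows "chain G x X n \<in> carrier G"
  using assms(2) by (induction n) (auto simp: assms(1))

lemma chain_split:
  assumes "x \<in> carrier G" "\<And>i. i < m + n \<Longrightarrow> X i \<in> carrier G"
  shows "chain G x X (m + n) = chain G x X m \<otimes> chain G \<one> (\<lambda>i. X (m + i)) n"
  using assms(2)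
proof (induction n)
  case 0
  then show ?case using chain_closed[of x m X] assms(1) by simp
next
  case (Suc n)
  have "chain G x X m \<in> carrier G" "chain G \<one> (\<lambda>i. X (m + i)) n \<in> carrier G" "X (m + n) \<in> carrier G"
    using Suc.prems assms(1) by (auto intro!: chain_closed)
  then show ?case using Suc by (simp add: m_assoc)
qed

end

text \<open>All that the walk needs from the group: scale steps for arbitrary finite sets, and a
  second starting point \<open>g0\<close> which \<open>\<rho>\<close> tells apart from the
  identity.\<close>

locale scale_system = group G
  for G :: "('a::countable, 'c) monoid_scheme" (structure) +
  fixes \<rho> :: "'a \<Rightarrow> 'q" and F :: "('a \<Rightarrow> real) set" and g0 :: 'a
  assumes step: "\<And>A e. finite A \<Longrightarrow> A \<subseteq> carrier G \<Longrightarrow> 0 < e \<Longrightarrow> \<exists>\<sigma>. scale_step G \<rho> F A e \<sigma>"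
    and g0: "g0 \<in> carrier G" "\<rho> g0 \<noteq> \<rho> \<one>"
begin

text \<open>The sets \<open>A k\<close> and the laws \<open>\<sigma> k\<close> depend on each other;
  choosing the law as a function of the set leaves a recursion over the sets alone.\<close>

definition pick :: "'a set \<Rightarrow> nat \<Rightarrow> 'a pmf" where
  "pick A k = (SOME \<sigma>. scale_step G \<rho> F A (eps k) \<sigma>)"

definition \<gamma> :: "nat \<Rightarrow> 'a" where
  "\<gamma> k = (if from_nat k \<in> carrier G then from_nat k else \<one>)"

text \<open>\<open>horizon\<close> depends only on the law of the scales, so it may occur here. The
  three extra letters leave room for a product \<open>y \<otimes> s \<otimes> w\<close>, and for an
  initial letter before a walk of \<open>horizon\<close> steps.\<close>

primrec A :: "nat \<Rightarrow> 'a set" where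
  "A 0 = {\<one>, g0}"
| "A (Suc k) = words G (A k \<union> set_pmf (pick (A k) k) \<union> {\<gamma> k}) (horizon (Suc k) + 3)"

definition \<sigma> :: "nat \<Rightarrow> 'a pmf" where "\<sigma> k = pick (A k) k"

definition U :: "nat \<Rightarrow> 'a set" where "U k = A k \<union> set_pmf (\<sigma> k) \<union> {\<gamma> k}"

lemma A_Suc: "A (Suc k) = words G (U k) (horizon (Suc k) + 3)"
  by (simp add: U_def \<sigma>_def)

declare A.simps(2) [simp del]

lemma \<gamma>_closed [simp]: "\<gamma> k \<in> carrier G"
  by (simp add: \<gamma>_def)

lemma scale_step_pick:
  assumes "finite B" "B \<subseteq> carrier G"
  shows "scale_step G \<rho> F B (eps k) (pick B k)"
  unfolding pick_def by (rule someI_ex[OF step[OF assms eps_pos]])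

lemma A_finite_closed: "finite (A k) \<and> A k \<subseteq> carrier G"
proof (induction k)
  case 0
  then show ?case using g0 by simp
next
  case (Suc k)
  have "scale_step G \<rho> F (A k) (eps k) (\<sigma> k)"
    unfolding \<sigma>_def using Suc by (intro scale_step_pick) auto
  then have "finite (set_pmf (\<sigma> k))" "set_pmf (\<sigma> k) \<subseteq> carrier G" by (auto simp: scale_step_def)
  then have "finite (U k)" "U k \<subseteq> carrier G" using Suc by (auto simp: U_def)
  then show ?case unfolding A_Suc using finite_words words_subset by blast
qed

lemma A_closed: "x \<in> A k \<Longrightarrow> x \<in> carrier G"
  using A_finite_closed by blast

lemma scale_step_\<sigma>: "scale_step G \<rho> F (A k) (eps k) (\<sigma> k)"
  unfolding \<sigma>_def using A_finite_closed by (intro scale_step_pick) auto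

lemma \<sigma>_closed: "s \<in> set_pmf (\<sigma> k) \<Longrightarrow> s \<in> carrier G"
  using scale_step_\<sigma>[of k] by (auto simp: scale_step_def)

lemma decode:
  assumes "y \<in> A k" "y' \<in> A k" "w \<in> A k" "w' \<in> A k" "s \<in> set_pmf (\<sigma> k)" "s' \<in> set_pmf (\<sigma> k)"
    "\<rho> (y \<otimes> s \<otimes> w) = \<rho> (y' \<otimes> s' \<otimes> w')"
  shows "\<rho> y = \<rho> y'"
  using scale_step_\<sigma>[of k] assms unfolding scale_step_def by blast

lemma new_scale:
  assumes "y \<in> A k" "w \<in> A k" "s \<in> set_pmf (\<sigma> k)"
  shows "\<rho> (y \<otimes> s \<otimes> w) \<notin> \<rho> ` A k"
  using scale_step_\<sigma>[of k] assms unfolding scale_step_def by blast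

lemma almost_invariant:
  assumes "f \<in> F" "x \<in> A k"
  shows "\<bar>expect (\<sigma> k) (\<lambda>s. f (x \<otimes> s)) - expect (\<sigma> k) f\<bar> \<le> eps k"
  using scale_step_\<sigma>[of k] assms unfolding scale_step_def by blast

lemma U_closed: "U k \<subseteq> carrier G"
  using A_closed \<sigma>_closed by (auto simp: U_def)

lemma U_subset_A: "U k \<subseteq> A (Suc k)"
  unfolding A_Suc using generator_in_words[OF U_closed] by auto

lemma A_mono: "k \<le> k' \<Longrightarrow> A k \<subseteq> A k'"
proof (rule lift_Suc_mono_le[of A])
  show "A n \<subseteq> A (Suc n)" for n using U_subset_A[of n] by (auto simp: U_def)
qed

lemma base_in_A: "\<one> \<in> A k" "g0 \<in> A k"
  using A_mono[of 0 k] by auto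

lemma scale_in_A:
  assumes "y \<in> A k" "w \<in> A k" "s \<in> set_pmf (\<sigma> k)" "k < k'"
  shows "y \<otimes> s \<otimes> w \<in> A k'"
proof -
  have "y \<in> words G (U k) (Suc 0)" using assms(1) by (intro generator_in_words[OF U_closed]) (auto simp: U_def)
  then have "y \<otimes> s \<otimes> w \<in> words G (U k) (Suc (Suc (Suc 0)))"
    using assms(2,3) by (intro words_snoc) (auto simp: U_def)
  also have "\<dots> \<subseteq> A (Suc k)" unfolding A_Suc by (rule words_mono) simp
  also have "\<dots> \<subseteq> A k'" using assms(4) by (intro A_mono) simp
  finally show ?thesis .
qed

definition D :: "nat \<Rightarrow> 'a set" where "D k = insert (\<gamma> k) (set_pmf (\<sigma> k))"

lemma D_closed: "D k \<subseteq> carrier G"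
  using \<sigma>_closed by (auto simp: D_def)

lemma D_subset_U:
  assumes "j \<le> k" shows "D j \<subseteq> U k"
proof (cases "j = k")
  case True
  then show ?thesis by (auto simp: D_def U_def)
next
  case False
  then have "D j \<subseteq> A (Suc j)" "A (Suc j) \<subseteq> A k" using U_subset_A[of j] A_mono[of "Suc j" k] assms
    by (auto simp: D_def U_def)
  then show ?thesis by (auto simp: U_def)
qed

lemma chain_in_A:
  assumes r: "r \<in> {\<one>, g0}" and n: "n \<le> horizon k" and X: "\<And>i. i < n \<Longrightarrow> \<exists>j<k. X i \<in> D j"
  shows "chain G r X n \<in> A k"
proof (cases k)
  case 0
  \<comment> \<open>No scale lies below 0, so the walk has not moved yet.\<close>
  then have "n = 0" using X by (cases n) auto
  then show ?thesis using r base_in_A by auto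
next
  case (Suc k')
  have "r \<in> words G (U k') 1"
    using r base_in_A[of k'] by (intro generator_in_words[OF U_closed]) (auto simp: U_def)
  moreover have "X i \<in> U k'" if "i < n" for i
    using X[OF that] D_subset_U Suc by (auto simp: less_Suc_eq_le)
  ultimately have "chain G r X n \<in> words G (U k') (1 + n)" by (rule chain_in_words)
  also have "\<dots> \<subseteq> A k" unfolding Suc A_Suc using n Suc by (intro words_mono) simp
  finally show ?thesis .
qed

text \<open>The positions that decode to the root \<open>r\<close>, one record at a time. Time does
  not occur, so the indicator of one fixed set tests the walk at all times.\<close>

inductive_set T :: "'a \<Rightarrow> 'a set" for r where
  root: "r \<in> T r"
| child: "y \<in> T r \<Longrightarrow> y \<in> A k \<Longrightarrow> s \<in> set_pmf (\<sigma> k) \<Longrightarrow> w \<in> A k \<Longrightarrow> y \<otimes> s \<otimes> w \<in> T r"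

text \<open>Compare the last records. At equal scales \<open>decode\<close> passes to the parents;
  at different scales the position of smaller scale lies in \<open>A\<close> of the larger one,
  which \<open>new_scale\<close> forbids; a root lies in every \<open>A k\<close>.\<close>

lemma T_disjoint_aux:
  assumes "x \<in> T \<one>" "x' \<in> T g0"
  shows "\<rho> x \<noteq> \<rho> x'"
  using assms
proof (induction arbitrary: x')
  case root
  show ?case using root
  proof cases
    case root
    then show ?thesis using g0 by metis
  next
    case (child y k s w)
    note c' = this
    have "\<rho> x' \<notin> \<rho> ` A k" unfolding c'(1) by (rule new_scale[OF c'(3,5,4)])
    then show ?thesis using base_in_A(1)[of k] by (metis imageI)
  qed
next
  case (child y k s w)
  have notA: "\<rho> (y \<otimes> s \<otimes> w) \<notin> \<rho> ` A k"
    by (rule new_scale) fact+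
  show ?case using child.prems
  proof cases
    case root
    then show ?thesis using notA base_in_A(2)[of k] by (metis imageI)
  next
    case (child y' k' s' w')
    note c' = this and c = \<open>y \<in> A k\<close> \<open>s \<in> set_pmf (\<sigma> k)\<close> \<open>w \<in> A k\<close>
    consider "k = k'" | "k < k'" | "k' < k" by linarith
    then show ?thesis
    proof cases
      case 1
      have "\<rho> y \<noteq> \<rho> y'" by (rule child.IH) fact
      then show ?thesis using decode[of y k y' w w' s s'] c c' 1 by metis
    next
      case 2
      have "y \<otimes> s \<otimes> w \<in> A k'" by (rule scale_in_A[OF c(1,3,2) 2])
      moreover have "\<rho> x' \<notin> \<rho> ` A k'" unfolding c'(1) by (rule new_scale[OF c'(3,5,4)])
      ultimately show ?thesis by (metis imageI)
    next
      case 3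
      have "x' \<in> A k" unfolding c'(1) by (rule scale_in_A[OF c'(3,5,4) 3])
      with notA show ?thesis by (metis imageI)
    qed
  qed
qed

lemma T_disjoint: "x \<in> T \<one> \<Longrightarrow> x \<in> T g0 \<Longrightarrow> False"
  using T_disjoint_aux by blast

definition late :: "nat \<Rightarrow> nat \<Rightarrow> (nat \<Rightarrow> nat \<times> 'a) set" where
  "late n k = {\<omega>. horizon k < n \<and> (\<forall>i\<le>horizon k. fst (\<omega> i) \<le> k)}"

text \<open>A tie of the record \<open>k\<close>, first completed at time \<open>j\<close>.
  Requiring smaller scales at all other times before \<open>j\<close> makes the probability decay
  geometrically in \<open>j\<close>, so that the sum over \<open>j\<close> is bounded uniformly in
  \<open>n\<close>.\<close>

definition repeated :: "nat \<Rightarrow> nat \<Rightarrow> nat \<Rightarrow> nat \<Rightarrow> (nat \<Rightarrow> nat \<times> 'a) set" where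
  "repeated n k i j = {\<omega>. fst (\<omega> i) = k \<and> fst (\<omega> j) = k \<and> (\<forall>l<j. l \<noteq> i \<longrightarrow> fst (\<omega> l) < k)}"

definition stray :: "nat \<Rightarrow> nat \<Rightarrow> (nat \<Rightarrow> nat \<times> 'a) set" where
  "stray k i = {\<omega>. fst (\<omega> i) = k \<and> snd (\<omega> i) \<notin> set_pmf (\<sigma> k)}"

text \<open>Stray increments are counted only up to \<open>horizon k\<close>: if the record is still
  \<open>k\<close> later than that, \<open>late\<close> already applies.\<close>

definition bad :: "nat \<Rightarrow> nat \<Rightarrow> (nat \<Rightarrow> nat \<times> 'a) set" where
  "bad n k = late n k \<union> (\<Union>j<n. \<Union>i<j. repeated n k i j) \<union> (\<Union>i\<in>{..<n} \<inter> {..horizon k}. stray k i)"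

text \<open>Outside the bad events the largest scale \<open>k\<close> so far occurs exactly once, within \<open>horizon k\<close> steps and with
  an increment from \<open>\<sigma> k\<close>, so the words before and after that increment both lie in \<open>A k\<close>.\<close>

lemma chain_in_T:
  assumes r: "r \<in> {\<one>, g0}" and good: "\<And>k. \<omega> \<notin> bad n k"
    and \<omega>: "\<And>i. i < n \<Longrightarrow> snd (\<omega> i) \<in> D (fst (\<omega> i))" and m: "m \<le> n"
  shows "chain G r (\<lambda>i. snd (\<omega> i)) m \<in> T r"
  using m
proof (induction m rule: less_induct)
  case (less m)
  let ?X = "\<lambda>i. snd (\<omega> i)"
  show ?case
  proof (cases "m = 0")
    case True
    then show ?thesis by (simp add: T.root)
  next
    case False
    define k where "k = Max ((\<lambda>i. fst (\<omega> i)) ` {..<m})"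
    have le: "fst (\<omega> i) \<le> k" if "i < m" for i using that by (auto simp: k_def)
    have "k \<in> (\<lambda>i. fst (\<omega> i)) ` {..<m}" unfolding k_def using False by (intro Max_in) auto
    then obtain i0 where i0: "i0 < m" "fst (\<omega> i0) = k" by auto
    define \<tau> where "\<tau> = (LEAST i. fst (\<omega> i) = k)"
    have \<tau>: "fst (\<omega> \<tau>) = k" "\<tau> \<le> i0" 
      unfolding \<tau>_def using LeastI[of "\<lambda>i. fst (\<omega> i) = k" i0] Least_le[of "\<lambda>i. fst (\<omega> i) = k" i0] i0 by auto
    have \<tau>m: "\<tau> < m" using \<tau> i0 by simp
    have before: "fst (\<omega> i) < k" if "i < \<tau>" for i
      using not_less_Least[of i "\<lambda>i. fst (\<omega> i) = k"] that le[of i] \<tau>m by (auto simp: \<tau>_def[symmetric] order_le_less)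
    have after: "fst (\<omega> j) < k" if "\<tau> < j" "j < m" for j
    proof (rule ccontr)
      assume "\<not> fst (\<omega> j) < k"
      then have "\<tau> < j \<and> fst (\<omega> j) = k" using le[of j] that by simp
      \<comment> \<open>The first repetition, because \<open>repeated\<close> demands smaller scales
        at all other earlier times.\<close>
      define j1 where "j1 = (LEAST j. \<tau> < j \<and> fst (\<omega> j) = k)"
      have j1: "\<tau> < j1" "fst (\<omega> j1) = k" "j1 \<le> j"
        unfolding j1_def using LeastI[of "\<lambda>j. \<tau> < j \<and> fst (\<omega> j) = k", OF \<open>\<tau> < j \<and> fst (\<omega> j) = k\<close>]
          Least_le[of "\<lambda>j. \<tau> < j \<and> fst (\<omega> j) = k", OF \<open>\<tau> < j \<and> fst (\<omega> j) = k\<close>] by auto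
      have "fst (\<omega> l) < k" if "l < j1" "l \<noteq> \<tau>" for l
      proof (cases "l < \<tau>")
        case True
        then show ?thesis by (rule before)
      next
        case False
        then have "fst (\<omega> l) \<noteq> k"
          using not_less_Least[of l "\<lambda>j. \<tau> < j \<and> fst (\<omega> j) = k"] that by (auto simp: j1_def[symmetric])
        then show ?thesis using le[of l] that j1 \<open>j < m\<close> by simp
      qed
      then have "\<omega> \<in> repeated n k \<tau> j1" using \<tau> j1 by (auto simp: repeated_def)
      then have "\<omega> \<in> bad n k" using j1 \<open>j < m\<close> less.prems by (auto simp: bad_def)
      then show False using good by blast
    qed
    have mk: "m \<le> horizon k"
    proof (rule ccontr)
      assume *: "\<not> m \<le> horizon k"
      then have "\<omega> \<in> late n k" using le less.prems by (auto simp: late_def)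
      then show False using good[of k] by (auto simp: bad_def)
    qed
    have s: "?X \<tau> \<in> set_pmf (\<sigma> k)"
    proof (rule ccontr)
      assume "?X \<tau> \<notin> set_pmf (\<sigma> k)"
      then have "\<omega> \<in> stray k \<tau>" using \<tau> by (simp add: stray_def)
      then show False using good[of k] \<tau>m mk less.prems by (auto simp: bad_def)
    qed
    define y where "y = chain G r ?X \<tau>"
    define w where "w = chain G \<one> (\<lambda>i. ?X (Suc \<tau> + i)) (m - Suc \<tau>)"
    have y: "y \<in> A k" unfolding y_def
    proof (rule chain_in_A[OF r])
      fix i assume "i < \<tau>"
      then show "\<exists>j<k. ?X i \<in> D j" using before[of i] \<omega>[of i] \<tau>m less.prems by auto
    qed (use \<tau>m mk in simp)
    have w: "w \<in> A k" unfolding w_def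
    proof (rule chain_in_A)
      fix i assume "i < m - Suc \<tau>"
      then have "Suc \<tau> + i < m" by simp
      then show "\<exists>j<k. ?X (Suc \<tau> + i) \<in> D j" using after[of "Suc \<tau> + i"] \<omega>[of "Suc \<tau> + i"] less.prems by auto
    qed (use mk in auto)
    have rG: "r \<in> carrier G" using r g0 by auto
    have XG: "?X i \<in> carrier G" if "i < m" for i using \<omega>[of i] subsetD[OF D_closed, of "snd (\<omega> i)"] that less.prems by simp
    have "chain G r ?X m = chain G r ?X (Suc \<tau> + (m - Suc \<tau>))" using \<tau>m by simp
    also have "\<dots> = chain G r ?X (Suc \<tau>) \<otimes> w"
      unfolding w_def by (rule chain_split[OF rG]) (use XG \<tau>m in auto)
    also have "\<dots> = y \<otimes> ?X \<tau> \<otimes> w" by (simp add: y_def)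
    finally have "chain G r ?X m = y \<otimes> ?X \<tau> \<otimes> w" .
    moreover have "y \<in> T r" unfolding y_def using \<tau>m less.prems by (intro less.IH) auto
    ultimately show ?thesis using T.child[OF _ y s w] by simp
  qed
qed

end

text \<open>The walk is lifted to increments labelled by their scales, so that events about scales
  can be measured. Splitting off the last step matches inserting coordinate \<open>n\<close> into
  the finite product.\<close>

lemma pw_eq_Pi_pmf:
  fixes G (structure) and \<mu> :: "('k \<times> 'a) pmf"
  assumes C: "\<And>x. \<bar>f x\<bar> \<le> C"
  shows "pw G (map_pmf snd \<mu>) n f x =
    expect (Pi_pmf {..<n} d (\<lambda>_. \<mu>)) (\<lambda>\<omega>. f (chain G x (\<lambda>i. snd (\<omega> i)) n))"
  using C
proof (induction n arbitrary: f)
  case (Suc n)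
  have chain_upd: "chain G x (\<lambda>i. snd (fun_upd \<omega> n y i)) m = chain G x (\<lambda>i. snd (\<omega> i)) m" if "m \<le> n" for \<omega> y m
    using that by (induction m) auto
  have "pw G (map_pmf snd \<mu>) (Suc n) f x = pw G (map_pmf snd \<mu>) n (\<lambda>y. expect \<mu> (\<lambda>s. f (y \<otimes> snd s))) x"
    by (subst pw_Suc') simp
  also have "\<dots> = expect (Pi_pmf {..<n} d (\<lambda>_. \<mu>))
      (\<lambda>\<omega>. expect \<mu> (\<lambda>s. f (chain G x (\<lambda>i. snd (\<omega> i)) n \<otimes> snd s)))"
    by (rule Suc.IH) (rule expect_abs_le[OF Suc.prems])
  also have "\<dots> = expect (pair_pmf \<mu> (Pi_pmf {..<n} d (\<lambda>_. \<mu>)))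
      (\<lambda>(s, \<omega>). f (chain G x (\<lambda>i. snd (\<omega> i)) n \<otimes> snd s))"
    by (subst expect_pair(2)[where C = C]) (use Suc.prems in auto)
  also have "\<dots> = expect (pair_pmf \<mu> (Pi_pmf {..<n} d (\<lambda>_. \<mu>)))
      (\<lambda>(s, \<omega>). f (chain G x (\<lambda>i. snd (fun_upd \<omega> n s i)) (Suc n)))"
    by (simp add: chain_upd fun_upd_same del: fun_upd_apply)
  also have "\<dots> = expect (Pi_pmf {..<Suc n} d (\<lambda>_. \<mu>)) (\<lambda>\<omega>. f (chain G x (\<lambda>i. snd (\<omega> i)) (Suc n)))"
    unfolding lessThan_Suc
    by (subst Pi_pmf_insert) (simp_all add: case_prod_unfold del: fun_upd_apply)
  finally show ?case .
qed simp

text \<open>A partial sum of the derivative of the geometric series; in the union bound for ties the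
  factor \<open>j\<close> counts the earlier indices.\<close>

lemma sum_arith_geometric_le:
  fixes r :: real
  assumes "0 \<le> r" "r < 1"
  shows "(\<Sum>j<n. real j * r ^ (j - 1)) \<le> 1 / (1 - r)\<^sup>2"
proof (cases n)
  case (Suc m)
  have s: "(\<lambda>j. of_nat (Suc j) * r ^ j) sums (1 / (1 - r)\<^sup>2)"
    by (rule geometric_deriv_sums) (use assms in simp)
  have "(\<Sum>j<n. real j * r ^ (j - 1)) = (\<Sum>j<m. of_nat (Suc j) * r ^ j)"
    unfolding Suc by (subst sum.lessThan_Suc_shift) simp
  also have "\<dots> \<le> 1 / (1 - r)\<^sup>2"
    unfolding sums_unique[OF s]
    by (rule sum_le_suminf[OF sums_summable[OF s]]) (use assms in \<open>auto intro!: mult_nonneg_nonneg\<close>)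
  finally show ?thesis .
qed (use assms in simp)

context scale_system
begin

text \<open>The rare value \<open>\<gamma> k\<close> runs through the whole carrier as
  \<open>k\<close> varies, which makes the support generate; it is rare enough to disturb neither
  memory nor almost invariance.\<close>

definition \<nu>_at :: "nat \<Rightarrow> 'a pmf" where
  "\<nu>_at k = bind_pmf (bernoulli_pmf (eps k)) (\<lambda>b. if b then return_pmf (\<gamma> k) else \<sigma> k)"

definition \<mu> :: "(nat \<times> 'a) pmf" where
  "\<mu> = bind_pmf scale_pmf (\<lambda>k. map_pmf (Pair k) (\<nu>_at k))"

definition \<nu> :: "'a pmf" where "\<nu> = map_pmf snd \<mu>"

lemma eps_less_1: "eps k < 1"
proof -
  have "(1/2) ^ k \<le> (1::real)" by (rule power_le_one) auto
  then show ?thesis using eps_le[of k] by linarith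
qed

lemma expect_\<nu>_at:
  assumes "\<And>x. \<bar>f x\<bar> \<le> C"
  shows "expect (\<nu>_at k) f = eps k * f (\<gamma> k) + (1 - eps k) * expect (\<sigma> k) f"
  unfolding \<nu>_at_def using eps_pos[of k] eps_less_1[of k]
  by (simp add: expect_bind[OF assms] integral_bernoulli_pmf)

lemma set_\<nu>_at: "set_pmf (\<nu>_at k) = D k"
  unfolding \<nu>_at_def using eps_pos[of k] eps_less_1[of k]
  by (auto simp: D_def set_pmf_bernoulli split: if_splits)

lemma set_scale_pmf: "set_pmf scale_pmf = UNIV"
  using mass_pos by (auto simp: set_pmf_eq pmf_scale_pmf less_le)

lemma set_\<mu>: "set_pmf \<mu> = {(k, s). s \<in> D k}"
  by (auto simp: \<mu>_def set_scale_pmf set_\<nu>_at)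

lemma expect_\<nu>:
  assumes "\<And>x. \<bar>f x\<bar> \<le> C"
  shows "expect \<nu> f = expect scale_pmf (\<lambda>k. expect (\<nu>_at k) f)"
  unfolding \<nu>_def \<mu>_def integral_map_pmf
  by (subst expect_bind[where C = C]) (use assms in auto)

lemma \<nu>_prob_on: "prob_on G \<nu>"
  using D_closed by (fastforce simp: prob_on_def \<nu>_def set_\<mu>)

lemma \<nu>_nondegenerate: "nondegenerate G \<nu>"
  unfolding nondegenerate_def
proof
  show "sgp_gen G (set_pmf \<nu>) \<subseteq> carrier G"
    using sgp_gen_subset[OF is_group \<nu>_prob_on[unfolded prob_on_def]] by blast
  show "carrier G \<subseteq> sgp_gen G (set_pmf \<nu>)"
  proof
    fix x assume "x \<in> carrier G"
    then have "x = \<gamma> (to_nat x)" by (simp add: \<gamma>_def)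
    then have "(to_nat x, x) \<in> set_pmf \<mu>" by (simp add: set_\<mu> D_def)
    then have "x \<in> set_pmf \<nu>" by (force simp: \<nu>_def)
    then show "x \<in> sgp_gen G (set_pmf \<nu>)" by (rule sgp_gen.base)
  qed
qed

lemma measure_\<mu>_scales: "measure (measure_pmf \<mu>) (K \<times> UNIV) = measure (measure_pmf scale_pmf) K"
proof -
  have "map_pmf fst \<mu> = scale_pmf"
    by (simp add: \<mu>_def map_bind_pmf pmf.map_comp comp_def map_pmf_const bind_return_pmf')
  then have "measure (measure_pmf scale_pmf) K = measure (measure_pmf (map_pmf fst \<mu>)) K" by simp
  also have "\<dots> = measure (measure_pmf \<mu>) (fst -` K)" by simp
  also have "fst -` K = K \<times> (UNIV :: 'a set)" by auto
  finally show ?thesis by simp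
qed

lemma measure_scale_single: "measure (measure_pmf scale_pmf) {k} = mass k"
  by (simp add: measure_pmf_single pmf_scale_pmf)

lemma measure_\<mu>_stray: "measure (measure_pmf \<mu>) ({k} \<times> (- set_pmf (\<sigma> k))) \<le> mass k * eps k"
proof -
  let ?S = "- set_pmf (\<sigma> k)"
  have "measure (measure_pmf \<mu>) ({k} \<times> ?S) = expect \<mu> (indicator ({k} \<times> ?S))" by simp
  also have "\<dots> = expect scale_pmf (\<lambda>j. expect (\<nu>_at j) (\<lambda>s. indicator ({k} \<times> ?S) (j, s)))"
    unfolding \<mu>_def by (subst expect_bind[where C = 1], rule indicator_abs_le_1, simp only: integral_map_pmf)
  also have "\<dots> = expect scale_pmf (\<lambda>j. expect (\<nu>_at k) (indicator ?S) * indicator {k} j)"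
  proof (rule expect_cong)
    fix j
    have "(\<lambda>s. indicator ({k} \<times> ?S) (j, s) :: real) = (\<lambda>s. indicator ?S s * indicator {k} j)"
      by (auto simp: indicator_def fun_eq_iff)
    then show "expect (\<nu>_at j) (\<lambda>s. indicator ({k} \<times> ?S) (j, s)) = expect (\<nu>_at k) (indicator ?S) * indicator {k} j"
      by (cases "j = k") simp_all
  qed
  also have "\<dots> = expect (\<nu>_at k) (indicator ?S) * mass k"
    by (simp only: integral_mult_right_zero) (simp add: measure_scale_single)
  also have "expect (\<nu>_at k) (indicator ?S) \<le> eps k"
  proof -
    have "measure (measure_pmf (\<sigma> k)) ?S = 0"
      by (simp add: measure_pmf_zero_iff)
    then have "expect (\<nu>_at k) (indicator ?S) = eps k * indicator ?S (\<gamma> k)"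
      by (subst expect_\<nu>_at[where C = 1]) (auto simp: indicator_abs_le_1)
    then show ?thesis using eps_pos[of k] by (simp add: indicator_def)
  qed
  finally show ?thesis using mass_pos[of k] by (simp add: mult.commute)
qed

section \<open>Probabilities of the bad events\<close>

abbreviation draws :: "nat \<Rightarrow> (nat \<Rightarrow> nat \<times> 'a) pmf" where
  "draws n \<equiv> Pi_pmf {..<n} (0, \<one>) (\<lambda>_. \<mu>)"

lemma measure_draws: "measure (measure_pmf (draws n)) (Pi {..<n} B) = (\<Prod>i<n. measure (measure_pmf \<mu>) (B i))"
  by (rule measure_Pi_pmf_Pi) simp

lemma measure_late: "measure (measure_pmf (draws n)) (late n k) \<le> (1/2) ^ k / 32"
proof (cases "horizon k < n")
  case True
  have "late n k = Pi {..<n} (\<lambda>i. if i \<le> horizon k then {..<Suc k} \<times> UNIV else UNIV)"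
    using True by (auto simp: late_def Pi_iff less_Suc_eq_le mem_Times_iff if_split_mem2)
  then have "measure (measure_pmf (draws n)) (late n k)
      = (\<Prod>i<n. if i \<le> horizon k then 1 - tail (Suc k) else 1)"
    by (simp add: measure_draws measure_\<mu>_scales scale_pmf_lessThan
        if_distrib[of "measure (measure_pmf \<mu>)"] cong: if_cong)
  also have "\<dots> = (1 - tail (Suc k)) ^ card ({..<n} \<inter> {i. i \<le> horizon k})"
    by (subst prod.If_cases) auto
  also have "{..<n} \<inter> {i. i \<le> horizon k} = {..horizon k}" using True by auto
  also have "(1 - tail (Suc k)) ^ card {..horizon k} \<le> (1/2) ^ k / 32"
    using horizon(2)[of k] by simp
  finally show ?thesis .
qed (simp add: late_def)

lemma measure_repeated:
  assumes "i < j" "j < n"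
  shows "measure (measure_pmf (draws n)) (repeated n k i j) = (mass k)\<^sup>2 * (1 - tail k) ^ (j - 1)"
proof -
  have "repeated n k i j = Pi {..<n} (\<lambda>l. if l = i \<or> l = j then {k} \<times> UNIV else if l < j then {..<k} \<times> UNIV else UNIV)"
    using assms by (auto simp: repeated_def Pi_iff mem_Times_iff if_split_mem2)
  then have "measure (measure_pmf (draws n)) (repeated n k i j)
      = (\<Prod>l<n. if l = i \<or> l = j then mass k else if l < j then 1 - tail k else 1)"
    by (simp add: measure_draws measure_\<mu>_scales scale_pmf_lessThan measure_scale_single
        if_distrib[of "measure (measure_pmf \<mu>)"] cong: if_cong)
  also have "\<dots> = mass k ^ card ({..<n} \<inter> {l. l = i \<or> l = j}) *
      (1 - tail k) ^ card ({..<n} \<inter> - {l. l = i \<or> l = j} \<inter> {l. l < j})"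
    by (simp add: prod.If_cases)
  also have "{..<n} \<inter> {l. l = i \<or> l = j} = {i, j}" using assms by auto
  also have "{..<n} \<inter> - {l. l = i \<or> l = j} \<inter> {l. l < j} = {..<j} - {i}" using assms by auto
  finally show ?thesis using assms by (simp add: power2_eq_square)
qed

lemma measure_stray:
  assumes "i < n"
  shows "measure (measure_pmf (draws n)) (stray k i) \<le> mass k * eps k"
proof -
  have "stray k i = Pi {..<n} (\<lambda>l. if l = i then {k} \<times> (- set_pmf (\<sigma> k)) else UNIV)"
    using assms by (auto simp: stray_def Pi_iff mem_Times_iff if_split_mem2)
  then have "measure (measure_pmf (draws n)) (stray k i)
      = (\<Prod>l<n. if l = i then measure (measure_pmf \<mu>) ({k} \<times> (- set_pmf (\<sigma> k))) else 1)"
    by (simp add: measure_draws if_distrib[of "measure (measure_pmf \<mu>)"] cong: if_cong)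
  also have "\<dots> = measure (measure_pmf \<mu>) ({k} \<times> (- set_pmf (\<sigma> k)))"
    using assms by simp
  finally show ?thesis using measure_\<mu>_stray[of k] by simp
qed

text \<open>The left side bounds the probability of a tie at scale \<open>k\<close>. Here the offset
  16 in \<open>tail\<close> pays off: over all scales together, ties cost at most 1/16.\<close>

lemma mass_div_tail: "(mass k)\<^sup>2 / (tail k)\<^sup>2 \<le> mass k / 16"
proof -
  have "mass k = tail k * (1 / (real k + 17))" by (simp add: mass_def tail_def)
  then have "(mass k)\<^sup>2 / (tail k)\<^sup>2 = 1 / (real k + 17)\<^sup>2"
    using tail_bounds(1)[of k] by (simp add: power_divide power_mult_distrib)
  also have "\<dots> \<le> 1 / ((real k + 16) * (real k + 17))"
    by (intro divide_left_mono) (auto simp: power2_eq_square intro!: mult_right_mono)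
  also have "\<dots> = mass k / 16" by (simp add: mass_def)
  finally show ?thesis .
qed

lemma measure_bad: "measure (measure_pmf (draws n)) (bad n k) \<le> (1/2) ^ k / 16 + mass k / 16"
proof -
  let ?P = "measure (measure_pmf (draws n))"
  have "?P (\<Union>j<n. \<Union>i<j. repeated n k i j) \<le> (\<Sum>j<n. ?P (\<Union>i<j. repeated n k i j))"
    by (rule measure_pmf.finite_measure_subadditive_finite) auto
  also have "\<dots> \<le> (\<Sum>j<n. \<Sum>i<j. ?P (repeated n k i j))"
    by (intro sum_mono measure_pmf.finite_measure_subadditive_finite) auto
  also have "\<dots> = (\<Sum>j<n. \<Sum>i<j. (mass k)\<^sup>2 * (1 - tail k) ^ (j - 1))"
    by (intro sum.cong refl measure_repeated) auto
  also have "\<dots> = (mass k)\<^sup>2 * (\<Sum>j<n. real j * (1 - tail k) ^ (j - 1))"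
    by (simp add: sum_distrib_left mult_ac)
  also have "\<dots> \<le> (mass k)\<^sup>2 * (1 / (1 - (1 - tail k))\<^sup>2)"
    using tail_bounds[of k] by (intro mult_left_mono sum_arith_geometric_le) auto
  also have "\<dots> \<le> mass k / 16" using mass_div_tail[of k] by simp
  finally have rep: "?P (\<Union>j<n. \<Union>i<j. repeated n k i j) \<le> mass k / 16" .
  have "?P (\<Union>i\<in>{..<n} \<inter> {..horizon k}. stray k i) \<le> (\<Sum>i\<in>{..<n} \<inter> {..horizon k}. ?P (stray k i))"
    by (rule measure_pmf.finite_measure_subadditive_finite) auto
  also have "\<dots> \<le> (\<Sum>i\<in>{..<n} \<inter> {..horizon k}. mass k * eps k)"
    by (intro sum_mono measure_stray) auto
  also have "\<dots> \<le> (\<Sum>i\<in>{..horizon k}. mass k * eps k)"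
    using mass_pos[of k] eps_pos[of k] by (intro sum_mono2) auto
  also have "\<dots> = mass k * ((real (horizon k) + 1) * eps k)" by simp
  also have "(real (horizon k) + 1) * eps k = (1/2) ^ k / 32" 
  proof -
    have "h * (p / (32 * h)) = p / 32" if "h \<noteq> 0" for h p :: real using that by simp
    from this[of "real (horizon k) + 1" "(1/2) ^ k"] show ?thesis unfolding eps_def by linarith
  qed
  also have "mass k * ((1/2) ^ k / 32) \<le> 1 * ((1/2) ^ k / 32)"
    using pmf_le_1[of scale_pmf k] by (intro mult_right_mono) (auto simp: pmf_scale_pmf)
  finally have str: "?P (\<Union>i\<in>{..<n} \<inter> {..horizon k}. stray k i) \<le> (1/2) ^ k / 32" by simp
  have "?P (bad n k) \<le> ?P (late n k \<union> (\<Union>j<n. \<Union>i<j. repeated n k i j)) + ?P (\<Union>i\<in>{..<n} \<inter> {..horizon k}. stray k i)"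
    unfolding bad_def by (rule measure_Un_le) auto
  moreover have "?P (late n k \<union> (\<Union>j<n. \<Union>i<j. repeated n k i j)) \<le> ?P (late n k) + ?P (\<Union>j<n. \<Union>i<j. repeated n k i j)"
    by (rule measure_Un_le) auto
  ultimately show ?thesis using rep str measure_late[of n k] by simp
qed

text \<open>A bound below 1/2, uniform in \<open>n\<close>, is what separates the two starting
  points.\<close>

lemma measure_bad_UN: "measure (measure_pmf (draws n)) (\<Union>k. bad n k) \<le> 1/4"
proof -
  let ?P = "measure (measure_pmf (draws n))"
  have "(\<lambda>k. (1/2) ^ k / 16 + mass k / 16) sums (1 / (1 - 1/2) / 16 + 1 / 16 :: real)"
    by (intro sums_add sums_divide geometric_sums mass_sums) simp
  then have b: "(\<lambda>k. (1/2) ^ k / 16 + mass k / 16) sums (3/16)" by simp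
  have sm: "summable (\<lambda>k. ?P (bad n k))"
    by (rule summable_comparison_test'[OF sums_summable[OF b], of 0]) (use measure_bad in simp)
  have "?P (\<Union>k. bad n k) \<le> (\<Sum>k. ?P (bad n k))"
    by (rule measure_pmf.finite_measure_subadditive_countably) (use sm in auto)
  also have "\<dots> \<le> (\<Sum>k. (1/2) ^ k / 16 + mass k / 16)"
    by (rule suminf_le[OF measure_bad sm sums_summable[OF b]])
  also have "\<dots> = 3/16" using sums_unique[OF b] by simp
  finally show ?thesis by simp
qed

lemma measure_chain_notin_T:
  assumes "r \<in> {\<one>, g0}"
  shows "measure (measure_pmf (draws n)) {\<omega>. chain G r (\<lambda>i. snd (\<omega> i)) n \<notin> T r} \<le> 1/4"
proof -
  have "AE \<omega> in measure_pmf (draws n). \<omega> \<in> {\<omega>. chain G r (\<lambda>i. snd (\<omega> i)) n \<notin> T r} \<longrightarrow> \<omega> \<in> (\<Union>k. bad n k)"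
    unfolding AE_measure_pmf_iff
  proof (intro ballI impI)
    fix \<omega> assume \<omega>: "\<omega> \<in> set_pmf (draws n)" and out: "\<omega> \<in> {\<omega>. chain G r (\<lambda>i. snd (\<omega> i)) n \<notin> T r}"
    have "\<omega> i \<in> set_pmf \<mu>" if "i < n" for i
      using \<omega> that by (auto simp: set_Pi_pmf PiE_dflt_def)
    then have D: "snd (\<omega> i) \<in> D (fst (\<omega> i))" if "i < n" for i
      using that by (fastforce simp: set_\<mu> case_prod_beta)
    show "\<omega> \<in> (\<Union>k. bad n k)"
    proof (rule ccontr)
      assume "\<omega> \<notin> (\<Union>k. bad n k)"
      then have "\<omega> \<notin> bad n k" for k by blast
      from chain_in_T[OF assms this D order_refl] out show False by simp
    qed
  qed
  then have "measure (measure_pmf (draws n)) {\<omega>. chain G r (\<lambda>i. snd (\<omega> i)) n \<notin> T r}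
      \<le> measure (measure_pmf (draws n)) (\<Union>k. bad n k)"
    by (rule measure_pmf.finite_measure_mono_AE) simp
  then show ?thesis using measure_bad_UN[of n] by linarith
qed

lemma pw_T:
  "pw G \<nu> n (indicator (T \<one>)) x = measure (measure_pmf (draws n)) {\<omega>. chain G x (\<lambda>i. snd (\<omega> i)) n \<in> T \<one>}"
proof -
  have "pw G \<nu> n (indicator (T \<one>)) x
      = expect (draws n) (\<lambda>\<omega>. indicator (T \<one>) (chain G x (\<lambda>i. snd (\<omega> i)) n))"
    unfolding \<nu>_def by (rule pw_eq_Pi_pmf[where C = 1]) (rule indicator_abs_le_1)
  also have "\<dots> = expect (draws n) (indicator {\<omega>. chain G x (\<lambda>i. snd (\<omega> i)) n \<in> T \<one>})"
    by (intro expect_cong) (simp add: indicator_def)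
  finally show ?thesis by simp
qed

lemma pw_T_one: "3/4 \<le> pw G \<nu> n (indicator (T \<one>)) \<one>"
proof -
  let ?E = "{\<omega> :: nat \<Rightarrow> nat \<times> 'a. chain G \<one> (\<lambda>i. snd (\<omega> i)) n \<in> T \<one>}"
  have "measure (measure_pmf (draws n)) (- ?E) \<le> 1/4"
    using measure_chain_notin_T[of "\<one>" n] by (simp add: Collect_neg_eq)
  moreover have "measure (measure_pmf (draws n)) (- ?E) = 1 - measure (measure_pmf (draws n)) ?E"
    using measure_pmf.prob_compl[of ?E "draws n"] by (simp add: Compl_eq_Diff_UNIV)
  ultimately show ?thesis by (simp add: pw_T)
qed

lemma pw_T_g0: "pw G \<nu> n (indicator (T \<one>)) g0 \<le> 1/4"
proof -
  have "measure (measure_pmf (draws n)) {\<omega>. chain G g0 (\<lambda>i. snd (\<omega> i)) n \<in> T \<one>}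
      \<le> measure (measure_pmf (draws n)) {\<omega>. chain G g0 (\<lambda>i. snd (\<omega> i)) n \<notin> T g0}"
    by (rule measure_pmf.finite_measure_mono) (use T_disjoint in auto)
  then show ?thesis using measure_chain_notin_T[of g0 n] by (simp add: pw_T)
qed

text \<open>The indicator of \<open>T \<one>\<close> is not claimed to be harmonic, but its
  expectations are at least 3/4 from the identity and at most 1/4 from \<open>g0\<close> at all
  times, and such bounds survive averaging and the limit.\<close>

lemma not_liouville_\<nu>: "\<not> liouville G \<nu>"
proof
  assume L: "liouville G \<nu>"
  let ?f = "\<lambda>_ :: unit. indicator (T \<one>) :: 'a \<Rightarrow> real"
  obtain F \<Phi> where F: "F \<noteq> bot" "F \<le> sequentially"
    and lim: "\<And>i x. ((\<lambda>n. (\<Sum>k<n. pw G \<nu> k (?f i) x) / real n) \<longlongrightarrow> \<Phi> i x) F"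
    and har: "\<And>i. harmonic G \<nu> (\<Phi> i)" "\<And>i x. \<bar>\<Phi> i x\<bar> \<le> 1"
    using averaged_harmonic[of ?f 1 G \<nu>, OF indicator_abs_le_1] by blast
  have pos: "\<forall>\<^sub>F n in F. 0 < n"
    by (rule filter_leD[OF F(2) eventually_gt_at_top])
  have "3/4 \<le> \<Phi> () \<one>"
  proof (rule tendsto_lowerbound[OF lim _ F(1)])
    show "\<forall>\<^sub>F n in F. 3/4 \<le> (\<Sum>k<n. pw G \<nu> k (?f ()) \<one>) / real n"
      using pos
    proof eventually_elim
      case (elim n)
      have "(\<Sum>k<n. 3/4) \<le> (\<Sum>k<n. pw G \<nu> k (?f ()) \<one>)" by (rule sum_mono) (rule pw_T_one)
      then show ?case using elim by (simp add: field_simps)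
    qed
  qed
  moreover have "\<Phi> () g0 \<le> 1/4"
  proof (rule tendsto_upperbound[OF lim _ F(1)])
    show "\<forall>\<^sub>F n in F. (\<Sum>k<n. pw G \<nu> k (?f ()) g0) / real n \<le> 1/4"
      using pos
    proof eventually_elim
      case (elim n)
      have "(\<Sum>k<n. pw G \<nu> k (?f ()) g0) \<le> (\<Sum>k<n. 1/4)" by (rule sum_mono) (rule pw_T_g0)
      then show ?case using elim by (simp add: field_simps)
    qed
  qed
  moreover have "\<Phi> () g0 = \<Phi> () \<one>"
    using L har g0(1) unfolding liouville_def by blast
  ultimately show False by simp
qed

text \<open>Run the walk from \<open>x\<close> until a scale of at least \<open>K\<close> appears.
  Up to \<open>horizon K\<close> the position is normally still in \<open>A K\<close>, and the large
  increment then hides it from \<open>H\<close>. Hence \<open>H\<close> is close to one value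
  \<open>a\<close> both at \<open>x\<close> and at the identity.\<close>

lemma harmonic_F_bound:
  assumes H: "harmonic G \<nu> H" "\<And>x. \<bar>H x\<bar> \<le> 1" "H \<in> F"
    and x: "x \<in> U k"
  shows "\<bar>H x - H \<one>\<bar> \<le> 6 * (1/2) ^ k"
proof -
  define K where "K = Suc k"
  define c where "c j = expect (\<nu>_at j) H" for j
  define V where "V = expect scale_pmf (\<lambda>j. if j < K then 0 else c j)"
  \<comment> \<open>The mean of \<open>H\<close> over a single increment conditioned on its scale
    being at least \<open>K\<close>.\<close>
  define a where "a = V / tail K"
  define \<delta> where "\<delta> = (1/2 :: real) ^ K"
  have t: "0 < tail K" "tail K \<le> 1" by (rule tail_bounds)+
  have c1: "\<bar>c j\<bar> \<le> 1" for j unfolding c_def by (rule expect_abs_le[OF H(2)])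
  have "\<bar>V\<bar> \<le> expect scale_pmf (\<lambda>j. if j < K then 0 else 1)"
  proof -
    have "\<bar>V\<bar> \<le> expect scale_pmf (\<lambda>j. \<bar>if j < K then 0 else c j\<bar>)"
      unfolding V_def by (rule integral_abs_bound)
    also have "\<dots> \<le> expect scale_pmf (\<lambda>j. if j < K then 0 else 1)"
      by (rule expect_mono[where C = 1 and D = 1]) (use c1 in auto)
    finally show ?thesis .
  qed
  also have "\<dots> = tail K" by (simp add: expect_scale_split)
  finally have V1: "\<bar>V\<bar> \<le> tail K" .
  then have a1: "\<bar>a\<bar> \<le> 1" unfolding a_def using t by (simp add: abs_divide divide_le_eq_1)
  have near: "\<bar>expect (\<nu>_at j) (\<lambda>s. H (y \<otimes> s)) - c j\<bar> \<le> \<delta>" if y: "y \<in> A K" and j: "K \<le> j" for y j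
  proof -
    have "y \<in> A j" using A_mono[OF j] y by blast
    then have 1: "\<bar>expect (\<sigma> j) (\<lambda>s. H (y \<otimes> s)) - expect (\<sigma> j) H\<bar> \<le> eps j"
      by (rule almost_invariant[OF H(3)])
    have "expect (\<nu>_at j) (\<lambda>s. H (y \<otimes> s)) - c j =
        eps j * (H (y \<otimes> \<gamma> j) - H (\<gamma> j)) + (1 - eps j) * (expect (\<sigma> j) (\<lambda>s. H (y \<otimes> s)) - expect (\<sigma> j) H)"
      unfolding c_def
      by (subst expect_\<nu>_at[of "\<lambda>s. H (y \<otimes> s)", OF H(2)], subst expect_\<nu>_at[OF H(2)]) (simp add: algebra_simps)
    also have "\<bar>\<dots>\<bar> \<le> eps j * 2 + 1 * eps j"
    proof (rule order_trans[OF abs_triangle_ineq add_mono])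
      have "\<bar>H (y \<otimes> \<gamma> j) - H (\<gamma> j)\<bar> \<le> 2"
        using H(2)[of "y \<otimes> \<gamma> j"] H(2)[of "\<gamma> j"] by linarith
      then show "\<bar>eps j * (H (y \<otimes> \<gamma> j) - H (\<gamma> j))\<bar> \<le> eps j * 2"
        using eps_pos[of j] by (simp add: abs_mult)
      show "\<bar>(1 - eps j) * (expect (\<sigma> j) (\<lambda>s. H (y \<otimes> s)) - expect (\<sigma> j) H)\<bar> \<le> 1 * eps j"
        unfolding abs_mult by (rule mult_mono) (use 1 eps_pos[of j] eps_less_1[of j] in auto)
    qed
    also have "\<dots> \<le> (1/2) ^ j" using eps_le[of j] by (simp add: field_simps)
    also have "\<dots> \<le> \<delta>" unfolding \<delta>_def using j by (intro power_decreasing) auto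
    finally show ?thesis .
  qed
  \<comment> \<open>A word of this length can take \<open>i\<close> further letters from
    \<open>U k\<close> without leaving \<open>A K\<close>; the second term bounds the effect of
    seeing only scales below \<open>K\<close> in all those steps.\<close>
  have main: "\<bar>H y - a\<bar> \<le> \<delta> + 2 * (1 - tail K) ^ i"
    if "y \<in> words G (U k) (horizon K + 3 - i)" "i \<le> horizon K + 2" for y i
    using that
  proof (induction i arbitrary: y)
    case 0
    have "\<bar>H y - a\<bar> \<le> 2" using H(2)[of y] a1 by linarith
    then show ?case by (simp add: \<delta>_def add_increasing)
  next
    case (Suc i)
    let ?r = "1 - tail K"
    have "y \<in> words G (U k) (horizon K + 3)"
      by (rule subsetD[OF words_mono Suc.prems(1)]) (rule diff_le_self)
    then have yA: "y \<in> A K" by (simp only: K_def A_Suc)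
    have yG: "y \<in> carrier G" using A_closed[OF yA] .
    have Hy: "H y = expect scale_pmf (\<lambda>j. expect (\<nu>_at j) (\<lambda>s. H (y \<otimes> s)))"
      using H(1) yG expect_\<nu>[of "\<lambda>s. H (y \<otimes> s)", OF H(2)] by (simp add: harmonic_def)
    \<comment> \<open>This writes \<open>a\<close> in the same shape as the harmonic equation for
      \<open>H y\<close>, so the two can be compared scale by scale.\<close>
    have a_eq: "a = expect scale_pmf (\<lambda>j. if j < K then a else c j)"
    proof -
      have "expect scale_pmf (\<lambda>j. if j < K then a else c j)
          = expect scale_pmf (\<lambda>j. (if j < K then a else 0) + (if j < K then 0 else c j))"
        by (rule expect_cong) simp
      also have "\<dots> = expect scale_pmf (\<lambda>j. if j < K then a else 0) + V"
        unfolding V_def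
        by (rule Bochner_Integration.integral_add; rule integrable_pmf_bounded[where C = 1]) (use c1 a1 in auto)
      also have "\<dots> = (1 - tail K) * a + tail K * a" using t by (simp add: expect_scale_split a_def)
      finally show ?thesis by (simp add: algebra_simps)
    qed
    have i1: "integrable (measure_pmf scale_pmf) (\<lambda>j. expect (\<nu>_at j) (\<lambda>s. H (y \<otimes> s)))"
      by (rule integrable_pmf_bounded[where C = 1]) (rule expect_abs_le[OF H(2)])
    have i2: "integrable (measure_pmf scale_pmf) (\<lambda>j. if j < K then a else c j)"
      by (rule integrable_pmf_bounded[where C = 1]) (use c1 a1 in auto)
    have eq: "H y - a = expect scale_pmf (\<lambda>j. expect (\<nu>_at j) (\<lambda>s. H (y \<otimes> s)) - (if j < K then a else c j))"
      using Hy a_eq Bochner_Integration.integral_diff[OF i1 i2] by linarith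
    have "\<bar>H y - a\<bar> \<le> expect scale_pmf (\<lambda>j. \<bar>expect (\<nu>_at j) (\<lambda>s. H (y \<otimes> s)) - (if j < K then a else c j)\<bar>)"
      unfolding eq by (rule integral_abs_bound)
    also have "\<dots> \<le> expect scale_pmf (\<lambda>j. if j < K then \<delta> + 2 * ?r ^ i else \<delta>)"
    proof (rule expect_mono)
      fix j
      show "\<bar>\<bar>expect (\<nu>_at j) (\<lambda>s. H (y \<otimes> s)) - (if j < K then a else c j)\<bar>\<bar> \<le> 2"
      proof -
        have "\<bar>expect (\<nu>_at j) (\<lambda>s. H (y \<otimes> s))\<bar> \<le> 1" by (rule expect_abs_le[OF H(2)])
        moreover have "\<bar>if j < K then a else c j\<bar> \<le> 1" using c1[of j] a1 by simp
        ultimately show ?thesis by linarith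
      qed
      have "?r ^ i \<le> 1" "0 \<le> ?r ^ i" using t by (auto intro: power_le_one)
      moreover have "0 \<le> \<delta>" by (simp add: \<delta>_def)
      ultimately have "\<bar>\<delta> + 2 * ?r ^ i\<bar> \<le> \<delta> + 2" "\<bar>\<delta>\<bar> \<le> \<delta> + 2" by linarith+
      then show "\<bar>if j < K then \<delta> + 2 * ?r ^ i else \<delta>\<bar> \<le> \<delta> + 2" by (simp only: split: if_split) blast
      show "\<bar>expect (\<nu>_at j) (\<lambda>s. H (y \<otimes> s)) - (if j < K then a else c j)\<bar> \<le> (if j < K then \<delta> + 2 * ?r ^ i else \<delta>)"
      proof (cases "j < K")
        case True
        have "expect (\<nu>_at j) (\<lambda>s. H (y \<otimes> s)) - a = expect (\<nu>_at j) (\<lambda>s. H (y \<otimes> s) - a)"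
          by (subst Bochner_Integration.integral_diff) (auto intro!: integrable_pmf_bounded[where C = 1] H(2))
        also have "\<bar>\<dots>\<bar> \<le> \<delta> + 2 * ?r ^ i"
        proof (rule expect_abs_le)
          fix s assume "s \<in> set_pmf (\<nu>_at j)"
          then have "s \<in> U k" using True D_subset_U[of j k] by (auto simp: set_\<nu>_at K_def)
          then have "y \<otimes> s \<in> words G (U k) (Suc (horizon K + 3 - Suc i))" by (rule words_snoc[OF Suc.prems(1)])
          moreover have "Suc (horizon K + 3 - Suc i) = horizon K + 3 - i" using Suc.prems(2) by simp
          ultimately have "y \<otimes> s \<in> words G (U k) (horizon K + 3 - i)" by (simp only:)
          then show "\<bar>H (y \<otimes> s) - a\<bar> \<le> \<delta> + 2 * ?r ^ i"
            by (rule Suc.IH) (use Suc.prems(2) in simp)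
        qed
        finally show ?thesis using True by simp
      next
        case False
        then show ?thesis using near[OF yA, of j] by simp
      qed
    qed
    finally have le: "\<bar>H y - a\<bar> \<le> expect scale_pmf (\<lambda>j. if j < K then \<delta> + 2 * ?r ^ i else \<delta>)" .
    have "(1 - u) * (d + 2 * q) + u * d = d + 2 * ((1 - u) * q)" for u d q :: real
      by (simp add: algebra_simps)
    from this[of "tail K" \<delta> "?r ^ i"]
    have "expect scale_pmf (\<lambda>j. if j < K then \<delta> + 2 * ?r ^ i else \<delta>) = \<delta> + 2 * ?r ^ Suc i"
      unfolding power_Suc by (rule trans[OF expect_scale_split])
    with le show ?case by linarith
  qed
  have small: "(1 - tail K) ^ (horizon K + 2) \<le> \<delta>"
  proof -
    have "(1 - tail K) ^ (horizon K + 2) \<le> (1 - tail K) ^ Suc (horizon K)"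
      using t by (intro power_decreasing) auto
    also have "\<dots> \<le> (1 - tail (Suc K)) ^ Suc (horizon K)"
      using t tail_mono[of K] by (intro power_mono) auto
    also have "\<dots> \<le> (1/2) ^ K / 32" by (rule horizon)
    also have "\<dots> \<le> \<delta>" by (simp add: \<delta>_def)
    finally show ?thesis .
  qed
  have b: "\<bar>H y - a\<bar> \<le> 3 * \<delta>" if "y \<in> words G (U k) 1" for y
    using main[of y "horizon K + 2"] that small by simp
  have "x \<in> words G (U k) 1" by (rule generator_in_words[OF U_closed x]) simp
  from b[OF this] b[OF one_in_words] have "\<bar>H x - H \<one>\<bar> \<le> 6 * \<delta>" by linarith
  also have "\<dots> \<le> 6 * (1/2) ^ k" by (simp add: \<delta>_def K_def)
  finally show ?thesis .
qed

text \<open>Every element occurs in the enumeration \<open>\<gamma>\<close> and so belongs to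
  \<open>U k\<close> for all large \<open>k\<close>, where the error tends to 0.\<close>

lemma harmonic_F_const:
  assumes H: "harmonic G \<nu> H" "\<And>x. \<bar>H x\<bar> \<le> 1" "H \<in> F" and x: "x \<in> carrier G"
  shows "H x = H \<one>"
proof -
  define j where "j = to_nat x"
  have "x = \<gamma> j" using x by (simp add: \<gamma>_def j_def)
  then have xU: "x \<in> U k" if "j \<le> k" for k using D_subset_U[OF that] by (auto simp: D_def)
  have "(\<lambda>k. 6 * (1/2 :: real) ^ k) \<longlonglongrightarrow> 6 * 0"
    by (intro tendsto_mult tendsto_const LIMSEQ_realpow_zero) auto
  then have "\<bar>H x - H \<one>\<bar> \<le> 6 * 0"
    by (rule LIMSEQ_le_const) (use harmonic_F_bound[OF H xU] in blast)
  then show ?thesis by simp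
qed

end

section \<open>The equivalence\<close>

lemma liouville_iff_poisson_trivial:
  fixes G :: "('a::countable, 'c) monoid_scheme"
  assumes "group G" "prob_on G \<nu>" "nondegenerate G \<nu>"
  shows "liouville G \<nu> \<longleftrightarrow> poisson_trivial G \<nu>"
  using assms poisson_trivial_imp_liouville liouville_imp_poisson_trivial by blast

lemma sgp_gen_hom_image:
  fixes G (structure)
  assumes "group G" "\<pi> \<in> hom G H" "S \<subseteq> carrier G" "x \<in> sgp_gen G S"
  shows "\<pi> x \<in> sgp_gen H (\<pi> ` S)"
  using assms(4)
proof induction
  case (base x)
  then show ?case by (intro sgp_gen.base imageI)
next
  case (mult x y)
  have "x \<in> carrier G" "y \<in> carrier G"
    using mult.hyps sgp_gen_subset[OF assms(1,3)] by blast+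
  then have "\<pi> (x \<otimes> y) = \<pi> x \<otimes>\<^bsub>H\<^esub> \<pi> y" using assms(2) by (simp add: hom_def)
  then show ?case using mult.IH by (simp add: sgp_gen.mult)
qed

lemma map_pmf_hom_prob:
  assumes G: "group G" "group H" and \<pi>: "\<pi> \<in> hom G H" "\<pi> ` carrier G = carrier H"
    and \<nu>: "prob_on G \<nu>" "nondegenerate G \<nu>"
  shows "prob_on H (map_pmf \<pi> \<nu>)" "nondegenerate H (map_pmf \<pi> \<nu>)"
proof -
  show p: "prob_on H (map_pmf \<pi> \<nu>)" using \<nu>(1) \<pi>(2) by (auto simp: prob_on_def)
  show "nondegenerate H (map_pmf \<pi> \<nu>)"
    unfolding nondegenerate_def
  proof
    show "sgp_gen H (set_pmf (map_pmf \<pi> \<nu>)) \<subseteq> carrier H"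
      using sgp_gen_subset[OF G(2) p[unfolded prob_on_def]] by blast
    show "carrier H \<subseteq> sgp_gen H (set_pmf (map_pmf \<pi> \<nu>))"
    proof
      fix y assume "y \<in> carrier H"
      then obtain x where x: "x \<in> carrier G" "y = \<pi> x" using \<pi>(2) by blast
      then have "x \<in> sgp_gen G (set_pmf \<nu>)" using \<nu>(2) by (simp add: nondegenerate_def)
      from sgp_gen_hom_image[OF G(1) \<pi>(1) \<nu>(1)[unfolded prob_on_def] this]
      show "y \<in> sgp_gen H (set_pmf (map_pmf \<pi> \<nu>))" by (simp add: x)
    qed
  qed
qed

lemma harmonic_compose:
  fixes G (structure)
  assumes \<pi>: "\<pi> \<in> hom G H" "\<pi> ` carrier G = carrier H" and \<nu>: "prob_on G \<nu>"
    and h: "harmonic H (map_pmf \<pi> \<nu>) h"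
  shows "harmonic G \<nu> (\<lambda>x. h (\<pi> x))"
  unfolding harmonic_def
proof
  fix x assume x: "x \<in> carrier G"
  then have "\<pi> x \<in> carrier H" using \<pi>(2) by blast
  then have "h (\<pi> x) = expect \<nu> (\<lambda>s. h (\<pi> x \<otimes>\<^bsub>H\<^esub> \<pi> s))" using h by (simp add: harmonic_def)
  also have "\<dots> = expect \<nu> (\<lambda>s. h (\<pi> (x \<otimes> s)))"
    by (rule expect_cong) (use x \<nu> \<pi>(1) in \<open>auto simp: prob_on_def hom_def\<close>)
  finally show "h (\<pi> x) = expect \<nu> (\<lambda>s. h (\<pi> (x \<otimes> s)))" .
qed

text \<open>Here \<open>\<iota>\<close> embeds one direct factor \<open>L\<close> and \<open>\<pi>\<close> projects to the other factor \<open>H\<close>. If \<open>L\<close> had no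
  ICC factor it would act trivially on all bounded harmonic functions, which would then live on \<open>H\<close>.\<close>

lemma icc_factor_of_complement:
  fixes G (structure) and \<iota> :: "'b \<Rightarrow> 'a" and \<pi> :: "'a \<Rightarrow> 'h"
  assumes G: "group G" "prob_on G \<nu>" "nondegenerate G \<nu>" and nl: "\<not> liouville G \<nu>"
    and L: "group L" and \<iota>: "\<iota> \<in> hom L G"
    and conj: "\<And>x. x \<in> carrier G \<Longrightarrow> \<exists>l\<in>carrier L. \<forall>a\<in>carrier L.
       \<iota> a \<otimes> x = x \<otimes> \<iota> (inv\<^bsub>L\<^esub> l \<otimes>\<^bsub>L\<^esub> a \<otimes>\<^bsub>L\<^esub> l)"
    and H: "group H" and \<pi>: "\<pi> \<in> hom G H" and j: "j \<in> hom H G" "\<And>y. y \<in> carrier H \<Longrightarrow> \<pi> (j y) = y"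
    and split: "\<And>x. x \<in> carrier G \<Longrightarrow> \<exists>a\<in>carrier L. x = \<iota> a \<otimes> j (\<pi> x)"
    and liou: "liouville H (map_pmf \<pi> \<nu>)"
  shows "has_nontrivial_icc_factor L"
proof (rule icc_factor_of_not_liouville[OF G nl L \<iota> conj])
  interpret G: group G by fact
  interpret H: group H by fact
  fix h C assume h: "harmonic G \<nu> h" "\<And>x. \<bar>h x\<bar> \<le> C"
    and inv: "\<And>a x. a \<in> carrier L \<Longrightarrow> x \<in> carrier G \<Longrightarrow> h (\<iota> a \<otimes> x) = h x"
  have jG: "j y \<in> carrier G" if "y \<in> carrier H" for y using j(1) that by (auto simp: hom_def)
  have \<pi>H: "\<pi> x \<in> carrier H" if "x \<in> carrier G" for x using \<pi> that by (auto simp: hom_def)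
  have hj: "h x = h (j (\<pi> x))" if x: "x \<in> carrier G" for x
  proof -
    obtain a where a: "a \<in> carrier L" "x = \<iota> a \<otimes> j (\<pi> x)" using split[OF x] by blast
    have "h (\<iota> a \<otimes> j (\<pi> x)) = h (j (\<pi> x))" by (rule inv[OF a(1) jG[OF \<pi>H[OF x]]])
    then show ?thesis using a(2) by simp
  qed
  have "harmonic H (map_pmf \<pi> \<nu>) (\<lambda>y. h (j y))"
    unfolding harmonic_def integral_map_pmf
  proof
    fix y assume y: "y \<in> carrier H"
    have "h (j y) = expect \<nu> (\<lambda>s. h (j y \<otimes> s))" using h(1) jG[OF y] by (simp add: harmonic_def)
    also have "\<dots> = expect \<nu> (\<lambda>s. h (j (y \<otimes>\<^bsub>H\<^esub> \<pi> s)))"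
    proof (rule expect_cong)
      fix s assume "s \<in> set_pmf \<nu>"
      then have s: "s \<in> carrier G" using G(2) by (auto simp: prob_on_def)
      have "\<pi> (j y \<otimes> s) = y \<otimes>\<^bsub>H\<^esub> \<pi> s" using \<pi> jG[OF y] s j(2)[OF y] by (simp add: hom_def)
      then show "h (j y \<otimes> s) = h (j (y \<otimes>\<^bsub>H\<^esub> \<pi> s))" using hj[of "j y \<otimes> s"] jG[OF y] s by simp
    qed
    finally show "h (j y) = expect \<nu> (\<lambda>s. h (j (y \<otimes>\<^bsub>H\<^esub> \<pi> s)))" .
  qed
  then have const: "h (j y) = h (j \<one>\<^bsub>H\<^esub>)" if "y \<in> carrier H" for y
    using liou[unfolded liouville_def, rule_format, of "\<lambda>y. h (j y)" C y] h(2) that by simp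
  have "j \<one>\<^bsub>H\<^esub> = \<one>" using hom_one[OF j(1) H G(1)] .
  show "\<forall>x\<in>carrier G. h x = h \<one>"
  proof
    fix x assume x: "x \<in> carrier G"
    show "h x = h \<one>" using hj[OF x] const[OF \<pi>H[OF x]] \<open>j \<one>\<^bsub>H\<^esub> = \<one>\<close> by simp
  qed
qed

lemma amenable_icc_imp_measure:
  fixes G1 :: "('a::countable, 'c) monoid_scheme" and G2 :: "('b::countable, 'd) monoid_scheme"
  assumes G1: "group G1" "amenable G1" "has_nontrivial_icc_factor G1"
    and G2: "group G2" "amenable G2" "has_nontrivial_icc_factor G2"
  obtains \<nu> where "prob_on (G1 \<times>\<times> G2) \<nu>" "nondegenerate (G1 \<times>\<times> G2) \<nu>" "\<not> liouville (G1 \<times>\<times> G2) \<nu>"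
    "liouville G1 (map_pmf fst \<nu>)" "liouville G2 (map_pmf snd \<nu>)"
proof -
  interpret G1: group G1 by fact
  interpret G2: group G2 by fact
  obtain N1 where N1: "N1 \<lhd> G1" "N1 \<noteq> carrier G1" "icc (G1 Mod N1)"
    using G1(3) unfolding has_nontrivial_icc_factor_def by blast
  obtain N2 where N2: "N2 \<lhd> G2" "N2 \<noteq> carrier G2" "icc (G2 Mod N2)"
    using G2(3) unfolding has_nontrivial_icc_factor_def by blast
  let ?G = "G1 \<times>\<times> G2"
  let ?\<pi>1 = "\<lambda>x. N1 #>\<^bsub>G1\<^esub> x"
  let ?\<pi>2 = "\<lambda>x. N2 #>\<^bsub>G2\<^esub> x"
  have Q1: "icc_quotient G1 (G1 Mod N1) ?\<pi>1" by (rule icc_quotient_Mod[OF G1(1,2) N1])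
  have Q2: "icc_quotient G2 (G2 Mod N2) ?\<pi>2" by (rule icc_quotient_Mod[OF G2(1,2) N2])
  interpret Q1: icc_quotient G1 "G1 Mod N1" ?\<pi>1 by (rule Q1)
  have "\<exists>q\<in>carrier (G1 Mod N1). q \<noteq> \<one>\<^bsub>G1 Mod N1\<^esub>" by (rule Q1.nontriv)
  then obtain g where g: "g \<in> carrier G1" "?\<pi>1 g \<noteq> ?\<pi>1 \<one>\<^bsub>G1\<^esub>"
    unfolding Q1.surj[symmetric] Q1.\<pi>_one by blast
  have "scale_system ?G (map_prod ?\<pi>1 ?\<pi>2) coord_functions (g, \<one>\<^bsub>G2\<^esub>)"
  proof (intro scale_system.intro scale_system_axioms.intro)
    show "group ?G" by (rule DirProd_group[OF G1(1) G2(1)])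
    show "\<exists>\<sigma>. scale_step ?G (map_prod ?\<pi>1 ?\<pi>2) coord_functions A e \<sigma>"
      if "finite A" "A \<subseteq> carrier ?G" "0 < e" for A e
      using product_scale_step[OF Q1 Q2 that] by blast
  qed (use g in \<open>auto simp: DirProd_def\<close>)
  then interpret S: scale_system ?G "map_prod ?\<pi>1 ?\<pi>2" coord_functions "(g, \<one>\<^bsub>G2\<^esub>)" .
  \<comment> \<open>Both projections are treated at once: a bounded harmonic function of the image
    walk, scaled and pulled back, becomes a harmonic coordinate function on the product.\<close>
  have const: "h x = h \<one>\<^bsub>H\<^esub>"
    if H: "group H" and \<pi>: "\<pi> \<in> hom ?G H" "\<pi> ` carrier ?G = carrier H"
      and F: "\<And>f. (\<And>x. \<bar>f x\<bar> \<le> 1) \<Longrightarrow> (\<lambda>x. f (\<pi> x)) \<in> coord_functions"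
      and h: "harmonic H (map_pmf \<pi> S.\<nu>) h" "\<And>x. \<bar>h x\<bar> \<le> C" and x: "x \<in> carrier H"
    for H :: "('h, 'e) monoid_scheme" and \<pi> h C x
  proof -
    \<comment> \<open>Coordinate functions are bounded by 1, hence the scaling; adding 1 keeps the
      divisor positive.\<close>
    define D where "D = \<bar>C\<bar> + 1"
    have D: "0 < D" by (simp add: D_def)
    define f where "f x = (1 / D) * h x + 0" for x
    have f1: "\<bar>f x\<bar> \<le> 1" for x
    proof -
      have "\<bar>h x\<bar> \<le> D" using h(2)[of x] by (simp add: D_def)
      then show ?thesis using D by (simp add: f_def abs_mult)
    qed
    have "harmonic H (map_pmf \<pi> S.\<nu>) f" unfolding f_def by (rule harmonic_affine[OF h])
    from harmonic_compose[OF \<pi> S.\<nu>_prob_on this]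
    have har: "harmonic ?G S.\<nu> (\<lambda>x. f (\<pi> x))" .
    obtain y where y: "y \<in> carrier ?G" "x = \<pi> y" using \<pi>(2) x by blast
    have "f (\<pi> y) = f (\<pi> \<one>\<^bsub>?G\<^esub>)"
      by (rule S.harmonic_F_const[OF har _ F y(1)]) (rule f1)+
    moreover have "\<pi> \<one>\<^bsub>?G\<^esub> = \<one>\<^bsub>H\<^esub>"
      by (rule hom_one[OF \<pi>(1) DirProd_group[OF G1(1) G2(1)] H])
    ultimately show ?thesis using D by (simp add: f_def y(2))
  qed
  show ?thesis
  proof (rule that[OF S.\<nu>_prob_on S.\<nu>_nondegenerate S.not_liouville_\<nu>])
    show "liouville G1 (map_pmf fst S.\<nu>)"
      unfolding liouville_def
    proof (intro allI impI ballI)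
      fix h C x assume h: "harmonic G1 (map_pmf fst S.\<nu>) h" "\<forall>x. \<bar>h x\<bar> \<le> C" "x \<in> carrier G1"
      show "h x = h \<one>\<^bsub>G1\<^esub>"
      proof (rule const[OF G1(1) _ _ _ h(1) _ h(3)])
        show "fst \<in> hom ?G G1" by (auto simp: hom_def DirProd_def)
        show "fst ` carrier ?G = carrier G1" by (force simp: DirProd_def)
        show "(\<lambda>x. f (fst x)) \<in> coord_functions" if "\<And>x. \<bar>f x\<bar> \<le> 1" for f
          using that unfolding coord_functions_def comp_def by blast
        show "\<bar>h x\<bar> \<le> C" for x using h(2) by blast
      qed
    qed
    show "liouville G2 (map_pmf snd S.\<nu>)"
      unfolding liouville_def
    proof (intro allI impI ballI)
      fix h C x assume h: "harmonic G2 (map_pmf snd S.\<nu>) h" "\<forall>x. \<bar>h x\<bar> \<le> C" "x \<in> carrier G2"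
      show "h x = h \<one>\<^bsub>G2\<^esub>"
      proof (rule const[OF G2(1) _ _ _ h(1) _ h(3)])
        show "snd \<in> hom ?G G2" by (auto simp: hom_def DirProd_def)
        show "snd ` carrier ?G = carrier G2" by (force simp: DirProd_def)
        show "(\<lambda>x. f (snd x)) \<in> coord_functions" if "\<And>x. \<bar>f x\<bar> \<le> 1" for f
          using that unfolding coord_functions_def comp_def by blast
        show "\<bar>h x\<bar> \<le> C" for x using h(2) by blast
      qed
    qed
  qed
qed

theorem theoremB:
  fixes G1 :: "('a::countable, 'c) monoid_scheme" and G2 :: "('b::countable, 'd) monoid_scheme"
  assumes "group G1" and "group G2"
  shows "(\<exists>\<nu> :: ('a \<times> 'b) pmf.
            prob_on (G1 \<times>\<times> G2) \<nu> \<and> nondegenerate (G1 \<times>\<times> G2) \<nu> \<and>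
            \<not> poisson_trivial (G1 \<times>\<times> G2) \<nu> \<and>
            poisson_trivial G1 (map_pmf fst \<nu>) \<and> poisson_trivial G2 (map_pmf snd \<nu>))
         \<longleftrightarrow> amenable G1 \<and> amenable G2 \<and>
             has_nontrivial_icc_factor G1 \<and> has_nontrivial_icc_factor G2"
proof -
  interpret G1: group G1 by fact
  interpret G2: group G2 by fact
  let ?G = "G1 \<times>\<times> G2"
  have G: "group ?G" by (rule DirProd_group) fact+
  have fst: "fst \<in> hom ?G G1" "fst ` carrier ?G = carrier G1"
    by (auto simp: hom_def DirProd_def image_iff intro!: bexI[of _ "(_, \<one>\<^bsub>G2\<^esub>)"])
  have snd: "snd \<in> hom ?G G2" "snd ` carrier ?G = carrier G2"
    by (auto simp: hom_def DirProd_def image_iff intro!: bexI[of _ "(\<one>\<^bsub>G1\<^esub>, _)"])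
  have eq: "(prob_on ?G \<nu> \<and> nondegenerate ?G \<nu> \<and> \<not> poisson_trivial ?G \<nu> \<and>
       poisson_trivial G1 (map_pmf fst \<nu>) \<and> poisson_trivial G2 (map_pmf snd \<nu>)) \<longleftrightarrow>
     (prob_on ?G \<nu> \<and> nondegenerate ?G \<nu> \<and> \<not> liouville ?G \<nu> \<and>
       liouville G1 (map_pmf fst \<nu>) \<and> liouville G2 (map_pmf snd \<nu>))" for \<nu> :: "('a \<times> 'b) pmf"
    using liouville_iff_poisson_trivial[OF G] liouville_iff_poisson_trivial[OF assms(1) map_pmf_hom_prob[OF G assms(1) fst]]
      liouville_iff_poisson_trivial[OF assms(2) map_pmf_hom_prob[OF G assms(2) snd]] by metis
  show ?thesis
    unfolding eq
  proof (intro iffI conjI; (elim exE conjE)?)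
    fix \<nu> :: "('a \<times> 'b) pmf"
    assume \<nu>: "prob_on ?G \<nu>" "nondegenerate ?G \<nu>" and nl: "\<not> liouville ?G \<nu>"
      and l1: "liouville G1 (map_pmf fst \<nu>)" and l2: "liouville G2 (map_pmf snd \<nu>)"
    show "amenable G1" by (rule liouville_imp_amenable[OF assms(1) map_pmf_hom_prob(1)[OF G assms(1) fst \<nu>] l1])
    show "amenable G2" by (rule liouville_imp_amenable[OF assms(2) map_pmf_hom_prob(1)[OF G assms(2) snd \<nu>] l2])
    \<comment> \<open>The roles cross: the trivial boundary of \<open>G2\<close> forces an ICC
      factor of \<open>G1\<close>. The conjugator for \<open>x\<close> is its own first coordinate,
      as the second commutes with the embedded \<open>G1\<close>.\<close>
    show "has_nontrivial_icc_factor G1"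
    proof (rule icc_factor_of_complement[OF G \<nu> nl assms(1) _ _ assms(2) snd(1) _ _ _ l2,
          where \<iota> = "\<lambda>a. (a, \<one>\<^bsub>G2\<^esub>)" and j = "\<lambda>b. (\<one>\<^bsub>G1\<^esub>, b)"])
      fix x assume x: "x \<in> carrier ?G"
      then show "\<exists>l\<in>carrier G1. \<forall>a\<in>carrier G1. (a, \<one>\<^bsub>G2\<^esub>) \<otimes>\<^bsub>?G\<^esub> x = x \<otimes>\<^bsub>?G\<^esub> (inv\<^bsub>G1\<^esub> l \<otimes>\<^bsub>G1\<^esub> a \<otimes>\<^bsub>G1\<^esub> l, \<one>\<^bsub>G2\<^esub>)"
        by (intro bexI[of _ "fst x"]) (auto simp: DirProd_def G1.m_assoc[symmetric])
      show "\<exists>a\<in>carrier G1. x = (a, \<one>\<^bsub>G2\<^esub>) \<otimes>\<^bsub>?G\<^esub> (\<one>\<^bsub>G1\<^esub>, snd x)"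
        using x by (intro bexI[of _ "fst x"]) (auto simp: DirProd_def)
    qed (auto simp: hom_def DirProd_def)
    show "has_nontrivial_icc_factor G2"
    proof (rule icc_factor_of_complement[OF G \<nu> nl assms(2) _ _ assms(1) fst(1) _ _ _ l1,
          where \<iota> = "\<lambda>b. (\<one>\<^bsub>G1\<^esub>, b)" and j = "\<lambda>a. (a, \<one>\<^bsub>G2\<^esub>)"])
      fix x assume x: "x \<in> carrier ?G"
      then show "\<exists>l\<in>carrier G2. \<forall>b\<in>carrier G2. (\<one>\<^bsub>G1\<^esub>, b) \<otimes>\<^bsub>?G\<^esub> x = x \<otimes>\<^bsub>?G\<^esub> (\<one>\<^bsub>G1\<^esub>, inv\<^bsub>G2\<^esub> l \<otimes>\<^bsub>G2\<^esub> b \<otimes>\<^bsub>G2\<^esub> l)"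
        by (intro bexI[of _ "snd x"]) (auto simp: DirProd_def G2.m_assoc[symmetric])
      show "\<exists>b\<in>carrier G2. x = (\<one>\<^bsub>G1\<^esub>, b) \<otimes>\<^bsub>?G\<^esub> (fst x, \<one>\<^bsub>G2\<^esub>)"
        using x by (intro bexI[of _ "snd x"]) (auto simp: DirProd_def)
    qed (auto simp: hom_def DirProd_def)
  next
    assume a: "amenable G1" "amenable G2" "has_nontrivial_icc_factor G1" "has_nontrivial_icc_factor G2"
    obtain \<nu> :: "('a \<times> 'b) pmf" where "prob_on ?G \<nu>" "nondegenerate ?G \<nu>" "\<not> liouville ?G \<nu>"
      "liouville G1 (map_pmf fst \<nu>)" "liouville G2 (map_pmf snd \<nu>)"
      by (rule amenable_icc_imp_measure[OF assms(1) a(1,3) assms(2) a(2,4)])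
    then show "\<exists>\<nu> :: ('a \<times> 'b) pmf. prob_on ?G \<nu> \<and> nondegenerate ?G \<nu> \<and> \<not> liouville ?G \<nu> \<and>
       liouville G1 (map_pmf fst \<nu>) \<and> liouville G2 (map_pmf snd \<nu>)" by blast
  qed
qed

end
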